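(* Let $0\le q\in L_1^{\mathrm{loc}}(\mathbb R)$ satisfy $\int_{-\infty}^x q(t)\,dt>0$ and $\int_x^\infty q(t)\,dt>0$ for all $x\in\mathbb R$. Let $\mu,\theta$ be positive continuous functions on $\mathbb R$, let $p\in[1,\infty)$, and suppose that $\int_{-\infty}^0\mu(t)\,dt=\int_0^\infty\mu(t)\,dt=\infty$. Let $q\in H$, and suppose that the pair $\{L_{p,\mu};L_{p,\theta}\}$ agrees with the equation $$-y''(x)+q(x)y(x)=f(x),\quad x\in\mathbb R.$$ Then this pair is admissible for this equation if and only if $m(q,\mu,\theta)<\infty$, where $$m(q,\mu,\theta)=\sup_{x\in\mathbb R}\left(\frac{\mu(x)}{\theta(x)}d^2(x)\right).$$
   Context: $L_{p,\mu}=\{f\in L_p^{\mathrm{loc}}(\mathbb R):\|f\|_{p,\mu}^p=\int_{-\infty}^\infty|\mu(x)f(x)|^pdx<\infty\}$, and $L_{p,\theta}$, $\|\cdot\|_{p,\theta}$ are defined in the same way with $\theta$ in place of $\mu$. A solution of $-y''+qy=f$ (with $f\in L_p^{\mathrm{loc}}(\mathbb R)$) is a function $y$ which is (locally) absolutely continuous together with its derivative and satisfies the equation almost everywhere on $\mathbb R$. The pair $\{L_{p,\mu};L_{p,\theta}\}$ is called admissible for the equation if: (I) for every $f\in L_{p,\theta}$ there is a unique solution $y\in L_{p,\mu}$ of the equation; (II) there is a constant $c(p)\in(0,\infty)$ such that for every $f\in L_{p,\theta}$ the solution $y\in L_{p,\mu}$ satisfies $\|y\|_{p,\mu}\le c(p)\|f\|_{p,\theta}$.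 The function $d$: under the stated assumptions on $q$, for each $x\in\mathbb R$ the equation $\int_0^{\sqrt2 d}\int_{x-t}^{x+t}q(\xi)\,d\xi\,dt=2$ in $d\ge0$ has a unique finite positive solution, denoted $d(x)$. Class $H$: $q\in H$ means $\lim_{|x|\to\infty}\nu(x)=0$, where $\nu(x)=d(x)\int_0^{\sqrt2d(x)}(q(x+t)-q(x-t))\,dt$. Agreement: for $q\in H$, the pair of weights $\{\mu,\theta\}$ agrees with $q$ (equivalently, by definition, the pair $\{L_{p,\mu};L_{p,\theta}\}$, $p\in[1,\infty)$, agrees with the equation) if for any $\varepsilon>0$ there is a constant $c(\varepsilon)\in[1,\infty)$ such that for all $t,x\in\mathbb R$ each of the two quantities $\sqrt{\frac{d(t)}{d(x)}}\,\frac{\mu(t)}{\mu(x)}$ and $\sqrt{\frac{d(t)}{d(x)}}\,\frac{\theta(x)}{\theta(t)}$ is at least $c(\varepsilon)^{-1}\exp\left(-\varepsilon\left|\int_x^t\frac{d\xi}{d(\xi)}\right|\right)$ and at most $c(\varepsilon)\exp\left(\varepsilon\left|\int_x^t\frac{d\xi}{d(\xi)}\right|\right)$. *)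

theory Defs
  imports "HOL-Analysis.Analysis"
begin

section \<open>Local integrability and weighted Lebesgue spaces\<close>

definition L1_loc :: "(real \<Rightarrow> real) \<Rightarrow> bool" where
  "L1_loc f \<longleftrightarrow> (\<forall>a b. set_integrable lebesgue {a..b} f)"

definition Lp_loc :: "real \<Rightarrow> (real \<Rightarrow> real) set" where
  "Lp_loc p = {f. f \<in> borel_measurable lebesgue \<and>
     (\<forall>a b. set_integrable lebesgue {a..b} (\<lambda>x. \<bar>f x\<bar> powr p))}"

text \<open>Functions equal almost everywhere are not identified.\<close>

definition Lp_weighted :: "real \<Rightarrow> (real \<Rightarrow> real) \<Rightarrow> (real \<Rightarrow> real) set" where
  "Lp_weighted p w = {f \<in> Lp_loc p. integrable lebesgue (\<lambda>x. \<bar>w x * f x\<bar> powr p)}"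

definition norm_weighted :: "real \<Rightarrow> (real \<Rightarrow> real) \<Rightarrow> (real \<Rightarrow> real) \<Rightarrow> real" where
  "norm_weighted p w f = (LINT x|lebesgue. \<bar>w x * f x\<bar> powr p) powr (1 / p)"


section \<open>Solutions and admissibility\<close>

text \<open>A finite family of non-overlapping compact intervals contained in \<open>{a..b}\<close> is
  a division of its own union \<open>t \<subseteq> {a..b}\<close>.\<close>

definition absolutely_continuous_on_interval :: "(real \<Rightarrow> real) \<Rightarrow> real \<Rightarrow> real \<Rightarrow> bool" where
  "absolutely_continuous_on_interval f a b \<longleftrightarrow>
     (\<forall>\<epsilon>>0. \<exists>\<delta>>0. \<forall>\<D> t. \<D> division_of t \<and> t \<subseteq> {a..b} \<and> (\<Sum>k\<in>\<D>. measure lborel k) < \<delta>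
        \<longrightarrow> (\<Sum>k\<in>\<D>. \<bar>f (Sup k) - f (Inf k)\<bar>) < \<epsilon>)"

definition locally_absolutely_continuous :: "(real \<Rightarrow> real) \<Rightarrow> bool" where
  "locally_absolutely_continuous f \<longleftrightarrow> (\<forall>a b. absolutely_continuous_on_interval f a b)"

text \<open>The equation is \<open>- y'' + q y = f\<close> almost everywhere.\<close>

definition is_solution :: "(real \<Rightarrow> real) \<Rightarrow> (real \<Rightarrow> real) \<Rightarrow> (real \<Rightarrow> real) \<Rightarrow> bool" where
  "is_solution q f y \<longleftrightarrow>
     (\<forall>x. y differentiable at x) \<and>
     locally_absolutely_continuous y \<and>
     locally_absolutely_continuous (deriv y) \<and>
     (AE x in lebesgue. deriv y differentiable at x \<and> - deriv (deriv y) x + q x * y x = f x)"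

definition admissible ::
  "real \<Rightarrow> (real \<Rightarrow> real) \<Rightarrow> (real \<Rightarrow> real) \<Rightarrow> (real \<Rightarrow> real) \<Rightarrow> bool" where
  "admissible p \<mu> \<theta> q \<longleftrightarrow>
     (\<forall>f \<in> Lp_weighted p \<theta>. \<exists>!y. is_solution q f y \<and> y \<in> Lp_weighted p \<mu>) \<and>
     (\<exists>c>0. \<forall>f \<in> Lp_weighted p \<theta>. \<forall>y. is_solution q f y \<and> y \<in> Lp_weighted p \<mu>
        \<longrightarrow> norm_weighted p \<mu> y \<le> c * norm_weighted p \<theta> f)"


section \<open>The auxiliary function, the class H and agreement\<close>

text \<open>The value is meaningful only for those \<open>q\<close> for which the defining equation has a unique
  solution, such as the locally integrable \<open>q \<ge> 0\<close> with positive mass on every half-line.\<close>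

definition d_fun :: "(real \<Rightarrow> real) \<Rightarrow> real \<Rightarrow> real" where
  "d_fun q x = (THE s. s \<ge> 0 \<and>
     (LINT t=0..sqrt 2 * s|lebesgue. (LINT \<xi>=x - t..x + t|lebesgue. q \<xi>)) = 2)"

definition nu_fun :: "(real \<Rightarrow> real) \<Rightarrow> real \<Rightarrow> real" where
  "nu_fun q x = d_fun q x * (LINT t=0..sqrt 2 * d_fun q x|lebesgue. (q (x + t) - q (x - t)))"

definition class_H :: "(real \<Rightarrow> real) set" where
  "class_H = {q. (nu_fun q \<longlongrightarrow> 0) at_infinity}"

definition agrees :: "(real \<Rightarrow> real) \<Rightarrow> (real \<Rightarrow> real) \<Rightarrow> (real \<Rightarrow> real) \<Rightarrow> bool" where
  "agrees \<mu> \<theta> q \<longleftrightarrow>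
     (\<forall>\<epsilon>>0. \<exists>c\<ge>1. \<forall>t x.
        let I = \<bar>LINT \<xi>=x..t|lebesgue. (1 / d_fun q \<xi>)\<bar>;
            A = sqrt (d_fun q t / d_fun q x) * (\<mu> t / \<mu> x);
            B = sqrt (d_fun q t / d_fun q x) * (\<theta> x / \<theta> t)
        in inverse c * exp (- \<epsilon> * I) \<le> A \<and> A \<le> c * exp (\<epsilon> * I) \<and>
           inverse c * exp (- \<epsilon> * I) \<le> B \<and> B \<le> c * exp (\<epsilon> * I))"

definition m_fun :: "(real \<Rightarrow> real) \<Rightarrow> (real \<Rightarrow> real) \<Rightarrow> (real \<Rightarrow> real) \<Rightarrow> ereal" where
  "m_fun q \<mu> \<theta> = (SUP x. ereal (\<mu> x / \<theta> x * (d_fun q x)\<^sup>2))"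

end

theory Submission
  imports Defs
begin

text \<open>Write \<open>r = sqrt 2 * d\<close>, so that the integral of \<open>q\<close> over \<open>{x - t..x + t}\<close>, integrated over
  \<open>t\<close> in \<open>{0..r x}\<close>, equals \<open>2\<close>; this makes \<open>r\<close> Lipschitz with constant \<open>1\<close>. Let \<open>u\<close> increase
  and \<open>v\<close> decrease, both positive solutions of \<open>y'' = q y\<close> with Wronskian \<open>1\<close>. Convexity on the window
  gives \<open>u v \<le> r\<close>, hence \<open>(ln (u / v))' = 1 / (u v) \<ge> 1 / r\<close>, so for \<open>x \<le> t\<close> the Green function
  \<open>u x * v t\<close> is at most \<open>sqrt (r x * r t)\<close> times the exponential of \<open>- 1 / 2\<close> times the integral of
  \<open>1 / r\<close> from \<open>x\<close> to \<open>t\<close>. If \<open>\<mu> d\<^sup>2 / \<theta>\<close> is bounded, agreement turns this into a bound of the weighted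
  kernel by a decaying exponential times \<open>min (1 / r x) (1 / r t)\<close>, and Schur's test applies for every
  \<open>p\<close>. Uniqueness holds because a nonzero solution of \<open>y'' = q y\<close> grows at least linearly at one end,
  which is incompatible with the divergence of the integrals of \<open>\<mu>\<close>.

  Conversely, let \<open>f\<close> be the indicator function of the window of radius \<open>r x / 4\<close> around \<open>x\<close>. The same growth
  argument shows that the solution is nonnegative; a second difference over the window forces it to be of
  order \<open>(r x)\<^sup>2\<close> somewhere, and \<open>y'' \<ge> - 1\<close> keeps it so on a set of measure of order \<open>r x\<close>. By agreement
  \<open>\<mu>\<close> and \<open>\<theta>\<close> are comparable to constants near \<open>x\<close>, so admissibility bounds \<open>\<mu> x * (d x)\<^sup>2 / \<theta> x\<close>.\<close>

section \<open>Absolute continuity and indefinite integrals\<close>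

text \<open>The equation is treated as the first-order system \<open>y' = z\<close>,
  \<open>z' = q y - f\<close>, each line read as an indefinite integral, because \<open>z\<close> is
  differentiable only almost everywhere; the relation \<open>primitive\<close> carries this
  calculus. Agreement is applied with \<epsilon> = 1/4 and so costs half of the decay rate 1/2 of
  the Green function. Its quotient for \<theta> moves the weight from \<open>t\<close> to
  \<open>x\<close> and leaves the factor \<open>1 / r x\<close>; its quotient for \<mu> moves it
  from \<open>x\<close> to \<open>t\<close> and leaves \<open>1 / r t\<close>. Schur's test needs
  both: with \<open>R\<close> a primitive of \<open>1 / r\<close>, the measure
  \<open>dt / r t\<close> is \<open>dR\<close>, against which the remaining exponential has a
  uniformly bounded integral. The obstacle in uniqueness is that the guaranteed growth is only
  linear while divergence is known for the integrals of \<mu> itself and not of its p-th power;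
  comparison with \<open>|x| powr (- 1 - 1 / p)\<close> bridges the two. In the converse, the radius
  \<open>r x / 4\<close> keeps all relevant points within \<open>r x / 2\<close> of
  \<open>x\<close>, where \<open>r\<close> changes by a bounded factor and \<open>R\<close> by at
  most 1.\<close>

text \<open>Two pairs with different tags and the same interval force that interval to have empty
  interior, hence to be a single point, where \<open>h\<close> vanishes. This turns a tagged sum
  into one over a plain division, the form in which absolute continuity can be applied.\<close>

lemma tagged_sum_over_intervals:
  fixes h :: "real set \<Rightarrow> real"
  assumes p: "p tagged_partial_division_of S"
    and h: "\<And>u. h {u..u} = 0"
  shows "(\<Sum>(x,K)\<in>p. h K) = (\<Sum>K\<in>snd ` p. h K)"
proof -
  have "(\<Sum>K\<in>snd ` p. h K) = sum (h \<circ> snd) p"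
  proof (rule sum.reindex_nontrivial)
    show "finite p" using p by (auto dest: tagged_partial_division_ofD)
    fix a b assume ab: "a \<in> p" "b \<in> p" "a \<noteq> b" "snd a = snd b"
    obtain x K y where a: "a = (x,K)" and b: "b = (y,K)" using ab(4) by (metis prod.collapse)
    have "interior K \<inter> interior K = {}"
      using tagged_partial_division_ofD(5)[OF p, of x K y K] ab a b by auto
    moreover obtain u v where K: "K = {u..v}" using tagged_partial_division_ofD(4)[OF p] ab(1) a by fastforce
    moreover have "x \<in> K" using tagged_partial_division_ofD(2)[OF p] ab(1) a by blast
    ultimately have "K = {u..u}" by auto
    then show "h (snd a) = 0" using h a by simp
  qed
  then show ?thesis by (simp add: case_prod_beta o_def)
qed

lemma content_Sup_Inf:
  fixes K :: "real set"
  assumes "x \<in> K" "\<exists>a b. K = cbox a b"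
  shows "measure lborel K = Sup K - Inf K" "Inf K \<le> x" "x \<le> Sup K" "Inf K \<in> K" "Sup K \<in> K" "K = {Inf K..Sup K}"
  using assms by auto

text \<open>In the Riemann sums of the derivative the tags in the exceptional null set are confined to
  intervals of small total length, on which the increments of \<open>f\<close> are small.\<close>

lemma absolutely_continuous_FTC:
  assumes ab: "a \<le> b" and ac: "absolutely_continuous_on_interval f a b"
    and N: "negligible N"
    and deriv: "\<And>x. x \<in> {a..b} - N \<Longrightarrow> (f has_real_derivative g x) (at x)"
  shows "(g has_integral f b - f a) {a..b}"
proof -
  define g' where "g' x = (if x \<in> N then 0 else g x)" for x
  have "(g' has_integral f b - f a) {a..b}"
    unfolding has_integral_real
  proof (intro allI impI)
    fix e :: real assume e: "e > 0"
    \<comment> \<open>The differentiability errors add up to at most \<eta> times the total length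
      \<open>b - a\<close>; the summand 1 in the denominator covers \<open>a = b\<close>.\<close>
    define \<eta> where "\<eta> = e / (2 * (b - a + 1))"
    have \<eta>: "\<eta> > 0" using e ab by (simp add: \<eta>_def)
    have \<eta>2: "\<eta> * (b - a) \<le> e / 2"
      using e ab by (simp add: \<eta>_def field_simps)
    obtain \<delta> where \<delta>: "\<delta> > 0" and ac': "\<And>p t. p division_of t \<Longrightarrow> t \<subseteq> {a..b} \<Longrightarrow>
        (\<Sum>k\<in>p. measure lborel k) < \<delta> \<Longrightarrow> (\<Sum>k\<in>p. \<bar>f (Sup k) - f (Inf k)\<bar>) < e / 2"
      using ac e unfolding absolutely_continuous_on_interval_def by (meson half_gt_zero)
    have "N \<in> sets lebesgue" using N by (simp add: negligible_imp_sets)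
    then obtain U where U: "open U" "N \<subseteq> U" "U - N \<in> lmeasurable" "emeasure lebesgue (U - N) < ennreal \<delta>"
      using \<delta> by (rule sets_lebesgue_outer_open)
    have Um: "U \<in> lmeasurable" and mU: "measure lebesgue U < \<delta>"
    proof -
      have Ueq: "U = (U - N) \<union> N" using U by auto
      show "U \<in> lmeasurable" by (subst Ueq) (use U N negligible_imp_measurable in blast)
      have "measure lebesgue (U - N) < \<delta>"
        using U(3,4) \<delta> by (simp add: emeasure_eq_measure2 ennreal_less_iff)
      then show "measure lebesgue U < \<delta>"
        using \<open>U \<in> lmeasurable\<close> N
        by (simp add: measure_Diff_null_set negligible_iff_null_sets fmeasurableD)
    qed
    have ex: "\<exists>d>0. \<forall>y. \<bar>y - x\<bar> < d \<longrightarrow> \<bar>f y - f x - g x * (y - x)\<bar> \<le> \<eta> * \<bar>y - x\<bar>"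
      if "x \<in> {a..b} - N" for x
    proof -
      have "(f has_derivative (*) (g x)) (at x)" using deriv[OF that] by (simp add: has_field_derivative_def)
      then show ?thesis using \<eta> unfolding has_derivative_at_alt by auto
    qed
    then obtain d where d: "\<And>x. x \<in> {a..b} - N \<Longrightarrow> d x > 0"
      "\<And>x y. x \<in> {a..b} - N \<Longrightarrow> \<bar>y - x\<bar> < d x \<Longrightarrow> \<bar>f y - f x - g x * (y - x)\<bar> \<le> \<eta> * \<bar>y - x\<bar>"
      by metis
    have "\<exists>r>0. ball x r \<subseteq> U" if "x \<in> N" for x
      using U that by (meson open_contains_ball subsetD)
    then obtain r where r: "\<And>x. x \<in> N \<Longrightarrow> r x > 0" "\<And>x. x \<in> N \<Longrightarrow> ball x (r x) \<subseteq> U"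
      by metis
    \<comment> \<open>At tags in \<open>N\<close> the gauge keeps the interval inside the small open
      set \<open>U\<close>; at the other tags of the interval it enforces the linear approximation
      of \<open>f\<close>.\<close>
    define \<gamma> where "\<gamma> x = (if x \<in> N then ball x (r x) else if x \<in> {a..b} then ball x (d x) else ball x 1)" for x
    have gauge: "gauge \<gamma>"
      using r d by (auto simp: gauge_def \<gamma>_def)
    have "norm ((\<Sum>(x, k)\<in>p. measure lborel k *\<^sub>R g' x) - (f b - f a)) < e"
      if p: "p tagged_division_of {a..b}" and fine: "\<gamma> fine p" for p
    proof -
      define D where "D k = f (Sup k) - f (Inf k)" for k
      have fin: "finite p" using p by blast
      have part: "p tagged_partial_division_of {a..b}" using p by (simp add: tagged_division_of_def)
      have D: "(\<Sum>(x, k)\<in>p. D k) = f b - f a"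
        using additive_tagged_division_1[OF ab p, of f] by (simp add: D_def)
      define p1 where "p1 = {(x,k)\<in>p. x \<in> N}"
      define p2 where "p2 = {(x,k)\<in>p. x \<notin> N}"
      have split: "p = p1 \<union> p2" "p1 \<inter> p2 = {}" "finite p1" "finite p2"
        using fin by (auto simp: p1_def p2_def intro: finite_subset[OF _ fin])
      have part1: "p1 tagged_partial_division_of {a..b}"
        using part by (rule tagged_partial_division_subset) (use split in auto)
      have int: "x \<in> k \<and> k \<subseteq> {a..b} \<and> (\<exists>u v. k = cbox u v)" if "(x,k) \<in> p" for x k
        using tagged_partial_division_ofD[OF part] that by blast
      have div1: "snd ` p1 division_of \<Union>(snd ` p1)" by (rule partial_division_of_tagged_division[OF part1])
      have "(\<Sum>k\<in>snd ` p1. measure lborel k) = (\<Sum>k\<in>snd ` p1. measure lebesgue k)"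
      proof (rule sum.cong)
        fix k assume "k \<in> snd ` p1"
        then obtain u v where "k = {u..v}" using int split(1) by fastforce
        then show "measure lborel k = measure lebesgue k" by simp
      qed simp
      also have "\<dots> = measure lebesgue (\<Union>(snd ` p1))" by (rule content_division[OF div1])
      also have "\<dots> \<le> measure lebesgue U"
      proof (rule measure_mono_fmeasurable)
        show "\<Union> (snd ` p1) \<subseteq> U"
        proof (clarsimp simp: p1_def)
          fix y x k assume "y \<in> k" "(x,k) \<in> p" "x \<in> N"
          then show "y \<in> U" using fine r(2)[of x] unfolding fine_def \<gamma>_def by fastforce
        qed
        show "\<Union> (snd ` p1) \<in> sets lebesgue"
          using lmeasurable_division[OF div1] by (simp add: fmeasurableD)
      qed (rule Um)
      finally have small: "(\<Sum>k\<in>snd ` p1. measure lborel k) < \<delta>" using mU by linarith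
      have sub1: "\<Union> (snd ` p1) \<subseteq> {a..b}" using int split(1) by fastforce
      have "(\<Sum>k\<in>snd ` p1. \<bar>D k\<bar>) < e / 2"
        unfolding D_def by (rule ac'[OF div1 sub1 small])
      then have s1: "(\<Sum>(x,k)\<in>p1. \<bar>D k\<bar>) < e / 2"
        by (subst tagged_sum_over_intervals[OF part1]) (auto simp: D_def)
      have b1: "\<bar>\<Sum>(x,k)\<in>p1. measure lborel k * g' x - D k\<bar> < e / 2"
      proof -
        have "(\<Sum>(x,k)\<in>p1. measure lborel k * g' x - D k) = (\<Sum>(x,k)\<in>p1. - D k)"
          by (rule sum.cong) (auto simp: p1_def g'_def)
        also have "\<bar>\<dots>\<bar> \<le> (\<Sum>(x,k)\<in>p1. \<bar>D k\<bar>)"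
          by (rule order_trans[OF sum_abs]) (auto simp: case_prod_beta)
        finally show ?thesis using s1 by linarith
      qed
      \<comment> \<open>Straddling: the tag lies between the two endpoints, so the approximation
        errors there are bounded by \<eta> times lengths that add up to exactly the length of
        \<open>k\<close>.\<close>
      have each: "\<bar>measure lborel k * g' x - D k\<bar> \<le> \<eta> * measure lborel k" if "(x,k) \<in> p2" for x k
      proof -
        have xk: "(x,k) \<in> p" "x \<notin> N" using that by (auto simp: p2_def)
        note i = int[OF xk(1)]
        have x: "x \<in> {a..b} - N" using i xk by auto
        note c = content_Sup_Inf[of x k]
        have "k \<subseteq> \<gamma> x" using fine xk by (auto simp: fine_def)
        then have "k \<subseteq> ball x (d x)" using xk x by (simp add: \<gamma>_def)
        then have near: "\<bar>Sup k - x\<bar> < d x" "\<bar>Inf k - x\<bar> < d x"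
          using c(4,5) i by (auto simp: dist_real_def abs_minus_commute)
        have "\<bar>f (Sup k) - f x - g x * (Sup k - x)\<bar> \<le> \<eta> * (Sup k - x)"
          "\<bar>f (Inf k) - f x - g x * (Inf k - x)\<bar> \<le> \<eta> * (x - Inf k)"
          using d(2)[OF x near(1)] d(2)[OF x near(2)] c(2,3) i by auto
        then show ?thesis
          using c(1) i xk by (auto simp: g'_def D_def algebra_simps abs_le_iff)
      qed
      have "\<bar>\<Sum>(x,k)\<in>p2. measure lborel k * g' x - D k\<bar> \<le> (\<Sum>(x,k)\<in>p2. \<eta> * measure lborel k)"
        by (rule order_trans[OF sum_abs], rule sum_mono) (use each in auto)
      also have "\<dots> \<le> (\<Sum>(x,k)\<in>p. \<eta> * measure lborel k)"
        by (rule sum_mono2) (use fin split \<eta> in auto)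
      also have "\<dots> = \<eta> * (\<Sum>(x,k)\<in>p. measure lborel k)" by (simp add: sum_distrib_left case_prod_beta)
      also have "(\<Sum>(x,k)\<in>p. measure lborel k) = b - a"
        using additive_content_tagged_division[of p a b] p ab by simp
      finally have b2: "\<bar>\<Sum>(x,k)\<in>p2. measure lborel k * g' x - D k\<bar> \<le> e / 2" using \<eta>2 by linarith
      have "(\<Sum>(x, k)\<in>p. measure lborel k *\<^sub>R g' x) - (f b - f a) = (\<Sum>(x,k)\<in>p. measure lborel k * g' x - D k)"
        unfolding D[symmetric] sum_subtractf[symmetric] by (simp add: case_prod_beta)
      also have "\<dots> = (\<Sum>(x,k)\<in>p1. measure lborel k * g' x - D k) + (\<Sum>(x,k)\<in>p2. measure lborel k * g' x - D k)"
        using split by (metis (no_types, lifting) sum.union_disjoint)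
      finally show ?thesis using b1 b2 by (simp add: real_norm_def)
    qed
    then show "\<exists>\<gamma>. gauge \<gamma> \<and> (\<forall>p. p tagged_division_of {a..b} \<and> \<gamma> fine p \<longrightarrow>
      norm ((\<Sum>(x, k)\<in>p. measure lborel k *\<^sub>R g' x) - (f b - f a)) < e)"
      using gauge by blast
  qed
  then show ?thesis
    by (rule has_integral_spike[OF N, rotated]) (auto simp: g'_def)
qed

text \<open>By Henstock's lemma and a Vitali covering, the set where the difference quotients stay
  \<open>e\<close>-far from \<open>f x\<close> is null.\<close>

lemma negligible_bad_difference_quotients:
  fixes f :: "real \<Rightarrow> real"
  assumes f: "f integrable_on {a..b}" and e: "e > 0"
  defines "F \<equiv> \<lambda>x. integral {a..x} f"
  defines "bad \<equiv> \<lambda>x y. y \<in> {a..b} \<and> y \<noteq> x \<and> \<bar>F y - F x - f x * (y - x)\<bar> > e * \<bar>y - x\<bar>"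
  shows "negligible {x \<in> {a<..<b}. \<forall>d>0. \<exists>y. \<bar>y - x\<bar> < d \<and> bad x y}" (is "negligible ?S")
  unfolding negligible_outer_le
proof (intro allI impI)
  fix \<eta> :: real assume \<eta>: "\<eta> > 0"
  obtain \<gamma> where \<gamma>: "gauge \<gamma>"
    and H: "\<And>p. \<lbrakk>p tagged_partial_division_of {a..b}; \<gamma> fine p\<rbrakk> \<Longrightarrow>
             sum (\<lambda>(x,k). norm(measure lborel k *\<^sub>R f x - integral k f)) p < e * \<eta>"
    using Henstock_lemma[of f a b "e * \<eta>"] f e \<eta> by auto
  \<comment> \<open>A covering interval is indexed by its tag \<open>x\<close> and a witness
    \<open>y\<close> of the bad quotient. The interval between them is the closed ball about their
    midpoint, as the covering theorem requires.\<close>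
  define K where "K = {(x,y). x \<in> {a<..<b} \<and> bad x y \<and> {min x y..max x y} \<subseteq> \<gamma> x}"
  define ce where "ce = (\<lambda>(x,y). (x+y)/2 :: real)"
  define ra where "ra = (\<lambda>(x,y). \<bar>y-x\<bar>/2 :: real)"
  have cb: "cball (ce i) (ra i) = {min (fst i) (snd i)..max (fst i) (snd i)}" for i
    by (cases i) (auto simp: ce_def ra_def cball_eq_atLeastAtMost min_def max_def abs_if field_simps)
  obtain C where C: "countable C" "C \<subseteq> K"
     "pairwise (\<lambda>i j. disjnt (cball (ce i) (ra i)) (cball (ce j) (ra j))) C"
     "negligible(?S - (\<Union>i \<in> C. cball (ce i) (ra i)))"
  proof (rule Vitali_covering_theorem_cballs[where K=K and r=ra and S="?S" and a=ce])
    fix i assume "i \<in> K" then show "0 < ra i" by (auto simp: K_def ra_def bad_def)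
  next
    fix x d :: real assume x: "x \<in> ?S" and d: "0 < d"
    have "open (\<gamma> x)" "x \<in> \<gamma> x" using \<gamma> by (auto simp: gauge_def)
    then obtain \<rho> where \<rho>: "\<rho> > 0" "ball x \<rho> \<subseteq> \<gamma> x" using open_contains_ball by blast
    have "min \<rho> d > 0" using \<rho> d by simp
    then obtain y where y: "\<bar>y - x\<bar> < min \<rho> d" "bad x y" using x by blast
    have "{min x y..max x y} \<subseteq> ball x \<rho>" using y by (auto simp: dist_real_def min_def max_def split: if_splits)
    then have "(x,y) \<in> K" using x y \<rho> by (auto simp: K_def)
    moreover have "x \<in> cball (ce (x,y)) (ra (x,y))" unfolding cb by simp
    moreover have "ra (x,y) < d" using y by (auto simp: ra_def)
    ultimately show "\<exists>i. i \<in> K \<and> x \<in> cball (ce i) (ra i) \<and> ra i < d" by blast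
  qed
  define J where "J = (\<lambda>i::real\<times>real. {min (fst i) (snd i)..max (fst i) (snd i)})"
  \<comment> \<open>Finitely many of the disjoint intervals, tagged by their \<open>x\<close>, form
    a fine tagged partial division. Each contributes at least \<open>e\<close> times its length to a
    Henstock sum below \<open>e * \<eta>\<close>.\<close>
  have bound: "measure lebesgue (\<Union>i\<in>C'. J i) \<le> \<eta>" if C': "C' \<subseteq> C" "finite C'" for C'
  proof -
    define p where "p = (\<lambda>i. (fst i, J i)) ` C'"
    have disj: "J i \<inter> J j = {}" if "i \<in> C'" "j \<in> C'" "i \<noteq> j" for i j
      using C(3) that C' unfolding cb J_def by (auto simp: pairwise_def disjnt_def)
    have inj: "inj_on (\<lambda>i. (fst i, J i)) C'"
    proof (rule inj_onI)
      fix i j assume ij: "i \<in> C'" "j \<in> C'" "(fst i, J i) = (fst j, J j)"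
      then have "J i \<inter> J j \<noteq> {}" by (auto simp: J_def)
      then show "i = j" using disj ij by blast
    qed
    have CK: "x \<in> {a<..<b}" "bad x y" "J (x,y) \<subseteq> \<gamma> x" if "(x,y) \<in> C'" for x y
      using that C' C(2) by (auto simp: K_def J_def)
    have "p tagged_partial_division_of {a..b}"
      unfolding tagged_partial_division_of_def
    proof (intro conjI allI impI)
      show "finite p" using C' by (simp add: p_def)
    next
      fix x k assume "(x,k) \<in> p"
      then obtain y where y: "(x,y) \<in> C'" "k = J (x,y)" by (auto simp: p_def)
      show "x \<in> k" using y by (auto simp: J_def)
      show "k \<subseteq> {a..b}" using CK[OF y(1)] y(2) by (auto simp: J_def bad_def)
      show "\<exists>a b. k = cbox a b" using y(2) by (auto simp: J_def)
    next
      fix x1 K1 x2 K2 assume "(x1, K1) \<in> p \<and> (x2, K2) \<in> p \<and> (x1, K1) \<noteq> (x2, K2)"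
      then obtain i j where "i \<in> C'" "j \<in> C'" "i \<noteq> j" "K1 = J i" "K2 = J j" by (auto simp: p_def)
      then have "K1 \<inter> K2 = {}" using disj by blast
      then show "interior K1 \<inter> interior K2 = {}" using interior_subset by blast
    qed
    moreover have "\<gamma> fine p" unfolding fine_def p_def using CK by fastforce
    ultimately have "sum (\<lambda>(x,k). norm(measure lborel k *\<^sub>R f x - integral k f)) p < e * \<eta>" by (rule H)
    then have le: "(\<Sum>i\<in>C'. \<bar>measure lborel (J i) * f (fst i) - integral (J i) f\<bar>) < e * \<eta>"
      unfolding p_def by (subst (asm) sum.reindex[OF inj]) (simp add: o_def)
    have ge: "e * measure lborel (J i) \<le> \<bar>measure lborel (J i) * f (fst i) - integral (J i) f\<bar>" if i: "i \<in> C'" for i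
    proof -
      obtain x y where xy: "i = (x,y)" by force
      note c = CK[OF i[unfolded xy]]
      have comb: "integral {a..u} f + integral {u..v} f = integral {a..v} f" if "a \<le> u" "u \<le> v" "v \<le> b" for u v
        using that by (intro Henstock_Kurzweil_Integration.integral_combine integrable_on_subinterval[OF f]) auto
      show ?thesis
      proof (cases "x \<le> y")
        case True
        then have "integral (J i) f = F y - F x"
          using comb[of x y] c by (auto simp: J_def xy F_def bad_def min_def max_def)
        then show ?thesis using c True by (auto simp: J_def xy bad_def min_def max_def algebra_simps abs_minus_commute)
      next
        case False
        then have "integral (J i) f = F x - F y"
          using comb[of y x] c by (auto simp: J_def xy F_def bad_def min_def max_def)
        then show ?thesis using c False by (auto simp: J_def xy bad_def min_def max_def algebra_simps)
      qed
    qed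
    have "e * (\<Sum>i\<in>C'. measure lborel (J i)) \<le> e * \<eta>"
      unfolding sum_distrib_left by (rule order_trans[OF sum_mono[OF ge] less_imp_le[OF le]])
    then have "(\<Sum>i\<in>C'. measure lborel (J i)) \<le> \<eta>" using e by simp
    moreover have "measure lebesgue (\<Union>i\<in>C'. J i) \<le> (\<Sum>i\<in>C'. measure lebesgue (J i))"
      by (rule measure_UNION_le) (use C' in \<open>auto simp: J_def\<close>)
    moreover have "measure lebesgue (J i) = measure lborel (J i)" for i by (simp add: J_def)
    ultimately show ?thesis by simp
  qed
  define T where "T = (\<Union>i\<in>C. J i)"
  have T: "T \<in> lmeasurable" "measure lebesgue T \<le> \<eta>"
    unfolding T_def
    by (rule fmeasurable_UN_bound[OF C(1) _ bound] measure_UN_bound[OF C(1) _ bound]; simp add: J_def)+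
  have neg: "negligible (?S - T)" using C(4) unfolding cb T_def J_def .
  show "\<exists>T. ?S \<subseteq> T \<and> T \<in> lmeasurable \<and> measure lebesgue T \<le> \<eta>"
  proof (intro exI conjI)
    show "?S \<subseteq> T \<union> (?S - T)" by blast
    show "T \<union> (?S - T) \<in> lmeasurable" using T neg negligible_imp_measurable by blast
    have "measure lebesgue (T \<union> (?S - T)) \<le> measure lebesgue T + measure lebesgue (?S - T)"
      using T neg by (intro measure_Un_le) (auto simp: fmeasurableD negligible_imp_sets)
    then show "measure lebesgue (T \<union> (?S - T)) \<le> \<eta>" using T neg by (simp add: negligible_imp_measure0)
  qed
qed

text \<open>The exceptional set is the union over \<open>n\<close> of the bad sets for the
  tolerances \<open>1 / real (Suc n)\<close>; off it, every tolerance is eventually met.\<close>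

lemma Lebesgue_differentiation:
  fixes f :: "real \<Rightarrow> real"
  assumes f: "f integrable_on {a..b}"
  shows "\<exists>N. negligible N \<and> (\<forall>x\<in>{a<..<b} - N. ((\<lambda>x. integral {a..x} f) has_real_derivative f x) (at x))"
proof -
  define F where "F = (\<lambda>x. integral {a..x} f)"
  define N where "N n = {x \<in> {a<..<b}. \<forall>d>0. \<exists>y. \<bar>y - x\<bar> < d \<and> y \<in> {a..b} \<and> y \<noteq> x \<and>
      \<bar>F y - F x - f x * (y - x)\<bar> > (1 / real (Suc n)) * \<bar>y - x\<bar>}" for n
  have neg: "negligible (\<Union>n. N n)"
    unfolding N_def F_def by (rule negligible_Union_nat, rule negligible_bad_difference_quotients[OF f]) simp
  have "(F has_real_derivative f x) (at x)" if x: "x \<in> {a<..<b} - (\<Union>n. N n)" for x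
    unfolding has_field_derivative_def has_derivative_at_alt
  proof (intro conjI allI impI)
    show "bounded_linear ((*) (f x))" by (rule bounded_linear_mult_right)
    fix e :: real assume "e > 0"
    then obtain n where n: "1 / real (Suc n) < e" using nat_approx_posE by blast
    have "x \<notin> N n" using x by auto
    then obtain d where d: "d > 0" "\<And>y. \<bar>y - x\<bar> < d \<Longrightarrow> y \<in> {a..b} \<Longrightarrow> y \<noteq> x \<Longrightarrow>
       \<bar>F y - F x - f x * (y - x)\<bar> \<le> (1 / real (Suc n)) * \<bar>y - x\<bar>"
      using x unfolding N_def mem_Collect_eq by (metis (no_types, lifting) DiffD1 linorder_not_le)
    show "\<exists>d>0. \<forall>y. norm (y - x) < d \<longrightarrow> norm (F y - F x - f x * (y - x)) \<le> e * norm (y - x)"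
    proof (intro exI conjI allI impI)
      show "min d (min (x - a) (b - x)) > 0" using d x by auto
      fix y assume y: "norm (y - x) < min d (min (x - a) (b - x))"
      show "norm (F y - F x - f x * (y - x)) \<le> e * norm (y - x)"
      proof (cases "y = x")
        case False
        have "\<bar>F y - F x - f x * (y - x)\<bar> \<le> (1 / real (Suc n)) * \<bar>y - x\<bar>"
          using y False by (intro d(2)) auto
        also have "\<dots> \<le> e * \<bar>y - x\<bar>" using n by (intro mult_right_mono) auto
        finally show ?thesis by simp
      qed auto
    qed
  qed
  then show ?thesis using neg unfolding F_def by blast
qed

section \<open>Calculus of indefinite integrals\<close>

text \<open>This is local absolute continuity of \<open>f\<close> with almost everywhere derivative
  \<open>g\<close>, encoded by increments: \<open>f\<close> is determined pointwise up to a
  constant, whereas \<open>g\<close> matters only up to null sets.\<close>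

definition primitive :: "(real \<Rightarrow> real) \<Rightarrow> (real \<Rightarrow> real) \<Rightarrow> bool" where
  "primitive f g \<longleftrightarrow> L1_loc g \<and> (\<forall>a b. a \<le> b \<longrightarrow> integral {a..b} g = f b - f a)"

lemma L1_loc_continuous: "continuous_on UNIV f \<Longrightarrow> L1_loc f"
  unfolding L1_loc_def by (blast intro: absolutely_integrable_continuous_real continuous_on_subset)

lemma L1_loc_integrable: "L1_loc f \<Longrightarrow> f integrable_on {a..b}"
  unfolding L1_loc_def by (rule set_lebesgue_integral_eq_integral(1)) blast

lemma L1_loc_add: "L1_loc f \<Longrightarrow> L1_loc g \<Longrightarrow> L1_loc (\<lambda>x. f x + g x)"
  unfolding L1_loc_def by (blast intro: set_integral_add)

lemma L1_loc_diff: "L1_loc f \<Longrightarrow> L1_loc g \<Longrightarrow> L1_loc (\<lambda>x. f x - g x)"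
  unfolding L1_loc_def by (blast intro: set_integral_diff)

lemma L1_loc_abs: "L1_loc f \<Longrightarrow> L1_loc (\<lambda>x. \<bar>f x\<bar>)"
  unfolding L1_loc_def by (blast intro: set_integrable_abs)

lemma L1_loc_mult_continuous:
  assumes "L1_loc q" "continuous_on UNIV y"
  shows "L1_loc (\<lambda>x. q x * y x)"
  unfolding L1_loc_def
proof (intro allI)
  fix a b :: real
  have y: "continuous_on {a..b} y" using assms(2) continuous_on_subset by blast
  have "(\<lambda>x. y x * q x) absolutely_integrable_on {a..b}"
  proof (rule absolutely_integrable_bounded_measurable_product_real)
    show "y \<in> borel_measurable (lebesgue_on {a..b})"
      by (rule continuous_imp_measurable_on_sets_lebesgue[OF y]) auto
    show "bounded (y ` {a..b})" by (rule compact_imp_bounded[OF compact_continuous_image[OF y]]) simp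
  qed (use assms in \<open>auto simp: L1_loc_def\<close>)
  then show "set_integrable lebesgue {a..b} (\<lambda>x. q x * y x)" by (simp add: mult.commute)
qed

lemma L1_loc_cmult: "L1_loc f \<Longrightarrow> L1_loc (\<lambda>x. c * f x)"
  using L1_loc_mult_continuous[of f "\<lambda>x. c"] by (simp add: mult.commute)

lemma AE_lebesgue_imp_negligible:
  assumes "AE x in lebesgue. P x"
  obtains N where "negligible N" "\<And>x. x \<notin> N \<Longrightarrow> P x"
proof -
  obtain N where "{x \<in> space lebesgue. \<not> P x} \<subseteq> N" "emeasure lebesgue N = 0" "N \<in> sets lebesgue"
    using assms by (rule AE_E)
  then show thesis using that[of N] by (auto simp: negligible_iff_null_sets null_sets_def)
qed

lemma negligible_imp_AE_lebesgue:
  assumes "negligible N" "\<And>x. x \<notin> N \<Longrightarrow> P x"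
  shows "AE x in lebesgue. P x"
proof (rule AE_I')
  show "N \<in> null_sets lebesgue" using assms by (simp add: negligible_iff_null_sets)
qed (use assms in auto)

lemma L1_loc_cong_AE:
  assumes "L1_loc f" "AE x in lebesgue. f x = g x"
  shows "L1_loc g"
proof -
  obtain N where N: "negligible N" "\<And>x. x \<notin> N \<Longrightarrow> f x = g x"
    using AE_lebesgue_imp_negligible[OF assms(2)] by blast
  show ?thesis unfolding L1_loc_def
  proof (intro allI)
    fix a b
    show "set_integrable lebesgue {a..b} g"
      by (rule absolutely_integrable_spike[where f=f, OF _ N(1)]) (use assms(1) N(2) in \<open>auto simp: L1_loc_def\<close>)
  qed
qed

lemma integral_cong_AE_lebesgue:
  assumes "AE x in lebesgue. f x = (g x :: real)"
  shows "integral {a..b::real} f = integral {a..b} g"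
proof -
  obtain N where N: "negligible N" "\<And>x. x \<notin> N \<Longrightarrow> f x = g x"
    using AE_lebesgue_imp_negligible[OF assms] by blast
  show ?thesis by (rule integral_spike[OF N(1)]) (use N(2) in auto)
qed

lemma integral_mono_AE_lebesgue:
  assumes "AE x in lebesgue. x \<in> {a..b} \<longrightarrow> f x \<le> (g x :: real)"
    and "f integrable_on {a..b::real}" "g integrable_on {a..b}"
  shows "integral {a..b} f \<le> integral {a..b} g"
proof -
  obtain N where N: "negligible N" "\<And>x. x \<notin> N \<Longrightarrow> x \<in> {a..b} \<longrightarrow> f x \<le> g x"
    using AE_lebesgue_imp_negligible[OF assms(1)] by blast
  have "integral {a..b} f = integral {a..b} (\<lambda>x. if x \<in> N then g x else f x)"
    by (rule integral_spike[OF N(1)]) auto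
  also have "\<dots> \<le> integral {a..b} g"
    by (rule integral_le[OF integrable_spike[OF assms(2) N(1)] assms(3)]) (use N(2) in auto)
  finally show ?thesis .
qed

lemma primitive_cong_AE:
  assumes "primitive f g" "AE x in lebesgue. g x = h x"
  shows "primitive f h"
  using assms L1_loc_cong_AE[OF _ assms(2)] integral_cong_AE_lebesgue[OF assms(2)]
  by (simp add: primitive_def)

lemma primitive_L1: "primitive f g \<Longrightarrow> L1_loc g"
  by (simp add: primitive_def)

lemma primitive_integral: "primitive f g \<Longrightarrow> a \<le> b \<Longrightarrow> integral {a..b} g = f b - f a"
  by (simp add: primitive_def)

lemma primitive_integrable: "primitive f g \<Longrightarrow> g integrable_on {a..b}"
  by (simp add: primitive_L1 L1_loc_integrable)

lemma primitive_mono: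
  assumes "primitive f g" "a \<le> b" "AE x in lebesgue. x \<in> {a..b} \<longrightarrow> c \<le> g x"
  shows "f a + c * (b - a) \<le> f b"
proof -
  have "integral {a..b} (\<lambda>x. c) \<le> integral {a..b} g"
    by (rule integral_mono_AE_lebesgue) (use assms primitive_integrable in auto)
  then show ?thesis using assms by (simp add: primitive_integral mult.commute)
qed

lemma primitive_isCont:
  assumes f: "primitive f g"
  shows "isCont f x"
proof -
  define a b where "a = x - 1" and "b = x + 1"
  have "continuous_on {a..b} (\<lambda>t. f a + integral {a..t} g)"
    by (intro continuous_intros indefinite_integral_continuous_1 primitive_integrable[OF f])
  then have "continuous_on {a..b} f"
    by (rule continuous_on_eq) (auto simp: primitive_integral[OF f])
  then have "continuous_on {a<..<b} f" by (rule continuous_on_subset) auto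
  then show ?thesis by (simp add: continuous_on_eq_continuous_at a_def b_def)
qed

lemma primitive_continuous: "primitive f g \<Longrightarrow> continuous_on S f"
  by (simp add: continuous_at_imp_continuous_on primitive_isCont)

lemma primitive_AE_derivative:
  assumes f: "primitive f g"
  shows "AE x in lebesgue. (f has_real_derivative g x) (at x)"
proof -
  define I where "I n = {- real n<..<real n}" for n
  have ex: "\<exists>N. negligible N \<and> (\<forall>x\<in>I n - N. (f has_real_derivative g x) (at x))" for n
  proof -
    obtain N where N: "negligible N" 
      "\<And>x. x \<in> I n - N \<Longrightarrow> ((\<lambda>x. integral {- real n..x} g) has_real_derivative g x) (at x)"
      using Lebesgue_differentiation[OF primitive_integrable[OF f], of "- real n" "real n"] unfolding I_def by blast
    have "(f has_real_derivative g x) (at x)" if x: "x \<in> I n - N" for x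
    proof -
      \<comment> \<open>The differentiation theorem concerns the integral started at
        \<open>- real n\<close>; adding the constant \<open>f (- real n)\<close> recovers
        \<open>f\<close>.\<close>
      have der: "((\<lambda>x. f (- real n) + integral {- real n..x} g) has_real_derivative g x) (at x)"
        using DERIV_add[OF DERIV_const N(2)[OF x]] by simp
      have "\<forall>\<^sub>F t in nhds x. t \<in> I n"
        by (rule eventually_nhds_in_open) (use x in \<open>auto simp: I_def\<close>)
      then have "\<forall>\<^sub>F t in nhds x. f (- real n) + integral {- real n..t} g = f t"
        by eventually_elim (auto simp: I_def primitive_integral[OF f])
      from DERIV_cong_ev[OF refl this refl] der show ?thesis by blast
    qed
    then show ?thesis using N(1) by blast
  qed
  define N where "N n = (SOME N. negligible N \<and> (\<forall>x\<in>I n - N. (f has_real_derivative g x) (at x)))" for n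
  have N: "negligible (N n)" "x \<in> I n - N n \<Longrightarrow> (f has_real_derivative g x) (at x)" for n x
    using someI_ex[OF ex[of n]] unfolding N_def[symmetric] by blast+
  show ?thesis
  proof (rule negligible_imp_AE_lebesgue)
    show "negligible (\<Union>n. N n)" by (rule negligible_Union_nat) (rule N)
    fix x assume x: "x \<notin> (\<Union>n. N n)"
    obtain n where "\<bar>x\<bar> < real n" using reals_Archimedean2 by blast
    then show "(f has_real_derivative g x) (at x)" using N(2)[of x n] x by (simp add: I_def abs_less_iff)
  qed
qed

text \<open>The integrand is truncated at a large height.\<close>

lemma primitive_locally_absolutely_continuous:
  assumes f: "primitive f g"
  shows "locally_absolutely_continuous f"
  unfolding locally_absolutely_continuous_def absolutely_continuous_on_interval_def
proof (intro allI impI)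
  fix a b e :: real assume e: "e > 0"
  define h where "h x = indicator {a..b} x * \<bar>g x\<bar>" for x
  have "set_integrable lebesgue {a..b} (\<lambda>x. \<bar>g x\<bar>)"
    using primitive_L1[OF f] by (simp add: L1_loc_def set_integrable_abs)
  then have h: "integrable lebesgue h" unfolding set_integrable_def h_def by simp
  have hnn: "h x \<ge> 0" for x by (simp add: h_def)
  \<comment> \<open>The part of \<open>h\<close> above height \<open>n\<close>. Its integral tends
    to 0 by dominated convergence, so for a suitable \<open>n\<close> it is below
    \<open>e / 2\<close>.\<close>
  define t where "t n x = h x - min (h x) (real n)" for n x
  have tint: "integrable lebesgue (t n)" for n
  proof (rule Bochner_Integration.integrable_bound[OF h])
    show "t n \<in> borel_measurable lebesgue" unfolding t_def using h by measurable
    show "AE x in lebesgue. norm (t n x) \<le> norm (h x)" using hnn by (auto simp: t_def min_def)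
  qed
  have "(\<lambda>n. integral\<^sup>L lebesgue (t n)) \<longlonglongrightarrow> integral\<^sup>L lebesgue (\<lambda>x::real. 0)"
  proof (rule Bochner_Integration.integral_dominated_convergence[where w=h])
    show "integrable lebesgue h" by (rule h)
    show "t n \<in> borel_measurable lebesgue" for n using tint by auto
    have "(\<lambda>n. t n x) \<longlonglongrightarrow> 0" for x
    proof (rule tendsto_eventually)
      obtain m where "h x \<le> real m" using real_arch_simple by blast
      then have "t n x = 0" if "n \<ge> m" for n using that by (auto simp: t_def min_def)
      then show "\<forall>\<^sub>F n in sequentially. t n x = 0" by (auto simp: eventually_sequentially)
    qed
    then show "AE x in lebesgue. (\<lambda>n. t n x) \<longlonglongrightarrow> 0" by simp
    show "AE x in lebesgue. norm (t n x) \<le> h x" for n using hnn by (auto simp: t_def min_def)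
  qed simp
  then have "\<forall>\<^sub>F n in sequentially. integral\<^sup>L lebesgue (t n) < e / 2"
    using e by (intro order_tendstoD) auto
  then obtain n where n: "integral\<^sup>L lebesgue (t n) < e / 2"
    by (auto simp: eventually_sequentially)
  have tU: "(t n has_integral integral\<^sup>L lebesgue (t n)) UNIV"
    by (rule has_integral_integral_lebesgue[OF tint])
  have tnn: "t n x \<ge> 0" for x by (simp add: t_def)
  \<comment> \<open>The part of the integrand below height \<open>n\<close> contributes at most
    \<open>real n * \<delta>\<close>, which is at most \<open>e / 2\<close>; the summand 1 covers
    \<open>n = 0\<close>.\<close>
  define \<delta> where "\<delta> = e / (2 * (real n + 1))"
  show "\<exists>\<delta>>0. \<forall>P t. P division_of t \<and> t \<subseteq> {a..b} \<and> (\<Sum>k\<in>P. measure lborel k) < \<delta> \<longrightarrow>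
           (\<Sum>k\<in>P. \<bar>f (Sup k) - f (Inf k)\<bar>) < e"
  proof (intro exI conjI allI impI)
    show "\<delta> > 0" using e by (simp add: \<delta>_def)
    fix P T assume *: "P division_of T \<and> T \<subseteq> {a..b} \<and> (\<Sum>k\<in>P. measure lborel k) < \<delta>"
    then have div: "P division_of T" by blast
    have each: "\<bar>f (Sup k) - f (Inf k)\<bar> \<le> real n * measure lborel k + integral k (t n)" if k: "k \<in> P" for k
    proof -
      obtain u v where uv: "k = {u..v}" "u \<le> v" using division_ofD(3,4)[OF div k] by fastforce
      have sub: "k \<subseteq> {a..b}" using division_ofD(2)[OF div k] * by blast
      have tk: "t n integrable_on {u..v}" using tU integrable_on_subinterval[of "t n" UNIV u v] by auto
      have "\<bar>f (Sup k) - f (Inf k)\<bar> = \<bar>integral {u..v} g\<bar>"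
        using uv by (simp add: primitive_integral[OF f])
      also have "\<dots> \<le> integral {u..v} (\<lambda>x. real n + t n x)"
      proof (rule integral_norm_bound_integral[where 'a=real, unfolded real_norm_def])
        show "g integrable_on {u..v}" by (rule primitive_integrable[OF f])
        show "(\<lambda>x. real n + t n x) integrable_on {u..v}" using tk by (intro integrable_add) auto
        fix x assume "x \<in> {u..v}"
        then show "\<bar>g x\<bar> \<le> real n + t n x" using sub uv by (auto simp: t_def h_def min_def)
      qed
      also have "\<dots> = real n * measure lborel k + integral k (t n)"
        using tk uv by (subst Henstock_Kurzweil_Integration.integral_add) auto
      finally show ?thesis .
    qed
    have tT: "t n integrable_on T"
    proof (rule integrable_combine_division[OF div])
      fix k assume k: "k \<in> P"
      then obtain u v where uv: "k = {u..v}" using division_ofD(4)[OF div k] by auto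
      show "t n integrable_on k" using tU integrable_on_subinterval[of "t n" UNIV u v] uv by auto
    qed
    have "(\<Sum>k\<in>P. \<bar>f (Sup k) - f (Inf k)\<bar>) \<le> (\<Sum>k\<in>P. real n * measure lborel k + integral k (t n))"
      by (rule sum_mono) (rule each)
    also have "\<dots> = real n * (\<Sum>k\<in>P. measure lborel k) + integral T (t n)"
      by (simp add: sum.distrib sum_distrib_left integral_combine_division_topdown[OF tT div])
    also have "\<dots> \<le> real n * \<delta> + integral UNIV (t n)"
    proof (rule add_mono)
      show "real n * (\<Sum>k\<in>P. measure lborel k) \<le> real n * \<delta>" using * by (intro mult_left_mono) auto
      show "integral T (t n) \<le> integral UNIV (t n)"
        by (rule integral_subset_le) (use tT tU tnn in auto)
    qed
    also have "\<dots> < e"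
    proof -
      have "real n * \<delta> \<le> e / 2" using e by (simp add: \<delta>_def field_simps)
      moreover have "integral UNIV (t n) = integral\<^sup>L lebesgue (t n)" using tU by blast
      ultimately show ?thesis using n by linarith
    qed
    finally show "(\<Sum>k\<in>P. \<bar>f (Sup k) - f (Inf k)\<bar>) < e" .
  qed
qed

text \<open>The fundamental theorem for absolutely continuous functions supplies the increments. It
  is what allows product rules to be proved through almost everywhere derivatives.\<close>

lemma primitiveI:
  assumes "locally_absolutely_continuous f" "AE x in lebesgue. (f has_real_derivative g x) (at x)" "L1_loc g"
  shows "primitive f g"
proof -
  obtain N where N: "negligible N" "\<And>x. x \<notin> N \<Longrightarrow> (f has_real_derivative g x) (at x)"
    using AE_lebesgue_imp_negligible[OF assms(2)] by blast
  have "(g has_integral f b - f a) {a..b}" if "a \<le> b" for a b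
    by (rule absolutely_continuous_FTC[OF that _ N(1)])
      (use assms(1) N(2) in \<open>auto simp: locally_absolutely_continuous_def\<close>)
  then show ?thesis using assms(3) by (auto simp: primitive_def)
qed

lemma locally_absolutely_continuous_mult:
  assumes f: "locally_absolutely_continuous f" "continuous_on UNIV f"
    and g: "locally_absolutely_continuous g" "continuous_on UNIV g"
  shows "locally_absolutely_continuous (\<lambda>x. f x * g x)"
  unfolding locally_absolutely_continuous_def absolutely_continuous_on_interval_def
proof (intro allI impI)
  fix a b e :: real assume e: "e > 0"
  have bdd: "\<exists>B>0. \<forall>x\<in>{a..b}. \<bar>h x\<bar> \<le> B" if "continuous_on UNIV h" for h :: "real \<Rightarrow> real"
  proof -
    have "bounded (h ` {a..b})"
      by (rule compact_imp_bounded[OF compact_continuous_image[OF continuous_on_subset[OF that]]]) auto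
    then show ?thesis unfolding bounded_pos by auto
  qed
  obtain A B where A: "A > 0" "\<And>x. x \<in> {a..b} \<Longrightarrow> \<bar>f x\<bar> \<le> A" and B: "B > 0" "\<And>x. x \<in> {a..b} \<Longrightarrow> \<bar>g x\<bar> \<le> B"
    using bdd[OF f(2)] bdd[OF g(2)] by blast
  have "e / (2 * A) > 0" "e / (2 * B) > 0" using e A B by auto
  then obtain d1 d2 where d1: "d1 > 0" "\<And>P t. P division_of t \<and> t \<subseteq> {a..b} \<and> (\<Sum>k\<in>P. measure lborel k) < d1
        \<Longrightarrow> (\<Sum>k\<in>P. \<bar>f (Sup k) - f (Inf k)\<bar>) < e / (2 * B)"
    and d2: "d2 > 0" "\<And>P t. P division_of t \<and> t \<subseteq> {a..b} \<and> (\<Sum>k\<in>P. measure lborel k) < d2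
        \<Longrightarrow> (\<Sum>k\<in>P. \<bar>g (Sup k) - g (Inf k)\<bar>) < e / (2 * A)"
    using f(1)[unfolded locally_absolutely_continuous_def absolutely_continuous_on_interval_def, rule_format, of "e / (2 * B)" a b]
      g(1)[unfolded locally_absolutely_continuous_def absolutely_continuous_on_interval_def, rule_format, of "e / (2 * A)" a b]
    by blast
  show "\<exists>\<delta>>0. \<forall>P t. P division_of t \<and> t \<subseteq> {a..b} \<and> (\<Sum>k\<in>P. measure lborel k) < \<delta> \<longrightarrow>
           (\<Sum>k\<in>P. \<bar>f (Sup k) * g (Sup k) - f (Inf k) * g (Inf k)\<bar>) < e"
  proof (intro exI conjI allI impI)
    show "min d1 d2 > 0" using d1 d2 by simp
    fix P T assume *: "P division_of T \<and> T \<subseteq> {a..b} \<and> (\<Sum>k\<in>P. measure lborel k) < min d1 d2"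
    have each: "\<bar>f (Sup k) * g (Sup k) - f (Inf k) * g (Inf k)\<bar> \<le>
        A * \<bar>g (Sup k) - g (Inf k)\<bar> + B * \<bar>f (Sup k) - f (Inf k)\<bar>" if k: "k \<in> P" for k
    proof -
      obtain u v where uv: "k = {u..v}" "u \<le> v" using division_ofD(3,4)[of P T k] k * by fastforce
      have "k \<subseteq> {a..b}" using division_ofD(2)[of P T k] k * by blast
      then have in_ab: "u \<in> {a..b}" "v \<in> {a..b}" using uv by auto
      have "f v * g v - f u * g u = f v * (g v - g u) + g u * (f v - f u)" by (simp add: algebra_simps)
      also have "\<bar>\<dots>\<bar> \<le> \<bar>f v\<bar> * \<bar>g v - g u\<bar> + \<bar>g u\<bar> * \<bar>f v - f u\<bar>"
        by (metis abs_mult abs_triangle_ineq)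
      also have "\<dots> \<le> A * \<bar>g v - g u\<bar> + B * \<bar>f v - f u\<bar>"
        by (intro add_mono mult_right_mono A B in_ab) auto
      finally show ?thesis using uv by simp
    qed
    have "(\<Sum>k\<in>P. \<bar>f (Sup k) * g (Sup k) - f (Inf k) * g (Inf k)\<bar>) \<le>
       A * (\<Sum>k\<in>P. \<bar>g (Sup k) - g (Inf k)\<bar>) + B * (\<Sum>k\<in>P. \<bar>f (Sup k) - f (Inf k)\<bar>)"
      unfolding sum_distrib_left sum.distrib[symmetric] by (rule sum_mono) (rule each)
    also have "\<dots> < A * (e / (2 * A)) + B * (e / (2 * B))"
      by (intro add_strict_mono mult_strict_left_mono d1(2)[of _ T] d2(2)[of _ T] A B) (use * in auto)
    also have "\<dots> = e" using A B by simp
    finally show "(\<Sum>k\<in>P. \<bar>f (Sup k) * g (Sup k) - f (Inf k) * g (Inf k)\<bar>) < e" .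
  qed
qed

text \<open>A product of continuous locally absolutely continuous functions is again locally
  absolutely continuous, so the pointwise product rule, valid almost everywhere, is enough.\<close>

lemma primitive_mult:
  assumes f: "primitive f f'" and g: "primitive g g'"
  shows "primitive (\<lambda>x. f x * g x) (\<lambda>x. f' x * g x + g' x * f x)"
proof (rule primitiveI)
  show "locally_absolutely_continuous (\<lambda>x. f x * g x)"
    by (intro locally_absolutely_continuous_mult primitive_locally_absolutely_continuous[OF f]
        primitive_locally_absolutely_continuous[OF g] primitive_continuous[OF f] primitive_continuous[OF g])
  show "AE x in lebesgue. ((\<lambda>x. f x * g x) has_real_derivative f' x * g x + g' x * f x) (at x)"
    using primitive_AE_derivative[OF f] primitive_AE_derivative[OF g]
    by eventually_elim (auto intro!: derivative_eq_intros)
  show "L1_loc (\<lambda>x. f' x * g x + g' x * f x)"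
    by (intro L1_loc_add L1_loc_mult_continuous primitive_L1[OF f] primitive_L1[OF g]
        primitive_continuous[OF f] primitive_continuous[OF g])
qed

lemma primitive_add:
  assumes f: "primitive f f'" and g: "primitive g g'"
  shows "primitive (\<lambda>x. f x + g x) (\<lambda>x. f' x + g' x)"
  using assms unfolding primitive_def
  by (auto intro!: L1_loc_add simp: Henstock_Kurzweil_Integration.integral_add L1_loc_integrable)

lemma primitive_cmult: "primitive f f' \<Longrightarrow> primitive (\<lambda>x. c * f x) (\<lambda>x. c * f' x)"
  unfolding primitive_def by (auto intro!: L1_loc_cmult simp: right_diff_distrib)

lemma primitive_minus: "primitive f f' \<Longrightarrow> primitive (\<lambda>x. - f x) (\<lambda>x. - f' x)"
  using primitive_cmult[of f f' "-1"] by simp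

lemma primitive_const: "primitive (\<lambda>x. c) (\<lambda>x. 0)"
  unfolding primitive_def by (auto intro!: L1_loc_continuous)

lemma primitive_unique:
  assumes "primitive f h" "primitive g h" "f a = g a"
  shows "f = g"
proof
  fix x show "f x = g x"
    using primitive_integral[OF assms(1), of a x] primitive_integral[OF assms(2), of a x]
      primitive_integral[OF assms(1), of x a] primitive_integral[OF assms(2), of x a] assms(3)
    by (cases "a \<le> x") auto
qed

text \<open>The reflections of the line; they carry statements about the right half-line to the left
  one. The outer minus sign cancels that of the chain rule.\<close>

lemma primitive_reflect:
  assumes f: "primitive f g"
  shows "primitive (\<lambda>x. - f (- x)) (\<lambda>x. g (- x))"
  unfolding primitive_def L1_loc_def
proof (intro conjI allI impI)
  fix a b :: real
  have "g absolutely_integrable_on {-b..-a}" using primitive_L1[OF f] by (simp add: L1_loc_def)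
  then show "(\<lambda>x. g (- x)) absolutely_integrable_on {a..b}"
    using absolutely_integrable_reflect_real[where a="-b" and b="-a" and f=g] by simp
  assume "a \<le> b"
  then show "integral {a..b} (\<lambda>x. g (- x)) = - f (- b) - - f (- a)"
    using Henstock_Kurzweil_Integration.integral_reflect_real[where a="-b" and b="-a" and f=g] primitive_integral[OF f, of "-b" "-a"]
    by simp
qed

lemma primitive_reflect': "primitive f g \<Longrightarrow> primitive (\<lambda>x. f (- x)) (\<lambda>x. - g (- x))"
  using primitive_minus[OF primitive_reflect] by fastforce

lemma primitive_DERIV:
  assumes f: "primitive f g" and g: "isCont g x"
  shows "(f has_real_derivative g x) (at x)"
proof -
  define a b where "a = x - 1" and "b = x + 1"
  have "((\<lambda>t. integral {a..t} g) has_vector_derivative g x) (at x within {a..b})"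
    using integral_has_vector_derivative_continuous_at[OF primitive_integrable[OF f], of x a b "{}"] g
    by (simp add: a_def b_def continuous_at_imp_continuous_at_within)
  then have "((\<lambda>t. integral {a..t} g) has_real_derivative g x) (at x within {a..b})"
    by (simp add: has_real_derivative_iff_has_vector_derivative)
  from DERIV_add[OF DERIV_const[of "f a"] this]
  have "((\<lambda>t. f a + integral {a..t} g) has_real_derivative g x) (at x within {a..b})"
    by simp
  then have der: "((\<lambda>t. f a + integral {a..t} g) has_real_derivative g x) (at x)"
    by (subst (asm) at_within_interior) (auto simp: a_def b_def)
  have "\<forall>\<^sub>F t in nhds x. t \<in> {a<..<b}"
    by (rule eventually_nhds_in_open) (auto simp: a_def b_def)
  then have "\<forall>\<^sub>F t in nhds x. f a + integral {a..t} g = f t"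
    by eventually_elim (auto simp: primitive_integral[OF f])
  from DERIV_cong_ev[OF refl this refl] der show ?thesis by blast
qed

lemma DERIV_primitive:
  assumes "\<And>x. (f has_real_derivative g x) (at x)" "continuous_on UNIV g"
  shows "primitive f g"
  unfolding primitive_def
proof (intro conjI allI impI)
  show "L1_loc g" using assms by (rule_tac L1_loc_continuous)
  fix a b :: real assume "a \<le> b"
  then show "integral {a..b} g = f b - f a"
    using fundamental_theorem_of_calculus[of a b f g] assms(1)
    by (metis has_real_derivative_iff_has_vector_derivative has_vector_derivative_at_within integral_unique)
qed

text \<open>Since \<open>y\<close> is continuous, \<open>q y - f\<close> is locally integrable, so
  \<open>deriv y\<close> is its indefinite integral and is continuous; then \<open>y\<close> is an
  indefinite integral of \<open>deriv y\<close>. Conversely, continuity of \<open>z\<close> makes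
  \<open>y\<close> differentiable everywhere with derivative \<open>z\<close>.\<close>

lemma is_solution_iff_primitive:
  assumes q: "L1_loc q" and f: "L1_loc f"
  shows "is_solution q f y \<longleftrightarrow> (\<exists>z. primitive y z \<and> primitive z (\<lambda>x. q x * y x - f x))"
proof
  assume sol: "is_solution q f y"
  define z where "z = deriv y"
  have yz: "(y has_real_derivative z x) (at x)" for x
    using sol unfolding is_solution_def z_def by (simp add: DERIV_deriv_iff_real_differentiable)
  have ycont: "continuous_on UNIV y" using yz DERIV_isCont by (blast intro: continuous_at_imp_continuous_on)
  have z: "primitive z (\<lambda>x. q x * y x - f x)"
  proof (rule primitiveI)
    show "locally_absolutely_continuous z" using sol by (simp add: is_solution_def z_def)
    have "AE x in lebesgue. deriv y differentiable at x \<and> - deriv (deriv y) x + q x * y x = f x"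
      using sol by (simp add: is_solution_def)
    then show "AE x in lebesgue. (z has_real_derivative q x * y x - f x) (at x)"
    proof eventually_elim
      case (elim x)
      then have "(z has_real_derivative deriv z x) (at x)" by (simp add: z_def DERIV_deriv_iff_real_differentiable)
      moreover have "deriv z x = q x * y x - f x" using elim by (simp add: z_def)
      ultimately show ?case by simp
    qed
    show "L1_loc (\<lambda>x. q x * y x - f x)" by (intro L1_loc_diff L1_loc_mult_continuous q f ycont)
  qed
  have "primitive y z" by (rule DERIV_primitive[OF yz primitive_continuous[OF z]])
  then show "\<exists>z. primitive y z \<and> primitive z (\<lambda>x. q x * y x - f x)" using z by blast
next
  assume "\<exists>z. primitive y z \<and> primitive z (\<lambda>x. q x * y x - f x)"
  then obtain z where y: "primitive y z" and z: "primitive z (\<lambda>x. q x * y x - f x)" by blast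
  have yz: "(y has_real_derivative z x) (at x)" for x
    by (rule primitive_DERIV[OF y primitive_isCont[OF z]])
  then have dy: "deriv y = z" by (auto intro: DERIV_imp_deriv)
  show "is_solution q f y" unfolding is_solution_def dy
  proof (intro conjI allI)
    show "y differentiable at x" for x using yz real_differentiable_def by blast
    show "AE x in lebesgue. z differentiable at x \<and> - deriv z x + q x * y x = f x"
      using primitive_AE_derivative[OF z]
      by eventually_elim (auto simp: DERIV_imp_deriv real_differentiable_def)
  qed (use y z primitive_locally_absolutely_continuous in auto)
qed

section \<open>A fundamental system of solutions\<close>

text \<open>The oriented integral from 0 to \<open>x\<close>. The case distinction is needed because
  the integral over \<open>{0..x}\<close> is 0 for negative \<open>x\<close>.\<close>

definition integral0 :: "(real \<Rightarrow> real) \<Rightarrow> real \<Rightarrow> real" where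
  "integral0 g x = (if 0 \<le> x then integral {0..x} g else - integral {x..0} g)"

lemma integral0_0 [simp]: "integral0 g 0 = 0"
  by (simp add: integral0_def)

lemma primitive_integral0:
  assumes g: "L1_loc g"
  shows "primitive (integral0 g) g"
proof -
  have comb: "integral {u..v} g + integral {v..w} g = integral {u..w} g" if "u \<le> v" "v \<le> w" for u v w
    using that by (intro Henstock_Kurzweil_Integration.integral_combine L1_loc_integrable[OF g])
  have "integral {u..v} g = integral0 g v - integral0 g u" if "u \<le> v" for u v
    using comb[of 0 u v] comb[of u 0 v] comb[of u v 0] that by (auto simp: integral0_def)
  then show ?thesis using g by (simp add: primitive_def)
qed

lemma L1_loc_reflect: "L1_loc g \<Longrightarrow> L1_loc (\<lambda>x. g (- x))"
  using primitive_L1[OF primitive_reflect[OF primitive_integral0]] .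

lemma integral0_reflect:
  assumes g: "L1_loc g"
  shows "integral0 (\<lambda>x. g (- x)) x = - integral0 g (- x)"
proof -
  have "integral0 (\<lambda>x. g (- x)) = (\<lambda>x. - integral0 g (- x))"
    by (rule primitive_unique[where a=0, OF primitive_integral0[OF L1_loc_reflect[OF g]]
        primitive_reflect[OF primitive_integral0[OF g]]]) simp
  then show ?thesis by (rule fun_cong)
qed

section \<open>Picard iteration for the homogeneous equation\<close>

text \<open>Terms \<open>w\<close> of the series for the homogeneous equation: the second derivative
  of each is \<open>q\<close> times its predecessor, and every term after the constant 1 vanishes at
  0 together with its derivative.\<close>

fun picard :: "(real \<Rightarrow> real) \<Rightarrow> nat \<Rightarrow> real \<Rightarrow> real" where
  "picard q 0 = (\<lambda>x. 1)"
| "picard q (Suc n) = integral0 (integral0 (\<lambda>x. q x * picard q n x))"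

declare picard.simps(2) [simp del]

lemma picard_primitive:
  assumes q: "L1_loc q"
  shows "continuous_on UNIV (picard q n)"
    "primitive (integral0 (\<lambda>x. q x * picard q n x)) (\<lambda>x. q x * picard q n x)"
    "primitive (picard q (Suc n)) (integral0 (\<lambda>x. q x * picard q n x))"
proof -
  have step: "primitive (integral0 (\<lambda>x. q x * picard q n x)) (\<lambda>x. q x * picard q n x) \<and>
      primitive (picard q (Suc n)) (integral0 (\<lambda>x. q x * picard q n x))"
    if "continuous_on UNIV (picard q n)" for n
  proof
    show *: "primitive (integral0 (\<lambda>x. q x * picard q n x)) (\<lambda>x. q x * picard q n x)"
      by (intro primitive_integral0 L1_loc_mult_continuous q that)
    show "primitive (picard q (Suc n)) (integral0 (\<lambda>x. q x * picard q n x))"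
      unfolding picard.simps(2)
      by (intro primitive_integral0 L1_loc_continuous primitive_continuous[OF *])
  qed
  show c: "continuous_on UNIV (picard q n)" for n
    by (induction n) (use step primitive_continuous in auto)
  show "primitive (integral0 (\<lambda>x. q x * picard q n x)) (\<lambda>x. q x * picard q n x)"
    "primitive (picard q (Suc n)) (integral0 (\<lambda>x. q x * picard q n x))"
    using step[OF c] by auto
qed

text \<open>The iteration is symmetric under reflection of \<open>q\<close>, which reduces estimates
  at negative points to positive ones.\<close>

lemma picard_reflect:
  assumes q: "L1_loc q"
  shows "picard (\<lambda>x. q (- x)) n x = picard q n (- x)"
proof (induction n arbitrary: x)
  case (Suc n)
  have "integral0 (\<lambda>x. q (- x) * picard (\<lambda>x. q (- x)) n x) = (\<lambda>x. - integral0 (\<lambda>x. q x * picard q n x) (- x))"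
    unfolding Suc by (intro ext integral0_reflect primitive_L1[OF picard_primitive(2)[OF q]])
  moreover have "integral0 (\<lambda>x. - integral0 (\<lambda>x. q x * picard q n x) (- x)) x = picard q (Suc n) (- x)"
  proof -
    have "primitive (\<lambda>x. picard q (Suc n) (- x)) (\<lambda>x. - integral0 (\<lambda>x. q x * picard q n x) (- x))"
      by (rule primitive_reflect'[OF picard_primitive(3)[OF q]])
    then show ?thesis
      using primitive_unique[where a=0, OF primitive_integral0[OF primitive_L1]]
      by (fastforce simp: picard.simps(2))
  qed
  ultimately show ?case by (simp add: picard.simps(2))
qed simp

text \<open>Induction. In the bound for \<open>picard q n s\<close> the factor \<open>s\<close> is
  enlarged to \<open>x\<close>; integrating \<open>q * Q ^ n\<close> to
  \<open>Q ^ Suc n / Suc n\<close> then produces the factorial, and the second integration costs one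
  more factor \<open>x\<close>.\<close>

lemma picard_bound_pos:
  assumes q: "L1_loc q" and nn: "AE x in lebesgue. 0 \<le> q x" and x: "0 \<le> x"
  shows "0 \<le> picard q n x \<and> picard q n x \<le> (x * integral0 q x) ^ n / fact n"
  using x
proof (induction n arbitrary: x)
  case (Suc n)
  define Q where "Q = integral0 q"
  define J where "J = integral0 (\<lambda>x. q x * picard q n x)"
  have Q: "primitive Q q" unfolding Q_def by (rule primitive_integral0[OF q])
  have J: "primitive J (\<lambda>x. q x * picard q n x)" unfolding J_def by (rule picard_primitive(2)[OF q])
  have Qmono: "Q s \<le> Q t" if "s \<le> t" for s t
  proof -
    have "AE x in lebesgue. x \<in> {s..t} \<longrightarrow> 0 \<le> q x" using nn by eventually_elim auto
    from primitive_mono[OF Q that this] show ?thesis by simp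
  qed
  have Q0: "Q 0 = 0" and J0: "J 0 = 0" by (auto simp: Q_def J_def)
  have Qn: "primitive (\<lambda>x. Q x ^ Suc n) (\<lambda>x. real (Suc n) * (q x * Q x ^ n))" for n
  proof (induction n)
    case 0 then show ?case using Q by simp
  next
    case (Suc n)
    have "(\<lambda>x. q x * Q x ^ Suc n + real (Suc n) * (q x * Q x ^ n) * Q x) = (\<lambda>x. real (Suc (Suc n)) * (q x * Q x ^ Suc n))"
      by (simp add: algebra_simps)
    then show ?case using primitive_mult[OF Q Suc] by simp
  qed
  have Jb: "0 \<le> J t \<and> J t \<le> x ^ n * Q x ^ Suc n / fact (Suc n)" if t: "0 \<le> t" "t \<le> x" for t
  proof
    have Jt: "J t = integral {0..t} (\<lambda>s. q s * picard q n s)"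
      using primitive_integral[OF J t(1)] J0 by simp
    show "0 \<le> J t"
    proof -
      have "AE s in lebesgue. s \<in> {0..t} \<longrightarrow> 0 \<le> q s * picard q n s"
        using nn by eventually_elim (use Suc.IH in auto)
      from primitive_mono[OF J t(1) this] show ?thesis using J0 by simp
    qed
    have prim: "primitive (\<lambda>s. x ^ n / fact n * (1 / real (Suc n) * Q s ^ Suc n))
       (\<lambda>s. x ^ n / fact n * (1 / real (Suc n) * (real (Suc n) * (q s * Q s ^ n))))"
      by (intro primitive_cmult Qn)
    have "J t \<le> integral {0..t} (\<lambda>s. x ^ n / fact n * (1 / real (Suc n) * (real (Suc n) * (q s * Q s ^ n))))"
      unfolding Jt
    proof (rule integral_mono_AE_lebesgue)
      show "AE s in lebesgue. s \<in> {0..t} \<longrightarrow> q s * picard q n s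
          \<le> x ^ n / fact n * (1 / real (Suc n) * (real (Suc n) * (q s * Q s ^ n)))"
        using nn
      proof eventually_elim
        case (elim s)
        show ?case
        proof
          assume s: "s \<in> {0..t}"
          have "picard q n s \<le> (s * Q s) ^ n / fact n" using Suc.IH[of s] s by (simp add: Q_def)
          also have "\<dots> \<le> (x * Q s) ^ n / fact n"
            using s t Qmono[of 0 s] Q0 by (intro divide_right_mono power_mono mult_right_mono) auto
          finally have "q s * picard q n s \<le> q s * ((x * Q s) ^ n / fact n)"
            using elim by (rule mult_left_mono)
          then show "q s * picard q n s \<le> x ^ n / fact n * (1 / real (Suc n) * (real (Suc n) * (q s * Q s ^ n)))"
            by (simp add: power_mult_distrib mult.commute mult.left_commute)
        qed
      qed
    qed (use primitive_integrable[OF J] primitive_integrable[OF prim] in auto)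
    also have "\<dots> = x ^ n / fact n * (1 / real (Suc n) * Q t ^ Suc n)"
      using primitive_integral[OF prim t(1)] Q0 by simp
    also have "\<dots> \<le> x ^ n / fact n * (1 / real (Suc n) * Q x ^ Suc n)"
      using t Qmono[of 0 t] Qmono[of t x] Q0 by (intro mult_left_mono power_mono) auto
    finally show "J t \<le> x ^ n * Q x ^ Suc n / fact (Suc n)" by (simp add: field_simps)
  qed
  have P: "picard q (Suc n) x = integral {0..x} J"
    using primitive_integral[OF picard_primitive(3)[OF q, of n] Suc.prems]
    by (simp add: J_def picard.simps(2))
  have Jint: "J integrable_on {0..x}"
    using primitive_integrable[OF picard_primitive(3)[OF q, of n]] by (simp add: J_def)
  have "0 \<le> integral {0..x} J" using Jb by (intro Henstock_Kurzweil_Integration.integral_nonneg Jint) auto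
  moreover have "integral {0..x} J \<le> integral {0..x} (\<lambda>t. x ^ n * Q x ^ Suc n / fact (Suc n))"
    using Jb by (intro integral_le Jint) auto
  moreover have "integral {0..x} (\<lambda>t. x ^ n * Q x ^ Suc n / fact (Suc n)) = (x * Q x) ^ Suc n / fact (Suc n)"
    using Suc.prems by (simp add: power_mult_distrib del: fact_Suc)
  ultimately show ?case unfolding P Q_def by linarith
qed simp

lemma AE_lebesgue_reflect:
  fixes P :: "real \<Rightarrow> bool"
  assumes "AE x in lebesgue. P x"
  shows "AE x in lebesgue. P (- x)"
proof -
  obtain N where N: "negligible N" "\<And>x. x \<notin> N \<Longrightarrow> P x"
    using AE_lebesgue_imp_negligible[OF assms] by blast
  have "negligible (uminus ` N)"
    by (rule negligible_differentiable_image_negligible[OF _ N(1)]) (auto intro!: derivative_intros)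
  then show ?thesis
    by (rule negligible_imp_AE_lebesgue) (use N(2) in force)
qed

lemma picard_bound:
  assumes q: "L1_loc q" and nn: "AE x in lebesgue. 0 \<le> q x"
  shows "0 \<le> picard q n x" "picard q n x \<le> \<bar>x * integral0 q x\<bar> ^ n / fact n"
proof -
  have le: "a ^ n / fact n \<le> \<bar>a\<bar> ^ n / fact n" for a :: real
    by (intro divide_right_mono) (auto simp flip: power_abs)
  have "0 \<le> picard q n x \<and> picard q n x \<le> \<bar>x * integral0 q x\<bar> ^ n / fact n"
  proof (cases "0 \<le> x")
    case True
    show ?thesis
      using picard_bound_pos[OF q nn True, of n] le[of "x * integral0 q x"] by linarith
  next
    case False
    have "AE x in lebesgue. 0 \<le> q (- x)"
      using nn by (rule AE_lebesgue_reflect)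
    then have "0 \<le> picard (\<lambda>x. q (- x)) n (- x) \<and>
        picard (\<lambda>x. q (- x)) n (- x) \<le> (- x * integral0 (\<lambda>x. q (- x)) (- x)) ^ n / fact n"
      using False by (intro picard_bound_pos L1_loc_reflect q) auto
    then show ?thesis
      using le[of "x * integral0 q x"]
      by (simp add: picard_reflect[OF q] integral0_reflect[OF q])
  qed
  then show "0 \<le> picard q n x" "picard q n x \<le> \<bar>x * integral0 q x\<bar> ^ n / fact n" by auto
qed


text \<open>The solution with \<open>f 0 = 1\<close>, \<open>f' 0 = 0\<close> is the sum of the Picard series, all of whose
  terms are nonnegative on the whole line.\<close>

lemma homogeneous_solution_ge_1:
  assumes q: "L1_loc q" and nn: "AE x in lebesgue. 0 \<le> q x"
  obtains f f' where "primitive f f'" "primitive f' (\<lambda>x. q x * f x)" "f' 0 = 0" "\<And>x. 1 \<le> f x"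
proof -
  define w where "w = picard q"
  define J where "J n = integral0 (\<lambda>x. q x * w n x)" for n
  have w: "continuous_on UNIV (w n)" and J: "primitive (J n) (\<lambda>x. q x * w n x)"
    and wS: "primitive (w (Suc n)) (J n)" for n
    using picard_primitive[OF q] by (auto simp: w_def J_def)
  have w0: "w 0 x = 1" and wS0: "w (Suc n) 0 = 0" and J0: "J n 0 = 0" and wnn: "0 \<le> w n x" for n x
    using picard_bound(1)[OF q nn] by (auto simp: w_def J_def picard.simps(2))
  \<comment> \<open>A bound on the compact interval, so that the terms are dominated there by an
    exponential series and the M-test gives uniform convergence.\<close>
  define B where "B N = (SUP x\<in>{-N..N}. \<bar>x * integral0 q x\<bar>)" for N
  have wB: "w n x \<le> B N ^ n / fact n" if "x \<in> {-N..N}" for n x N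
  proof -
    have c: "continuous_on {-N..N} (\<lambda>x. \<bar>x * integral0 q x\<bar>)"
      by (intro continuous_intros primitive_continuous[OF primitive_integral0[OF q]])
    have "bdd_above ((\<lambda>x. \<bar>x * integral0 q x\<bar>) ` {-N..N})"
      by (rule bounded_imp_bdd_above[OF compact_imp_bounded[OF compact_continuous_image[OF c]]]) simp
    then have "\<bar>x * integral0 q x\<bar> \<le> B N" unfolding B_def using that by (rule cSUP_upper[rotated])
    then have "\<bar>x * integral0 q x\<bar> ^ n / fact n \<le> B N ^ n / fact n"
      by (intro divide_right_mono power_mono) auto
    then show ?thesis using picard_bound(2)[OF q nn, of n x] by (simp add: w_def)
  qed
  have sumB: "summable (\<lambda>n. B N ^ n / fact n)" for N
    using summable_exp[of "B N"] by (simp add: field_simps)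
  define f where "f x = (\<Sum>n. w n x)" for x
  define S where "S n x = (\<Sum>k<n. w k x)" for n x
  have summ: "summable (\<lambda>n. w n x)" for x
  proof (rule summable_comparison_test'[OF sumB[of "\<bar>x\<bar>"], of 0])
    have "x \<in> {-\<bar>x\<bar>..\<bar>x\<bar>}" by (simp add: abs_if)
    then show "norm (w n x) \<le> B \<bar>x\<bar> ^ n / fact n" for n using wB wnn by simp
  qed
  have lim: "(\<lambda>n. S n x) \<longlonglongrightarrow> f x" for x
    unfolding S_def f_def using summable_LIMSEQ[OF summ] .
  have S_le: "S n x \<le> f x" and S_nn: "0 \<le> S n x" for n x
    unfolding S_def f_def by (auto intro!: sum_le_suminf summ wnn sum_nonneg)
  have contS: "continuous_on A (S n)" for n A
    unfolding S_def by (intro continuous_intros continuous_on_subset[OF w]) auto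
  have cont: "continuous_on UNIV f"
  proof -
    have "continuous_on {-N..N} f" for N
    proof (rule uniform_limit_theorem[where f=S and F=sequentially])
      have "uniform_limit {-N..N} (\<lambda>n x. \<Sum>k<n. w k x) (\<lambda>x. suminf (\<lambda>k. w k x)) sequentially"
        by (rule Weierstrass_m_test[OF _ sumB[of N]]) (use wB wnn in auto)
      then show "uniform_limit {-N..N} S f sequentially" unfolding S_def f_def .
    qed (use contS in auto)
    then have *: "continuous_on {-(\<bar>x\<bar>+1)..\<bar>x\<bar>+1} f" for x by blast
    have "isCont f x" for x
      by (rule continuous_on_interior[OF *[of x]]) (use abs_ge_self[of x] abs_ge_minus_self[of x] in auto)
    then show ?thesis by (simp add: continuous_at_imp_continuous_on)
  qed
  have ge1: "1 \<le> f x" for x using S_le[of 1 x] by (simp add: S_def w0)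
  define f' where "f' = integral0 (\<lambda>x. q x * f x)"
  have qf: "L1_loc (\<lambda>x. q x * f x)" by (rule L1_loc_mult_continuous[OF q cont])
  have f': "primitive f' (\<lambda>x. q x * f x)" unfolding f'_def by (rule primitive_integral0[OF qf])
  define Z where "Z n x = (\<Sum>k<n. J k x)" for n x
  have Z: "primitive (Z n) (\<lambda>x. q x * S n x)" for n
  proof (induction n)
    case 0 then show ?case using primitive_const[of 0] by (simp add: Z_def S_def)
  next
    case (Suc n)
    show ?case using primitive_add[OF Suc J[of n]] by (simp add: Z_def S_def algebra_simps)
  qed
  \<comment> \<open>The index shifts by one because the initial term of \<open>S\<close> is the
    constant 1 and contributes nothing to the derivative.\<close>
  have SZ: "primitive (S (Suc n)) (Z n)" for n
  proof (induction n)
    case 0 then show ?case using primitive_const[of 1] by (simp add: Z_def S_def w0)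
  next
    case (Suc n)
    show ?case using primitive_add[OF Suc wS[of n]] by (simp add: Z_def S_def algebra_simps)
  qed
  have Z0: "Z n 0 = 0" and f'0: "f' 0 = 0" for n by (auto simp: Z_def J0 f'_def)
  \<comment> \<open>Nonnegativity of the terms places the partial sums between 0 and
    \<open>f\<close>, so \<open>|q * f|\<close> dominates.\<close>
  have limI: "(\<lambda>n. integral {a..b} (\<lambda>x. q x * S n x)) \<longlonglongrightarrow> integral {a..b} (\<lambda>x. q x * f x)" for a b
  proof (rule dominated_convergence(2))
    show "(\<lambda>x. q x * S n x) integrable_on {a..b}" for n by (rule primitive_integrable[OF Z])
    show "(\<lambda>x. \<bar>q x * f x\<bar>) integrable_on {a..b}" by (rule L1_loc_integrable[OF L1_loc_abs[OF qf]])
    show "norm (q x * S n x) \<le> \<bar>q x * f x\<bar>" for n x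
      using S_le[of n x] S_nn[of n x] by (auto simp: abs_mult intro!: mult_left_mono)
    show "(\<lambda>n. q x * S n x) \<longlonglongrightarrow> q x * f x" for x by (intro tendsto_intros lim)
  qed
  have limZ: "(\<lambda>n. Z n x) \<longlonglongrightarrow> f' x" for x
  proof (cases "0 \<le> x")
    case True
    then show ?thesis using limI[of 0 x] by (simp add: primitive_integral[OF Z] primitive_integral[OF f'] Z0 f'0)
  next
    case False
    then show ?thesis using tendsto_minus[OF limI[of x 0]]
      by (simp add: primitive_integral[OF Z] primitive_integral[OF f'] Z0 f'0)
  qed
  have Zb: "\<bar>Z n x\<bar> \<le> integral {-\<bar>x\<bar>..\<bar>x\<bar>} (\<lambda>x. \<bar>q x * f x\<bar>)" for n x
  proof -
    have *: "\<bar>integral {a..b} (\<lambda>x. q x * S n x)\<bar> \<le> integral {-\<bar>x\<bar>..\<bar>x\<bar>} (\<lambda>x. \<bar>q x * f x\<bar>)"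
      if "-\<bar>x\<bar> \<le> a" "b \<le> \<bar>x\<bar>" for a b
    proof -
      have "\<bar>integral {a..b} (\<lambda>x. q x * S n x)\<bar> \<le> integral {a..b} (\<lambda>x. \<bar>q x * f x\<bar>)"
        by (rule integral_norm_bound_integral[where 'a=real, unfolded real_norm_def,
              OF primitive_integrable[OF Z] L1_loc_integrable[OF L1_loc_abs[OF qf]]])
          (use order_trans[OF S_le abs_ge_self] S_nn in \<open>auto simp: abs_mult intro!: mult_left_mono\<close>)
      also have "\<dots> \<le> integral {-\<bar>x\<bar>..\<bar>x\<bar>} (\<lambda>x. \<bar>q x * f x\<bar>)"
        by (rule integral_subset_le) (use that L1_loc_integrable[OF L1_loc_abs[OF qf]] in auto)
      finally show ?thesis .
    qed
    show ?thesis
      using *[of 0 x] *[of x 0]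
      by (cases "0 \<le> x") (auto simp: primitive_integral[OF Z] Z0)
  qed
  have "primitive f f'"
    unfolding primitive_def
  proof (intro conjI allI impI)
    show "L1_loc f'" by (rule L1_loc_continuous[OF primitive_continuous[OF f']])
    fix a b :: real assume ab: "a \<le> b"
    define N where "N = max \<bar>a\<bar> \<bar>b\<bar>"
    have "(\<lambda>n. integral {a..b} (Z n)) \<longlonglongrightarrow> integral {a..b} f'"
    proof (rule dominated_convergence(2))
      show "Z n integrable_on {a..b}" for n by (rule primitive_integrable[OF SZ])
      show "(\<lambda>x. integral {-N..N} (\<lambda>x. \<bar>q x * f x\<bar>)) integrable_on {a..b}" by (rule integrable_on_const) simp
      show "norm (Z n x) \<le> integral {-N..N} (\<lambda>x. \<bar>q x * f x\<bar>)" if "x \<in> {a..b}" for n x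
      proof -
        have "integral {-\<bar>x\<bar>..\<bar>x\<bar>} (\<lambda>x. \<bar>q x * f x\<bar>) \<le> integral {-N..N} (\<lambda>x. \<bar>q x * f x\<bar>)"
          by (rule integral_subset_le) (use that L1_loc_integrable[OF L1_loc_abs[OF qf]] in \<open>auto simp: N_def\<close>)
        then show ?thesis using Zb[of n x] by simp
      qed
      show "(\<lambda>n. Z n x) \<longlonglongrightarrow> f' x" for x by (rule limZ)
    qed
    moreover have "integral {a..b} (Z n) = S (Suc n) b - S (Suc n) a" for n
      by (rule primitive_integral[OF SZ ab])
    moreover have "(\<lambda>n. S (Suc n) b - S (Suc n) a) \<longlonglongrightarrow> f b - f a"
      by (intro tendsto_diff LIMSEQ_Suc lim)
    ultimately show "integral {a..b} f' = f b - f a" by (simp add: LIMSEQ_unique)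
  qed
  then show thesis using that f' f'0 ge1 by blast
qed

text \<open>Bridge to the integrals occurring in \<open>d_fun\<close> and \<open>agrees\<close>,
  which are taken over the open interval; its endpoints form a null set.\<close>

lemma interval_integral_lebesgue_eq_integral:
  assumes f: "L1_loc f" and ab: "a \<le> b"
  shows "(LINT t=ereal a..ereal b|lebesgue. f t) = integral {a..b} f"
proof -
  have "set_integrable lebesgue {a..b} f" using f by (simp add: L1_loc_def)
  then have "set_integrable lebesgue {a<..<b} f" by (rule set_integrable_subset) auto
  then have "(LINT t:{a<..<b}|lebesgue. f t) = integral {a<..<b} f" by (rule set_lebesgue_integral_eq_integral)
  then show ?thesis using ab by (simp add: interval_lebesgue_integral_def integral_open_interval_real)
qed

lemma integral_nonpos_imp_AE_zero:
  assumes q: "L1_loc q" and nn: "AE x in lebesgue. 0 \<le> q x" and le: "integral {a..b} q \<le> 0"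
  shows "AE t in lebesgue. t \<in> {a..b} \<longrightarrow> q t = 0"
proof -
  have int: "set_integrable lebesgue {a..b} q" using q by (simp add: L1_loc_def)
  have nn': "AE t in lebesgue. 0 \<le> indicator {a..b} t *\<^sub>R q t" using nn by eventually_elim auto
  have "(LINT t|lebesgue. indicator {a..b} t *\<^sub>R q t) \<le> 0"
    using le set_lebesgue_integral_eq_integral(2)[OF int] by (simp add: set_lebesgue_integral_def)
  moreover have "0 \<le> (LINT t|lebesgue. indicator {a..b} t *\<^sub>R q t)"
    by (rule integral_nonneg_AE[OF nn'])
  ultimately have "(LINT t|lebesgue. indicator {a..b} t *\<^sub>R q t) = 0" by linarith
  then have "AE t in lebesgue. indicator {a..b} t *\<^sub>R q t = 0"
    using integral_nonneg_eq_0_iff_AE[OF int[unfolded set_integrable_def] nn'] by blast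
  then show ?thesis by eventually_elim auto
qed

section \<open>Potentials with mass at both ends, and their fundamental systems\<close>

text \<open>The half-line masses are extended nonnegative integrals since they may be
  infinite.\<close>

locale potential =
  fixes q :: "real \<Rightarrow> real"
  assumes q_nonneg: "AE x in lebesgue. 0 \<le> q x"
    and q_loc: "L1_loc q"
    and q_left: "\<And>x. (\<integral>\<^sup>+t\<in>{..x}. ennreal (q t) \<partial>lebesgue) > 0"
    and q_right: "\<And>x. (\<integral>\<^sup>+t\<in>{x..}. ennreal (q t) \<partial>lebesgue) > 0"
begin

lemma AE_nonneg: "AE x in lebesgue. P x \<longrightarrow> 0 \<le> q x"
  using q_nonneg by eventually_elim auto

text \<open>If no compact interval of the exhaustion carried mass, \<open>q\<close> would vanish
  almost everywhere on each of them, hence on \<open>A\<close>.\<close>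

lemma mass_on_exhaustion:
  assumes pos: "(\<integral>\<^sup>+t\<in>A. ennreal (q t) \<partial>lebesgue) > 0" and A: "A \<subseteq> (\<Union>n::nat. {a n..b n})"
  obtains n where "0 < integral {a n..b n} q"
proof (rule ccontr)
  assume "\<not> thesis"
  then have "integral {a n..b n} q \<le> 0" for n
    using that[of n] by linarith
  then have "AE t in lebesgue. \<forall>n. t \<in> {a n..b n} \<longrightarrow> q t = 0"
    unfolding AE_all_countable by (intro allI integral_nonpos_imp_AE_zero q_loc q_nonneg)
  then have "AE t in lebesgue. ennreal (q t) * indicator A t = 0"
  proof eventually_elim
    case (elim t)
    then have "q t = 0" if "t \<in> A" using that A by fast
    then show ?case by (cases "t \<in> A") auto
  qed
  then have "(\<integral>\<^sup>+t\<in>A. ennreal (q t) \<partial>lebesgue) = (\<integral>\<^sup>+t. 0 \<partial>(lebesgue :: real measure))" by (rule nn_integral_cong_AE)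
  then show False using pos by simp
qed

lemma right_mass: obtains b where "x \<le> b" "0 < integral {x..b} q"
proof -
  have sub: "{x..} \<subseteq> (\<Union>n::nat. {x..x + real n})"
  proof
    fix t assume "t \<in> {x..}"
    moreover obtain n where "t - x \<le> real n" using real_arch_simple by blast
    ultimately show "t \<in> (\<Union>n::nat. {x..x + real n})" by (auto simp: algebra_simps)
  qed
  show thesis
    by (rule mass_on_exhaustion[OF q_right sub]) (rule that, auto)
qed

lemma left_mass: obtains a where "a \<le> x" "0 < integral {a..x} q"
proof -
  have sub: "{..x} \<subseteq> (\<Union>n::nat. {x - real n..x})"
  proof
    fix t assume "t \<in> {..x}"
    moreover obtain n where "x - t \<le> real n" using real_arch_simple by blast
    ultimately show "t \<in> (\<Union>n::nat. {x - real n..x})" by (auto simp: algebra_simps)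
  qed
  show thesis
    by (rule mass_on_exhaustion[OF q_left sub]) (rule that, auto)
qed

text \<open>Reduction of order: with \<open>P' = 1 / f\<^sup>2\<close>, both \<open>f (P - inf P)\<close> and \<open>f (sup P - P)\<close> are
  solutions; \<open>P\<close> is bounded because \<open>f\<close> grows linearly at both ends.\<close>

lemma fundamental_system:
  obtains u u' v v' where
    "primitive u u'" "primitive u' (\<lambda>x. q x * u x)" "\<And>x. 0 < u x" "\<And>x. 0 \<le> u' x"
    "primitive v v'" "primitive v' (\<lambda>x. q x * v x)" "\<And>x. 0 < v x" "\<And>x. v' x \<le> 0"
    "\<And>x. u' x * v x - u x * v' x = 1"
proof -
  obtain f f' where f: "primitive f f'" and f': "primitive f' (\<lambda>x. q x * f x)" and f'0: "f' 0 = 0"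
    and ge1: "\<And>x. 1 \<le> f x"
    using homogeneous_solution_ge_1[OF q_loc q_nonneg] by blast
  have fpos: "0 < f x" and fne: "f x \<noteq> 0" for x using ge1[of x] by auto
  have f'mono: "f' s \<le> f' t" if "s \<le> t" for s t
  proof -
    have "AE x in lebesgue. x \<in> {s..t} \<longrightarrow> 0 \<le> q x * f x"
      using q_nonneg by eventually_elim (auto intro!: mult_nonneg_nonneg less_imp_le[OF fpos])
    from primitive_mono[OF f' that this] show ?thesis by simp
  qed
  have q_le: "integral {s..t} q \<le> f' t - f' s" if "s \<le> t" for s t
  proof -
    have "integral {s..t} q \<le> integral {s..t} (\<lambda>x. q x * f x)"
    proof (rule integral_mono_AE_lebesgue)
      show "AE x in lebesgue. x \<in> {s..t} \<longrightarrow> q x \<le> q x * f x"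
        using q_nonneg by eventually_elim (use ge1 in \<open>auto simp: mult_le_cancel_left1\<close>)
    qed (use L1_loc_integrable[OF q_loc] primitive_integrable[OF f'] in auto)
    then show ?thesis by (simp add: primitive_integral[OF f' that])
  qed
  have Df: "(f has_real_derivative f' x) (at x)" for x
    by (rule primitive_DERIV[OF f primitive_isCont[OF f']])
  have cinv: "continuous_on UNIV (\<lambda>x. 1 / (f x)\<^sup>2)"
    by (intro continuous_intros primitive_continuous[OF f]) (use fne in auto)
  define P where "P = integral0 (\<lambda>x. 1 / (f x)\<^sup>2)"
  have P: "primitive P (\<lambda>x. 1 / (f x)\<^sup>2)"
    unfolding P_def by (rule primitive_integral0[OF L1_loc_continuous[OF cinv]])
  have DP: "(P has_real_derivative 1 / (f x)\<^sup>2) (at x)" for x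
    by (rule primitive_DERIV[OF P]) (use cinv in \<open>simp add: continuous_on_eq_continuous_at\<close>)
  have Pmono: "P s < P t" if "s < t" for s t
  proof (rule DERIV_pos_imp_increasing[OF that])
    fix x
    show "\<exists>y. (P has_real_derivative y) (at x) \<and> 0 < y"
      using DP[of x] fpos[of x] by (intro exI[of _ "1 / (f x)\<^sup>2"]) simp
  qed
  \<comment> \<open>The derivative of \<open>P + 1 / (f' X * f)\<close> is
    \<open>(1 - f' z / f' X) / f\<^sup>2\<close>. By monotonicity of \<open>f'\<close> it is
    nonpositive to the right of \<open>X\<close> if \<open>f' X > 0\<close> and to the left of
    \<open>X\<close> if \<open>f' X < 0\<close>. This is where growth of \<open>f\<close> bounds
    \<open>P\<close>.\<close>
  have antimono: "P t + 1 / (f' X * f t) \<le> P s + 1 / (f' X * f s)"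
    if "s \<le> t" "f' X \<noteq> 0" "\<And>z. s \<le> z \<Longrightarrow> z \<le> t \<Longrightarrow> 1 \<le> f' z / f' X" for s t X
  proof (rule DERIV_nonpos_imp_nonincreasing[OF that(1), of "\<lambda>x. P x + 1 / (f' X * f x)"])
    fix z assume z: "s \<le> z" "z \<le> t"
    have "((\<lambda>x. P x + 1 / (f' X * f x)) has_real_derivative (1 / (f z)\<^sup>2) * (1 - f' z / f' X)) (at z)"
      using fne[of z] that(2)
      by (auto intro!: derivative_eq_intros DP Df simp: field_simps power2_eq_square)
    moreover have "(1 / (f z)\<^sup>2) * (1 - f' z / f' X) \<le> 0"
      using that(3)[OF z] fpos[of z] by (intro mult_nonneg_nonpos) auto
    ultimately show "\<exists>y. ((\<lambda>x. P x + 1 / (f' X * f x)) has_real_derivative y) (at z) \<and> y \<le> 0" by blast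
  qed
  have ub: "P x \<le> P X + 1 / (f' X * f X)" if X: "f' X > 0" for x X
  proof (cases "x \<le> X")
    case True
    have "P x \<le> P X" using Pmono[of x X] True by (cases "x = X") auto
    moreover have "0 \<le> 1 / (f' X * f X)" using X fpos[of X] by simp
    ultimately show ?thesis by linarith
  next
    case False
    have "P x + 1 / (f' X * f x) \<le> P X + 1 / (f' X * f X)"
      using False X by (intro antimono) (auto simp: f'mono)
    moreover have "0 \<le> 1 / (f' X * f x)" using X fpos[of x] by simp
    ultimately show ?thesis by linarith
  qed
  have lb: "P X + 1 / (f' X * f X) \<le> P x" if X: "f' X < 0" for x X
  proof (cases "X \<le> x")
    case True
    have "P X \<le> P x" using Pmono[of X x] True by (cases "x = X") auto
    moreover have "1 / (f' X * f X) \<le> 0" using X fpos[of X] by (intro divide_nonneg_neg mult_neg_pos) auto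
    ultimately show ?thesis by linarith
  next
    case False
    have "P X + 1 / (f' X * f X) \<le> P x + 1 / (f' X * f x)"
      using False X by (intro antimono) (auto simp: f'mono le_divide_eq)
    moreover have "1 / (f' X * f x) \<le> 0" using X fpos[of x] by (intro divide_nonneg_neg mult_neg_pos) auto
    ultimately show ?thesis by linarith
  qed
  obtain X1 where X1: "f' X1 > 0"
  proof -
    obtain b where "0 \<le> b" "0 < integral {0..b} q" by (rule right_mass)
    then show thesis using q_le[of 0 b] f'0 that[of b] by auto
  qed
  obtain X2 where X2: "f' X2 < 0"
  proof -
    obtain a where "a \<le> 0" "0 < integral {a..0} q" by (rule left_mass)
    then show thesis using q_le[of a 0] f'0 that[of a] by auto
  qed
  define L where "L = (SUP x. P x)"
  define l where "l = (INF x. P x)"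
  have bdd: "bdd_above (range P)" "bdd_below (range P)"
    using ub[OF X1] lb[OF X2] by (auto intro!: bdd_aboveI bdd_belowI)
  have PL: "P x < L" for x
    using Pmono[of x "x+1"] cSUP_upper[OF UNIV_I bdd(1), of "x+1"] by (simp add: L_def)
  have lP: "l < P x" for x
    using Pmono[of "x-1" x] cINF_lower[OF bdd(2) UNIV_I, of "x-1"] by (simp add: l_def)
  \<comment> \<open>Multiplied by \<open>f' X\<close>, this is exactly the inequality that makes the
    derivative of \<open>v\<close> nonpositive; \<open>llb\<close> plays the same role for
    \<open>u\<close>.\<close>
  have Lub: "L - P X \<le> 1 / (f' X * f X)" if X: "f' X > 0" for X
    using cSUP_least[of UNIV P, OF _ ub[OF X]] by (simp add: L_def algebra_simps)
  have llb: "1 / (f' X * f X) \<le> l - P X" if X: "f' X < 0" for X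
    using cINF_greatest[of UNIV _ P, OF _ lb[OF X]] by (simp add: l_def algebra_simps)
  \<comment> \<open>The Wronskian of \<open>f * (P - l)\<close> and \<open>f * (L - P)\<close> is
    \<open>L - l\<close>; dividing the second solution by it normalises the Wronskian to 1.\<close>
  define c where "c = L - l"
  have c: "c > 0" using PL[of 0] lP[of 0] by (simp add: c_def)
  have inv: "primitive (\<lambda>x. 1 / f x) (\<lambda>x. - f' x / (f x)\<^sup>2)"
    by (rule DERIV_primitive)
      (use fne in \<open>auto intro!: derivative_eq_intros Df continuous_intros primitive_continuous[OF f]
          primitive_continuous[OF f'] simp: power2_eq_square\<close>)
  \<comment> \<open>Any constant \<open>k\<close> may be subtracted from \<open>P\<close>, because
    \<open>f\<close> itself is a solution; the two terms \<open>f' / f\<^sup>2\<close>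
    cancel.\<close>
  have sol: "primitive (\<lambda>x. (P x - k) * f x) (\<lambda>x. f' x * (P x - k) + 1 / f x)"
      "primitive (\<lambda>x. f' x * (P x - k) + 1 / f x) (\<lambda>x. q x * ((P x - k) * f x))" for k
  proof -
    have Pk: "primitive (\<lambda>x. P x - k) (\<lambda>x. 1 / (f x)\<^sup>2)"
      using primitive_add[OF P primitive_const[of "-k"]] by simp
    have "(\<lambda>x. 1 / (f x)\<^sup>2 * f x + f' x * (P x - k)) = (\<lambda>x. f' x * (P x - k) + 1 / f x)"
      using fne by (auto simp: power2_eq_square)
    with primitive_mult[OF Pk f]
    show "primitive (\<lambda>x. (P x - k) * f x) (\<lambda>x. f' x * (P x - k) + 1 / f x)" by simp
    have "(\<lambda>x. q x * f x * (P x - k) + 1 / (f x)\<^sup>2 * f' x + - f' x / (f x)\<^sup>2) = (\<lambda>x. q x * ((P x - k) * f x))"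
      by (auto simp: algebra_simps)
    with primitive_add[OF primitive_mult[OF f' Pk] inv]
    show "primitive (\<lambda>x. f' x * (P x - k) + 1 / f x) (\<lambda>x. q x * ((P x - k) * f x))" by simp
  qed
  define u where "u x = (P x - l) * f x" for x
  define u' where "u' x = f' x * (P x - l) + 1 / f x" for x
  define v where "v x = - 1 / c * ((P x - L) * f x)" for x
  define v' where "v' x = - 1 / c * (f' x * (P x - L) + 1 / f x)" for x
  show thesis
  proof (rule that)
    show "primitive u u'" "primitive u' (\<lambda>x. q x * u x)"
      using sol[of l] by (simp_all add: u_def[abs_def] u'_def[abs_def])
    show "primitive v v'"
      using primitive_cmult[OF sol(1)[of L], of "- 1 / c"] by (simp add: v_def[abs_def] v'_def[abs_def])
    show "primitive v' (\<lambda>x. q x * v x)"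
      using primitive_cmult[OF sol(2)[of L], of "- 1 / c"]
      by (simp add: v_def[abs_def] v'_def[abs_def] algebra_simps)
    fix x
    show "0 < u x" using lP fpos by (simp add: u_def)
    show "0 < v x" using PL[of x] fpos[of x] c by (simp add: v_def divide_less_0_iff mult_less_0_iff)
    show "0 \<le> u' x"
    proof (cases "f' x < 0")
      case True
      then have "f' x * (l - P x) \<le> f' x * (1 / (f' x * f x))" by (intro mult_left_mono_neg llb) auto
      then show ?thesis using True by (simp add: u'_def algebra_simps)
    next
      case False
      then show ?thesis using lP[of x] fpos[of x] by (simp add: u'_def)
    qed
    have "0 \<le> f' x * (P x - L) + 1 / f x"
    proof (cases "f' x > 0")
      case True
      then have "f' x * (L - P x) \<le> f' x * (1 / (f' x * f x))" by (intro mult_left_mono Lub) auto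
      then show ?thesis using True by (simp add: algebra_simps)
    next
      case False
      then have "0 \<le> f' x * (P x - L)" using PL[of x] by (intro mult_nonpos_nonpos) auto
      then show ?thesis using fpos[of x] by (simp add: add_nonneg_pos less_imp_le)
    qed
    then show "v' x \<le> 0" using c by (simp add: v'_def)
    show "u' x * v x - u x * v' x = 1"
      using c fne[of x] by (simp add: u_def v_def u'_def v'_def field_simps) (simp add: c_def algebra_simps)
  qed
qed

end

section \<open>The function d and the Green function\<close>

lemma primitive_le:
  assumes "primitive f g" "a \<le> b" "AE x in lebesgue. x \<in> {a..b} \<longrightarrow> g x \<le> c"
  shows "f b \<le> f a + c * (b - a)"
proof -
  have "AE x in lebesgue. x \<in> {a..b} \<longrightarrow> - c \<le> - g x" using assms(3) by eventually_elim auto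
  from primitive_mono[OF primitive_minus[OF assms(1)] assms(2) this] show ?thesis by simp
qed

text \<open>Integrates an inequality between derivatives when explicit antiderivatives of both sides
  are at hand.\<close>

lemma DERIV_diff_mono:
  fixes f g :: "real \<Rightarrow> real"
  assumes "a \<le> b"
    and "\<And>x. a \<le> x \<Longrightarrow> x \<le> b \<Longrightarrow> (f has_real_derivative f' x) (at x)"
    and "\<And>x. a \<le> x \<Longrightarrow> x \<le> b \<Longrightarrow> (g has_real_derivative g' x) (at x)"
    and "\<And>x. a \<le> x \<Longrightarrow> x \<le> b \<Longrightarrow> f' x \<le> g' x"
  shows "f b - f a \<le> g b - g a"
proof -
  have "g a - f a \<le> g b - f b"
  proof (rule DERIV_nonneg_imp_nondecreasing[OF assms(1), of "\<lambda>x. g x - f x"])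
    fix x assume "a \<le> x" "x \<le> b"
    then show "\<exists>y. ((\<lambda>x. g x - f x) has_real_derivative y) (at x) \<and> 0 \<le> y"
      using assms(2-4)[of x] by (intro exI[of _ "g' x - f' x"]) (auto intro!: DERIV_diff)
  qed
  then show ?thesis by simp
qed

lemma interval_integral_lebesgue_cong:
  assumes "a \<le> b" and "\<And>t. a \<le> t \<Longrightarrow> f t = g t"
  shows "(LINT t=ereal a..ereal b|lebesgue. f t) = (LINT t=ereal a..ereal b|lebesgue. g t)"
  using assms unfolding interval_lebesgue_integral_def
  by (auto intro!: set_lebesgue_integral_cong)

section \<open>The window mass, its radius, and the Green function\<close>

context potential
begin

definition Q :: "real \<Rightarrow> real" where "Q = integral0 q"

text \<open>The left side of the equation for \<open>d_fun q x\<close> as a function of its upper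
  limit, the inner integral being written as an increment of \<open>Q\<close>.\<close>

definition mass :: "real \<Rightarrow> real \<Rightarrow> real" where
  "mass x = integral0 (\<lambda>t. Q (x + t) - Q (x - t))"

definition rad :: "real \<Rightarrow> real" where "rad x = sqrt 2 * d_fun q x"

lemma Q_primitive: "primitive Q q"
  unfolding Q_def by (rule primitive_integral0[OF q_loc])

lemma Q_mono: "s \<le> t \<Longrightarrow> Q s \<le> Q t"
  using primitive_mono[OF Q_primitive _ AE_nonneg] by simp

lemma Q_continuous: "continuous_on S Q"
  by (rule primitive_continuous[OF Q_primitive])

lemma Q_window_continuous:
  "continuous_on S (\<lambda>t. Q (x + t) - Q (x - t))" "continuous_on S (\<lambda>t. Q x - Q (x - t))"
  "continuous_on S (\<lambda>t. Q (x + t) - Q x)"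
  by (intro continuous_on_diff continuous_on_compose2[OF Q_continuous[of UNIV]] continuous_intros; simp)+

lemma mass_primitive: "primitive (mass x) (\<lambda>t. Q (x + t) - Q (x - t))"
  unfolding mass_def by (intro primitive_integral0 L1_loc_continuous Q_window_continuous)

lemma mass_0 [simp]: "mass x 0 = 0" by (simp add: mass_def)

text \<open>The slope \<open>Q (x + t) - Q (x - t)\<close> is nondecreasing in \<open>t\<close>, so
  \<open>mass x\<close> is convex on the nonnegative half-line and lies above its tangents.\<close>

lemma mass_ge: "0 \<le> a \<Longrightarrow> a \<le> b \<Longrightarrow> mass x a + (Q (x + a) - Q (x - a)) * (b - a) \<le> mass x b"
  by (rule primitive_mono[OF mass_primitive]) (auto intro!: AE_I2 diff_mono Q_mono)

lemma mass_mono: "0 \<le> a \<Longrightarrow> a \<le> b \<Longrightarrow> mass x a \<le> mass x b"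
  using mass_ge[of a b x] Q_mono[of "x - a" "x + a"] mult_nonneg_nonneg[of "Q (x + a) - Q (x - a)" "b - a"] by linarith

lemma mass_le:
  assumes "0 \<le> s"
  shows "mass x s \<le> (Q (x + s) - Q (x - s)) * s"
proof -
  have "AE t in lebesgue. t \<in> {0..s} \<longrightarrow> Q (x + t) - Q (x - t) \<le> Q (x + s) - Q (x - s)"
    by (intro AE_I2 impI diff_mono Q_mono) auto
  from primitive_le[OF mass_primitive assms this] show ?thesis by simp
qed

text \<open>By \<open>mass_le\<close>, a value of at least 2 at \<open>s\<close> forces a positive
  slope there, and the slope cannot decrease afterwards. Uniqueness of the radius rests on
  this.\<close>

lemma mass_strict:
  assumes "0 \<le> s" "s < s'" "2 \<le> mass x s"
  shows "2 < mass x s'"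
proof -
  have "0 < (Q (x + s) - Q (x - s)) * s" using mass_le[OF assms(1), of x] assms(3) by linarith
  then have "0 < Q (x + s) - Q (x - s)" using assms(1) by (simp add: zero_less_mult_iff)
  then have "0 < (Q (x + s) - Q (x - s)) * (s' - s)" using assms(2) by simp
  then show ?thesis using mass_ge[of s s' x] assms by linarith
qed

lemma mass_eq_2_ex1: "\<exists>!s. 0 \<le> s \<and> mass x s = 2"
proof -
  obtain b where b: "x \<le> b" "0 < integral {x..b} q" by (rule right_mass)
  define c where "c = integral {x..b} q"
  have c: "c = Q b - Q x" "c > 0" using b by (auto simp: c_def primitive_integral[OF Q_primitive])
  define t where "t = b - x"
  have t: "0 \<le> t" using b by (simp add: t_def)
  have "c \<le> Q (x + t) - Q (x - t)" using c(1) Q_mono[of "x - t" x] t by (simp add: t_def)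
  then have "c * (2 / c) \<le> (Q (x + t) - Q (x - t)) * (2 / c)" using c by (intro mult_right_mono) auto
  moreover have "c * (2 / c) = 2" using c(2) by simp
  ultimately have "2 \<le> (Q (x + t) - Q (x - t)) * (2 / c)" by linarith
  \<comment> \<open>Beyond \<open>t\<close> the slope is at least \<open>c\<close>, so a further
    length \<open>2 / c\<close> adds at least 2.\<close>
  then have ge: "2 \<le> mass x (t + 2 / c)"
    using mass_ge[of t "t + 2 / c" x] mass_mono[of 0 t x] t c by simp
  have "\<exists>s. 0 \<le> s \<and> s \<le> t + 2 / c \<and> mass x s = 2"
    by (rule IVT') (use ge t c primitive_continuous[OF mass_primitive] in auto)
  then obtain s where s: "0 \<le> s" "mass x s = 2" by blast
  show ?thesis
  proof (rule ex1I[of _ s])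
    show "0 \<le> s \<and> mass x s = 2" using s by simp
    fix s' assume "0 \<le> s' \<and> mass x s' = 2"
    then show "s' = s" using s mass_strict[of s s' x] mass_strict[of s' s x] by force
  qed
qed

lemma LINT_mass:
  assumes s: "0 \<le> s"
  shows "(LINT t=0..ereal s|lebesgue. (LINT \<xi>=ereal (x - t)..ereal (x + t)|lebesgue. q \<xi>)) = mass x s"
proof -
  have inner: "(LINT \<xi>=ereal (x - t)..ereal (x + t)|lebesgue. q \<xi>) = Q (x + t) - Q (x - t)" if "0 \<le> t" for t
    using that by (simp add: interval_integral_lebesgue_eq_integral[OF q_loc] primitive_integral[OF Q_primitive])
  have "(LINT t=0..ereal s|lebesgue. (LINT \<xi>=ereal (x - t)..ereal (x + t)|lebesgue. q \<xi>)) =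
      (LINT t=ereal 0..ereal s|lebesgue. (Q (x + t) - Q (x - t)))"
    unfolding zero_ereal_def by (rule interval_integral_lebesgue_cong[OF s inner])
  also have "\<dots> = integral {0..s} (\<lambda>t. Q (x + t) - Q (x - t))"
    by (rule interval_integral_lebesgue_eq_integral[OF L1_loc_continuous[OF Q_window_continuous(1)] s])
  also have "\<dots> = mass x s" using s by (simp add: primitive_integral[OF mass_primitive])
  finally show ?thesis .
qed

lemma rad: "0 < rad x" "mass x (rad x) = 2"
proof -
  obtain s where s: "0 \<le> s" "mass x s = 2" and uniq: "\<And>s'. 0 \<le> s' \<Longrightarrow> mass x s' = 2 \<Longrightarrow> s' = s"
    using mass_eq_2_ex1[of x] by blast
  have "d_fun q x = s / sqrt 2"
    unfolding d_fun_def
  proof (rule the_equality)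
    show "0 \<le> s / sqrt 2 \<and> (LINT t=0..ereal (sqrt 2 * (s / sqrt 2))|lebesgue. (LINT \<xi>=ereal (x - t)..ereal (x + t)|lebesgue. q \<xi>)) = 2"
      using s LINT_mass[OF s(1), of x] by simp
    fix d assume "0 \<le> d \<and> (LINT t=0..ereal (sqrt 2 * d)|lebesgue. (LINT \<xi>=ereal (x - t)..ereal (x + t)|lebesgue. q \<xi>)) = 2"
    then have "sqrt 2 * d = s" using LINT_mass[of "sqrt 2 * d" x] uniq[of "sqrt 2 * d"] by simp
    then show "d = s / sqrt 2" by (simp add: field_simps)
  qed
  then have "rad x = s" by (simp add: rad_def)
  moreover have "s \<noteq> 0" using s by auto
  ultimately show "0 < rad x" "mass x (rad x) = 2" using s by auto
qed

lemma d_fun_rad: "d_fun q x = rad x / sqrt 2"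
  by (simp add: rad_def)

lemma rad_le:
  assumes "0 \<le> s" "2 \<le> mass x s"
  shows "rad x \<le> s"
  using mass_strict[of s "rad x" x] rad[of x] assms by force

text \<open>The window of radius \<open>t\<close> about \<open>x\<close> lies in the window of
  radius \<open>t + |x - y|\<close> about \<open>y\<close>. Integrating over \<open>t\<close> shows
  that the mass at \<open>y\<close> has reached 2 by \<open>rad x + |x - y|\<close>.\<close>

lemma rad_Lipschitz: "rad y \<le> rad x + \<bar>x - y\<bar>"
proof (rule rad_le)
  define h where "h = \<bar>x - y\<bar>"
  show "0 \<le> rad x + \<bar>x - y\<bar>" using rad(1)[of x] by simp
  have D: "(mass z has_real_derivative (Q (z + t) - Q (z - t))) (at t)" for z t
    by (rule primitive_DERIV[OF mass_primitive])
      (use Q_window_continuous(1)[of UNIV z] in \<open>simp add: continuous_on_eq_continuous_at\<close>)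
  have "mass x (rad x) - mass x 0 \<le> mass y (rad x + h) - mass y (0 + h)"
  proof (rule DERIV_diff_mono)
    show "0 \<le> rad x" using rad(1)[of x] by simp
    fix t :: real assume t: "0 \<le> t"
    show "(mass x has_real_derivative (Q (x + t) - Q (x - t))) (at t)" by (rule D)
    show "((\<lambda>t. mass y (t + h)) has_real_derivative (Q (y + (t + h)) - Q (y - (t + h)))) (at t)"
      using D[of y "t + h"] by (simp add: DERIV_shift)
    show "Q (x + t) - Q (x - t) \<le> Q (y + (t + h)) - Q (y - (t + h))"
      using abs_ge_self[of "x - y"] abs_ge_minus_self[of "x - y"] by (rule_tac diff_mono; rule_tac Q_mono; simp add: h_def)
  qed
  moreover have "0 \<le> mass y h" using mass_mono[of 0 h y] by (simp add: h_def)
  ultimately show "2 \<le> mass y (rad x + \<bar>x - y\<bar>)" using rad(2)[of x] by (simp add: h_def)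
qed

lemma rad_continuous: "continuous_on S rad"
proof (rule continuous_on_subset[OF _ subset_UNIV], rule lipschitz_on_continuous_on)
  show "1-lipschitz_on UNIV rad"
  proof (rule lipschitz_onI)
    fix x y show "dist (rad x) (rad y) \<le> 1 * dist x y"
      using rad_Lipschitz[of x y] rad_Lipschitz[of y x] by (simp add: dist_real_def abs_le_iff abs_minus_commute)
  qed simp
qed

text \<open>Length measured in units of the local radius. The integral in \<open>agrees\<close>
  equals \<open>sqrt 2\<close> times an increment of \<open>R\<close> in absolute value.\<close>

definition R :: "real \<Rightarrow> real" where "R = integral0 (\<lambda>s. 1 / rad s)"

lemma inverse_rad_continuous: "continuous_on S (\<lambda>s. 1 / rad s)"
  by (intro continuous_intros rad_continuous) (use rad(1) in \<open>auto simp: less_imp_neq[symmetric]\<close>)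

lemma R_primitive: "primitive R (\<lambda>s. 1 / rad s)"
  unfolding R_def by (intro primitive_integral0 L1_loc_continuous inverse_rad_continuous)

lemma R_DERIV: "(R has_real_derivative 1 / rad s) (at s)"
  by (rule primitive_DERIV[OF R_primitive])
    (use inverse_rad_continuous[of UNIV] in \<open>simp add: continuous_on_eq_continuous_at\<close>)

lemma R_mono: "s \<le> t \<Longrightarrow> R s \<le> R t"
  using primitive_mono[OF R_primitive, of s t 0] by (simp add: less_imp_le[OF rad(1)])

lemma LINT_inverse_d: "\<bar>LINT \<xi>=ereal x..ereal t|lebesgue. (1 / d_fun q \<xi>)\<bar> = sqrt 2 * \<bar>R t - R x\<bar>"
proof -
  have c: "L1_loc (\<lambda>\<xi>. 1 / d_fun q \<xi>)"
    unfolding d_fun_rad using L1_loc_continuous[OF continuous_on_mult_left[OF inverse_rad_continuous, where c="sqrt 2"]]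
    by simp
  have *: "(LINT \<xi>=ereal a..ereal b|lebesgue. (1 / d_fun q \<xi>)) = sqrt 2 * (R b - R a)" if "a \<le> b" for a b
  proof -
    have "integral {a..b} (\<lambda>\<xi>. 1 / d_fun q \<xi>) = integral {a..b} (\<lambda>\<xi>. sqrt 2 * (1 / rad \<xi>))"
      by (simp add: d_fun_rad)
    also have "\<dots> = sqrt 2 * (R b - R a)"
      using that primitive_integral[OF primitive_cmult[OF R_primitive, of "sqrt 2"]] by (simp add: right_diff_distrib)
    finally show ?thesis by (simp add: interval_integral_lebesgue_eq_integral[OF c that])
  qed
  show ?thesis
  proof (cases "x \<le> t")
    case True
    then show ?thesis using R_mono[OF True] by (simp add: * abs_mult)
  next
    case False
    have "(LINT \<xi>=ereal x..ereal t|lebesgue. (1 / d_fun q \<xi>)) = - (LINT \<xi>=ereal t..ereal x|lebesgue. (1 / d_fun q \<xi>))"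
      using False by (simp add: interval_lebesgue_integral_def)
    then show ?thesis using False by (simp add: * abs_mult)
  qed
qed

text \<open>One of the two half-windows carries at least half of \<open>mass x (rad x) = 2\<close>; on that side
  convexity forces the logarithmic derivative to be at least \<open>1 / rad x\<close>.\<close>

lemma product_le_rad:
  assumes u: "primitive u u'" "primitive u' (\<lambda>x. q x * u x)" "\<And>x. 0 < u x" "\<And>x. 0 \<le> u' x"
    and v: "primitive v v'" "primitive v' (\<lambda>x. q x * v x)" "\<And>x. 0 < v x" "\<And>x. v' x \<le> 0"
    and W: "\<And>x. u' x * v x - u x * v' x = 1"
  shows "u x * v x \<le> rad x"
proof -
  define r where "r = rad x"
  have r: "0 < r" "mass x r = 2" using rad by (auto simp: r_def)
  \<comment> \<open>The contributions of the left and right half-windows; their sum is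
    \<open>mass x\<close>.\<close>
  define A where "A = integral0 (\<lambda>t. Q x - Q (x - t))"
  define B where "B = integral0 (\<lambda>t. Q (x + t) - Q x)"
  have A: "primitive A (\<lambda>t. Q x - Q (x - t))" and B: "primitive B (\<lambda>t. Q (x + t) - Q x)"
    unfolding A_def B_def by (intro primitive_integral0 L1_loc_continuous Q_window_continuous)+
  have DA: "(A has_real_derivative (Q x - Q (x - t))) (at t)" and DB: "(B has_real_derivative (Q (x + t) - Q x)) (at t)" for t
    by (rule primitive_DERIV[OF A] primitive_DERIV[OF B];
        use Q_window_continuous(2,3)[of UNIV x] in \<open>simp add: continuous_on_eq_continuous_at\<close>)+
  have "A r + B r = mass x r"
  proof -
    have "primitive (\<lambda>t. A t + B t) (\<lambda>t. Q (x + t) - Q (x - t))"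
      using primitive_add[OF A B] by simp
    from primitive_unique[OF this mass_primitive, of 0] show ?thesis
      by (auto simp: A_def B_def dest: fun_cong)
  qed
  then have AB: "1 \<le> A r \<or> 1 \<le> B r" using r by linarith
  have Du: "(u has_real_derivative u' s) (at s)" and Dv: "(v has_real_derivative v' s) (at s)" for s
    by (rule primitive_DERIV[OF u(1) primitive_isCont[OF u(2)]] primitive_DERIV[OF v(1) primitive_isCont[OF v(2)]])+
  have umono: "u s \<le> u t" if "s \<le> t" for s t
    by (rule DERIV_nonneg_imp_nondecreasing[OF that]) (use Du u(4) in blast)
  have vmono: "v t \<le> v s" if "s \<le> t" for s t
    by (rule DERIV_nonpos_imp_nonincreasing[OF that]) (use Dv v(4) in blast)
  have gain: "m * (Q t - Q s) \<le> w' t - w' s"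
    if w: "primitive w' (\<lambda>x. q x * w x)" and st: "s \<le> t" and m: "\<And>z. z \<in> {s..t} \<Longrightarrow> m \<le> w z" for w w' m s t
  proof -
    have "AE z in lebesgue. z \<in> {s..t} \<longrightarrow> m * q z \<le> q z * w z"
      using q_nonneg by eventually_elim (use m in \<open>auto simp: mult.commute[of m] intro!: mult_left_mono\<close>)
    then have "integral {s..t} (\<lambda>z. m * q z) \<le> integral {s..t} (\<lambda>z. q z * w z)"
      by (rule integral_mono_AE_lebesgue) (use primitive_integrable[OF w] primitive_integrable[OF primitive_cmult[OF Q_primitive]] in auto)
    then show ?thesis
      using primitive_integral[OF primitive_cmult[OF Q_primitive] st, of m] primitive_integral[OF w st]
      by (simp add: algebra_simps)
  qed
  from AB show ?thesis
  proof
    assume A1: "1 \<le> A r"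
    \<comment> \<open>On the left half-window \<open>u\<close> is at least \<open>u (x - r)\<close>,
      so \<open>u' x - u' (x - t)\<close> is at least that value times the mass passed. Integrating
      in \<open>t\<close> and using \<open>1 \<le> A r\<close> cancels \<open>u (x - r)\<close> and
      leaves \<open>u x \<le> r * u' x\<close>.\<close>
    have "u (x - r) * A r - u (x - r) * A 0 \<le> (r * u' x + u (x - r)) - (0 * u' x + u (x - 0))"
    proof (rule DERIV_diff_mono)
      show "0 \<le> r" using r by simp
      fix t :: real assume t: "0 \<le> t" "t \<le> r"
      show "((\<lambda>t. u (x - r) * A t) has_real_derivative u (x - r) * (Q x - Q (x - t))) (at t)"
        by (auto intro!: derivative_eq_intros DA)
      show "((\<lambda>t. t * u' x + u (x - t)) has_real_derivative u' x - u' (x - t)) (at t)"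
        by (auto intro!: derivative_eq_intros DERIV_chain2[OF Du])
      show "u (x - r) * (Q x - Q (x - t)) \<le> u' x - u' (x - t)"
        by (rule gain[OF u(2)]) (use t in \<open>auto intro!: umono\<close>)
    qed
    moreover have "u (x - r) * 1 \<le> u (x - r) * A r" using A1 u(3)[of "x - r"] by (intro mult_left_mono) auto
    ultimately have "u x \<le> r * u' x" by (simp add: A_def)
    then have "u x * v x \<le> r * u' x * v x" using v(3)[of x] by (intro mult_right_mono) auto
    also have "\<dots> \<le> r * (u' x * v x - u x * v' x)"
      using r(1) u(3)[of x] v(4)[of x] by (simp add: algebra_simps mult_nonneg_nonpos2 mult_nonpos_nonneg mult_le_0_iff zero_le_mult_iff)
    finally show ?thesis by (simp add: W r_def)
  next
    assume B1: "1 \<le> B r"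
    have "v (x + r) * B r - v (x + r) * B 0 \<le> (v (x + r) - r * v' x) - (v (x + 0) - 0 * v' x)"
    proof (rule DERIV_diff_mono)
      show "0 \<le> r" using r by simp
      fix t :: real assume t: "0 \<le> t" "t \<le> r"
      show "((\<lambda>t. v (x + r) * B t) has_real_derivative v (x + r) * (Q (x + t) - Q x)) (at t)"
        by (auto intro!: derivative_eq_intros DB)
      show "((\<lambda>t. v (x + t) - t * v' x) has_real_derivative v' (x + t) - v' x) (at t)"
        by (auto intro!: derivative_eq_intros DERIV_chain2[OF Dv])
      show "v (x + r) * (Q (x + t) - Q x) \<le> v' (x + t) - v' x"
        by (rule gain[OF v(2)]) (use t in \<open>auto intro!: vmono\<close>)
    qed
    moreover have "v (x + r) * 1 \<le> v (x + r) * B r" using B1 v(3)[of "x + r"] by (intro mult_left_mono) auto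
    ultimately have "v x \<le> - (r * v' x)" by (simp add: B_def)
    then have "u x * v x \<le> u x * - (r * v' x)" using u(3)[of x] by (intro mult_left_mono) auto
    also have "\<dots> \<le> r * (u' x * v x - u x * v' x)"
      using r(1) v(3)[of x] u(4)[of x] by (simp add: algebra_simps)
    finally show ?thesis by (simp add: W r_def)
  qed
qed

text \<open>The square of \<open>u x * v t\<close> is \<open>(u x * v x) * (u t * v t)\<close> times
  the quotient of \<open>u / v\<close> at \<open>x\<close> by \<open>u / v\<close> at
  \<open>t\<close>. The first two factors are at most the radii, and the last decays with rate 1 in
  \<open>R\<close>; the square root halves the rate.\<close>

lemma green_bound:
  assumes u: "primitive u u'" "primitive u' (\<lambda>x. q x * u x)" "\<And>x. 0 < u x" "\<And>x. 0 \<le> u' x"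
    and v: "primitive v v'" "primitive v' (\<lambda>x. q x * v x)" "\<And>x. 0 < v x" "\<And>x. v' x \<le> 0"
    and W: "\<And>x. u' x * v x - u x * v' x = 1"
    and xt: "x \<le> t"
  shows "u x * v t \<le> sqrt (rad x * rad t) * exp (- (R t - R x) / 2)"
proof (rule power2_le_imp_le)
  have Du: "(u has_real_derivative u' s) (at s)" and Dv: "(v has_real_derivative v' s) (at s)" for s
    by (rule primitive_DERIV[OF u(1) primitive_isCont[OF u(2)]] primitive_DERIV[OF v(1) primitive_isCont[OF v(2)]])+
  note uv = product_le_rad[OF u v W]
  have "R t - R x \<le> (ln (u t) - ln (v t)) - (ln (u x) - ln (v x))"
  proof (rule DERIV_diff_mono[OF xt R_DERIV])
    fix s
    show "((\<lambda>s. ln (u s) - ln (v s)) has_real_derivative u' s / u s - v' s / v s) (at s)"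
      using u(3)[of s] v(3)[of s] by (auto intro!: derivative_eq_intros Du Dv simp: field_simps)
    have "u' s / u s - v' s / v s = 1 / (u s * v s)"
      using u(3)[of s] v(3)[of s] W[of s] by (simp add: field_simps)
    then show "1 / rad s \<le> u' s / u s - v' s / v s"
      using uv[of s] u(3)[of s] v(3)[of s] rad(1)[of s] by (simp add: frac_le)
  qed
  then have e: "exp (ln (u x) + ln (v t) - (ln (u t) + ln (v x))) \<le> exp (- (R t - R x))" by simp
  have "(u x * v t)\<^sup>2 = (u x * v x) * (u t * v t) * exp (ln (u x) + ln (v t) - (ln (u t) + ln (v x)))"
    using u(3)[of x] v(3)[of x] u(3)[of t] v(3)[of t] by (simp add: exp_diff exp_add power2_eq_square field_simps)
  also have "\<dots> \<le> (rad x * rad t) * exp (- (R t - R x))"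
    using uv[of x] uv[of t] e u(3)[of x] v(3)[of x] u(3)[of t] v(3)[of t] rad(1)[of x] rad(1)[of t]
    by (intro mult_mono) auto
  also have "\<dots> = (sqrt (rad x * rad t) * exp (- (R t - R x) / 2))\<^sup>2"
    using rad(1)[of x] rad(1)[of t] by (simp add: power_mult_distrib exp_double[symmetric])
  finally show "(u x * v t)\<^sup>2 \<le> (sqrt (rad x * rad t) * exp (- (R t - R x) / 2))\<^sup>2" .
qed (use rad(1)[of x] rad(1)[of t] in auto)

end

section \<open>Growth, uniqueness and positivity of solutions\<close>

lemma first_nonpos_point:
  fixes h :: "real \<Rightarrow> real"
  assumes "continuous_on UNIV h" "0 < h x0" "x0 \<le> x1" "h x1 \<le> 0"
  obtains c where "x0 < c" "c \<le> x1" "h c \<le> 0" "\<And>x. x0 \<le> x \<Longrightarrow> x < c \<Longrightarrow> 0 < h x"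
proof -
  define S where "S = {x0..x1} \<inter> {x. h x \<le> 0}"
  have "compact S" unfolding S_def
    by (rule compact_Int_closed[OF compact_Icc closed_Collect_le[OF assms(1) continuous_on_const]])
  moreover have "S \<noteq> {}" using assms by (auto simp: S_def)
  ultimately have "\<exists>c\<in>S. \<forall>t\<in>S. c \<le> t" by (rule compact_attains_inf)
  then obtain c where c: "c \<in> S" "\<And>t. t \<in> S \<Longrightarrow> c \<le> t" by metis
  have "h c \<le> 0" using c(1) by (simp add: S_def)
  then have "c \<noteq> x0" using assms(2) by force
  moreover have "0 < h x" if "x0 \<le> x" "x < c" for x
  proof (rule ccontr)
    assume "\<not> 0 < h x"
    then have "x \<in> S" using that c(1) by (simp add: S_def)
    then show False using c(2)[of x] that(2) by simp
  qed
  moreover have "x0 \<le> c" "c \<le> x1" "h c \<le> 0" using c(1) by (simp_all add: S_def)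
  ultimately show thesis by (intro that[of c]) simp_all
qed

text \<open>Signs are known only strictly before the first zero, whereas the integrals run over
  closed intervals; the endpoint is discarded as a null set.\<close>

lemma AE_lebesgue_except_point:
  fixes c :: real
  assumes "AE x in lebesgue. P x"
  shows "AE x in lebesgue. x \<noteq> c \<and> P x"
proof -
  have "AE x in lebesgue. x \<noteq> c" by (rule negligible_imp_AE_lebesgue[of "{c}"]) auto
  with assms show ?thesis by eventually_elim auto
qed

text \<open>At the first nonpositive point \<open>h\<close> is positive throughout the preceding
  stretch, so \<open>mono\<close> applies there and gives a value of at least \<open>h x0\<close>, a
  contradiction.\<close>

lemma positive_persists:
  fixes h :: "real \<Rightarrow> real"
  assumes "continuous_on UNIV h" "0 < h x0" "x0 \<le> s"
    and mono: "\<And>t. x0 \<le> t \<Longrightarrow> (\<And>s. x0 \<le> s \<Longrightarrow> s < t \<Longrightarrow> 0 < h s) \<Longrightarrow> h x0 \<le> h t"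
  shows "0 < h s"
proof (rule ccontr)
  assume "\<not> 0 < h s"
  then have "h s \<le> 0" by simp
  with assms(1-3) obtain c where c: "x0 < c" "c \<le> s" "h c \<le> 0" "\<And>x. x0 \<le> x \<Longrightarrow> x < c \<Longrightarrow> 0 < h x"
    by (rule first_nonpos_point) blast
  have "h x0 \<le> h c" using c by (intro mono) auto
  then show False using assms(2) c(3) by linarith
qed

text \<open>While \<open>h\<close> stays positive its derivative \<open>k\<close> is nondecreasing,
  so \<open>h\<close> stays above its rising tangent at \<open>x0\<close> and cannot return to 0.
  Asking for a sign of \<open>g\<close> only where \<open>h > 0\<close> lets the result apply to the
  negative of a solution with nonnegative right-hand side.\<close>

lemma positive_convex_growth:
  assumes h: "primitive h k" and k: "primitive k g"
    and g: "AE x in lebesgue. 0 < h x \<longrightarrow> 0 \<le> g x"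
    and x0: "0 < h x0" "0 < k x0" and x: "x0 \<le> x"
  shows "h x0 + k x0 * (x - x0) \<le> h x"
proof -
  have grow: "h x0 + k x0 * (t - x0) \<le> h t" if t: "x0 \<le> t" and pos: "\<And>s. x0 \<le> s \<Longrightarrow> s < t \<Longrightarrow> 0 < h s" for t
  proof -
    have "k x0 \<le> k s" if s: "x0 \<le> s" "s \<le> t" for s
    proof -
      have "AE z in lebesgue. z \<in> {x0..s} \<longrightarrow> 0 \<le> g z"
        using AE_lebesgue_except_point[OF g, of t]
      proof eventually_elim
        case (elim z)
        show ?case
        proof
          assume "z \<in> {x0..s}"
          then show "0 \<le> g z" using elim pos[of z] s by simp
        qed
      qed
      from primitive_mono[OF k s(1) this] show ?thesis by simp
    qed
    then show ?thesis
      by (intro primitive_mono[OF h t]) (auto intro!: AE_I2)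
  qed
  have "h x0 \<le> h t" if "x0 \<le> t" "\<And>s. x0 \<le> s \<Longrightarrow> s < t \<Longrightarrow> 0 < h s" for t
  proof -
    have "0 \<le> k x0 * (t - x0)" using x0(2) that(1) by simp
    then show ?thesis using grow[OF that] by linarith
  qed
  then have "0 < h s" if "x0 \<le> s" for s
    using positive_persists[OF primitive_continuous[OF h] x0(1) that] by blast
  then show ?thesis using x by (intro grow) auto
qed

lemma locally_constant_where_positive:
  assumes h: "primitive h k" and k: "\<And>x. 0 < h x \<Longrightarrow> k x = 0" and x0: "0 < h x0" and x: "x0 \<le> x"
  shows "h x = h x0"
proof -
  have const: "h t = h x0" if t: "x0 \<le> t" and pos: "\<And>s. x0 \<le> s \<Longrightarrow> s < t \<Longrightarrow> 0 < h s" for t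
  proof -
    have ae: "AE z in lebesgue. z \<noteq> t" using AE_lebesgue_except_point[of "\<lambda>x. True" t] by simp
    have "AE z in lebesgue. z \<in> {x0..t} \<longrightarrow> 0 \<le> k z" "AE z in lebesgue. z \<in> {x0..t} \<longrightarrow> k z \<le> 0"
      using ae by (eventually_elim, use k pos in force)+
    from primitive_mono[OF h t this(1)] primitive_le[OF h t this(2)] show ?thesis by simp
  qed
  have "0 < h s" if "x0 \<le> s" for s
    using positive_persists[OF primitive_continuous[OF h] x0 that] const by (metis order_refl)
  then show ?thesis using x by (intro const) auto
qed

text \<open>A point with \<open>h > 0\<close> and nonzero slope yields growth to the right or, by
  reflection, to the left. Otherwise the slope vanishes wherever \<open>h\<close> is positive, so
  \<open>h\<close> keeps the value \<open>h x0\<close> and \<open>g\<close>, the almost everywhere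
  derivative of the zero function \<open>k\<close>, vanishes.\<close>

lemma linear_growth_or_constant:
  assumes h: "primitive h k" and k: "primitive k g"
    and g: "AE x in lebesgue. 0 < h x \<longrightarrow> 0 \<le> g x"
    and x0: "0 < h x0"
  obtains (right) \<kappa> X where "0 < \<kappa>" "1 \<le> X" "\<And>x. X \<le> x \<Longrightarrow> \<kappa> * \<bar>x\<bar> \<le> h x"
    | (left) \<kappa> X where "0 < \<kappa>" "1 \<le> X" "\<And>x. x \<le> - X \<Longrightarrow> \<kappa> * \<bar>x\<bar> \<le> h x"
    | (const) "\<And>x. h x = h x0" "AE x in lebesgue. g x = 0"
proof -
  \<comment> \<open>Past \<open>2 * |s| + 1\<close> the tangent line exceeds the line through the
    origin with half its slope.\<close>
  have half: "(m / 2) * x \<le> a + m * (x - s)" if "0 < m" "0 < a" "2 * \<bar>s\<bar> + 1 \<le> x" for m a s x :: real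
  proof -
    have "m * s \<le> m * (x / 2)" using that by (intro mult_left_mono) auto
    moreover have "m / 2 * x + m * (x / 2) = m * x" by simp
    ultimately show ?thesis using that(2) by (simp only: right_diff_distrib)
  qed
  have hr: "primitive (\<lambda>x. h (- x)) (\<lambda>x. - k (- x))" by (rule primitive_reflect'[OF h])
  have kr: "primitive (\<lambda>x. - k (- x)) (\<lambda>x. g (- x))" by (rule primitive_reflect[OF k])
  consider s where "0 < h s" "0 < k s" | s where "0 < h s" "k s < 0" | "\<And>s. 0 < h s \<Longrightarrow> k s = 0"
    by (meson linorder_neqE_linordered_idom)
  then show thesis
  proof cases
    case 1
    show thesis
    proof (rule right[of "k s / 2" "2 * \<bar>s\<bar> + 1"])
      fix x assume x: "2 * \<bar>s\<bar> + 1 \<le> x"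
      have "k s / 2 * x \<le> h s + k s * (x - s)" using half[OF 1(2,1) x] by simp
      also have "\<dots> \<le> h x" using x by (intro positive_convex_growth[OF h k g 1]) auto
      finally show "k s / 2 * \<bar>x\<bar> \<le> h x" using x by simp
    qed (use 1 in auto)
  next
    case 2
    show thesis
    proof (rule left[of "- k s / 2" "2 * \<bar>s\<bar> + 1"])
      fix x assume "x \<le> - (2 * \<bar>s\<bar> + 1)"
      then have x: "2 * \<bar>- s\<bar> + 1 \<le> - x" by simp
      have "- k s / 2 * (- x) \<le> h s + (- k s) * (- x - (- s))" using half[OF _ 2(1) x, of "- k s"] 2 by simp
      also have "\<dots> \<le> h x"
        using positive_convex_growth[OF hr kr AE_lebesgue_reflect[OF g], of "- s" "- x"] x 2 by simp
      finally show "- k s / 2 * \<bar>x\<bar> \<le> h x" using x by simp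
    qed (use 2 in auto)
  next
    case 3
    have c: "h x = h x0" for x
    proof (cases "x0 \<le> x")
      case True
      then show ?thesis using locally_constant_where_positive[OF h 3 x0] by blast
    next
      case False
      then show ?thesis using locally_constant_where_positive[OF hr, of "- x0" "- x"] 3 x0 by simp
    qed
    have "k x = 0" for x by (rule 3) (use c[of x] x0 in simp)
    then have "k = (\<lambda>x. 0)" by (intro ext)
    moreover have "AE x in lebesgue. (k has_real_derivative g x) (at x)" by (rule primitive_AE_derivative[OF k])
    ultimately have "AE x in lebesgue. ((\<lambda>x. 0) has_real_derivative g x) (at x)" by simp
    then have "AE x in lebesgue. g x = 0" by eventually_elim (rule DERIV_unique[OF _ DERIV_const])
    with c show thesis by (intro const)
  qed
qed

section \<open>Divergent weights exclude linear growth\<close>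

lemma nn_integral_powr_tail_finite:
  fixes \<alpha> :: real
  assumes \<alpha>: "0 < \<alpha>"
  shows "(\<integral>\<^sup>+x\<in>{x. 1 \<le> \<bar>x\<bar>}. ennreal (\<bar>x\<bar> powr (- 1 - \<alpha>)) \<partial>lborel) < \<infinity>"
proof -
  let ?f = "\<lambda>x. \<bar>x\<bar> powr (- 1 - \<alpha>)"
  have "(\<integral>\<^sup>+x. ennreal (?f x) * indicator {1..} x \<partial>lborel) = ennreal (0 - (- 1 / \<alpha> * 1 powr (- \<alpha>)))"
  proof (rule nn_integral_FTC_atLeast[where F="\<lambda>x. - 1 / \<alpha> * x powr (- \<alpha>)"])
    show "((\<lambda>x. - 1 / \<alpha> * x powr (- \<alpha>)) has_real_derivative ?f x) (at x)" if "1 \<le> x" for x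
    proof -
      have e: "- \<alpha> - 1 = - 1 - \<alpha>" by simp
      have "((\<lambda>x. - 1 / \<alpha> * x powr (- \<alpha>)) has_real_derivative - 1 / \<alpha> * (- \<alpha> * x powr (- \<alpha> - 1))) (at x)"
        using that by (intro DERIV_cmult has_real_derivative_powr) simp
      then show ?thesis using that \<alpha> by (simp add: e)
    qed
    have "((\<lambda>x. - 1 / \<alpha> * x powr (- \<alpha>)) \<longlongrightarrow> - 1 / \<alpha> * 0) at_top"
      using \<alpha> by (intro tendsto_mult tendsto_const tendsto_neg_powr filterlim_ident) auto
    then show "((\<lambda>x. - 1 / \<alpha> * x powr (- \<alpha>)) \<longlongrightarrow> 0) at_top" by simp
  qed auto
  then have r: "(\<integral>\<^sup>+x. ennreal (?f x) * indicator {1..} x \<partial>lborel) < \<infinity>" by simp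
  have l: "(\<integral>\<^sup>+x. ennreal (?f x) * indicator {..-1} x \<partial>lborel) = (\<integral>\<^sup>+x. ennreal (?f x) * indicator {1..} x \<partial>lborel)"
  proof -
    have "(\<integral>\<^sup>+x. ennreal (?f x) * indicator {..-1} x \<partial>lborel) = (\<integral>\<^sup>+x. ennreal (?f (- x)) * indicator {..-1} (- x) \<partial>lborel)"
      using nn_integral_real_affine[of "\<lambda>x. ennreal (?f x) * indicator {..-1} x" "-1" 0] by simp
    moreover have "indicator {..-1} (- x) = (indicator {1..} x :: ennreal)" for x :: real
      by (simp add: indicator_def)
    ultimately show ?thesis by simp
  qed
  have "(\<integral>\<^sup>+x\<in>{x. 1 \<le> \<bar>x\<bar>}. ennreal (?f x) \<partial>lborel) =
      (\<integral>\<^sup>+x. ennreal (?f x) * indicator {1..} x + ennreal (?f x) * indicator {..-1} x \<partial>lborel)"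
    by (intro nn_integral_cong) (auto split: split_indicator)
  also have "\<dots> = (\<integral>\<^sup>+x. ennreal (?f x) * indicator {1..} x \<partial>lborel) + (\<integral>\<^sup>+x. ennreal (?f x) * indicator {..-1} x \<partial>lborel)"
    by (intro nn_integral_add) auto
  also have "\<dots> < \<infinity>" using r l by simp
  finally show ?thesis .
qed

text \<open>With \<open>s = \<mu> x \<cdot> \<kappa> \<bar>x\<bar>\<close> either \<open>s \<ge> \<bar>x\<bar> powr (- 1 / p)\<close>, and then \<open>s \<le> \<bar>x\<bar> \<cdot> s powr p\<close>,
  or \<open>s\<close> is dominated by \<open>\<bar>x\<bar> powr (- 1 / p)\<close>.\<close>

lemma weight_integral_finite:
  assumes p: "1 \<le> p" and int: "integrable lebesgue (\<lambda>x. \<bar>\<mu> x * y x\<bar> powr p)"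
    and \<mu>: "\<And>x. 0 < \<mu> x" and \<kappa>: "0 < \<kappa>"
    and S: "S \<in> sets borel" "\<And>x. x \<in> S \<Longrightarrow> 1 \<le> \<bar>x\<bar>" "\<And>x. x \<in> S \<Longrightarrow> \<kappa> * \<bar>x\<bar> \<le> \<bar>y x\<bar>"
  shows "(\<integral>\<^sup>+x\<in>S. ennreal (\<mu> x) \<partial>lebesgue) < \<infinity>"
proof -
  let ?F = "\<lambda>x. \<bar>\<mu> x * y x\<bar> powr p" and ?G = "\<lambda>x. \<bar>x\<bar> powr (- 1 - 1 / p)"
  have pw: "\<mu> x \<le> (?F x + ?G x) / \<kappa>" if x: "x \<in> S" for x
  proof -
    define X where "X = \<bar>x\<bar>"
    have X: "1 \<le> X" using S(2)[OF x] by (simp add: X_def)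
    define s where "s = \<mu> x * (\<kappa> * X)"
    have s: "0 < s" using \<mu>[of x] \<kappa> X by (simp add: s_def)
    have "s \<le> \<bar>\<mu> x * y x\<bar>" using S(3)[OF x] \<mu>[of x] by (simp add: s_def X_def abs_mult)
    then have sF: "s powr p \<le> ?F x" using s p by (intro powr_mono2) auto
    have "\<kappa> * \<mu> x = s / X" using X by (simp add: s_def)
    also have "\<dots> \<le> s powr p + X powr (- 1 - 1 / p)"
    proof (cases "X powr (- 1 / p) \<le> s")
      case True
      have "s powr (1 - p) \<le> (X powr (- 1 / p)) powr (1 - p)"
        using True X p s by (intro powr_mono2') auto
      also have "(X powr (- 1 / p)) powr (1 - p) = X powr ((p - 1) / p)"
      proof -
        have "- 1 / p * (1 - p) = (p - 1) / p" using p by (simp add: field_simps)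
        then show ?thesis by (simp only: powr_powr)
      qed
      also have "\<dots> \<le> X powr 1" using X p by (intro powr_mono) (auto simp: divide_le_eq)
      finally have "s powr p * s powr (1 - p) \<le> s powr p * X" using X by (intro mult_left_mono) auto
      moreover have "s powr p * s powr (1 - p) = s" using s by (simp add: powr_add[symmetric])
      ultimately have "s \<le> s powr p * X" by simp
      then have "s / X \<le> s powr p" using X by (simp add: divide_le_eq)
      then show ?thesis using powr_ge_zero[of X "- 1 - 1 / p"] by linarith
    next
      case False
      then have "s / X \<le> X powr (- 1 / p) / X" using X by (intro divide_right_mono) auto
      also have "\<dots> = X powr (- 1 / p - 1)" using X by (simp add: powr_diff)
      also have "\<dots> = X powr (- 1 - 1 / p)" by (rule arg_cong[where f="\<lambda>a. X powr a"]) simp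
      finally show ?thesis using powr_ge_zero[of s p] by linarith
    qed
    finally have "\<kappa> * \<mu> x \<le> s powr p + ?G x" unfolding X_def .
    then have "\<kappa> * \<mu> x \<le> ?F x + ?G x" using sF by linarith
    then show ?thesis using \<kappa> by (simp add: le_divide_eq mult.commute)
  qed
  have "(\<integral>\<^sup>+x\<in>S. ennreal (\<mu> x) \<partial>lebesgue) \<le>
      (\<integral>\<^sup>+x. ennreal (1 / \<kappa>) * (ennreal (?F x) + ennreal (?G x) * indicator {x. 1 \<le> \<bar>x\<bar>} x) \<partial>lebesgue)"
  proof (rule nn_integral_mono)
    fix x
    show "ennreal (\<mu> x) * indicator S x \<le> ennreal (1 / \<kappa>) * (ennreal (?F x) + ennreal (?G x) * indicator {x. 1 \<le> \<bar>x\<bar>} x)"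
    proof (cases "x \<in> S")
      case True
      have "ennreal (\<mu> x) \<le> ennreal (1 / \<kappa> * (?F x + ?G x))"
        using pw[OF True] by (intro ennreal_leI) simp
      also have "\<dots> = ennreal (1 / \<kappa>) * (ennreal (?F x) + ennreal (?G x))"
        using \<kappa> by (subst ennreal_mult) (auto simp: ennreal_plus)
      finally show ?thesis using True S(2)[OF True] by simp
    qed auto
  qed
  also have "\<dots> = ennreal (1 / \<kappa>) * ((\<integral>\<^sup>+x. ennreal (?F x) \<partial>lebesgue) + (\<integral>\<^sup>+x\<in>{x. 1 \<le> \<bar>x\<bar>}. ennreal (?G x) \<partial>lebesgue))"
  proof -
    have m1: "(\<lambda>x. ennreal (?F x)) \<in> borel_measurable lebesgue" using int by auto
    have m2: "(\<lambda>x. ennreal (?G x) * indicator {x. 1 \<le> \<bar>x\<bar>} x) \<in> borel_measurable lebesgue"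
      by (rule measurable_completion) measurable
    show ?thesis
      by (subst nn_integral_cmult[OF borel_measurable_add[OF m1 m2]]) (simp add: nn_integral_add[OF m1 m2])
  qed
  also have "\<dots> < \<infinity>"
  proof -
    have "(\<integral>\<^sup>+x. ennreal (?F x) \<partial>lebesgue) < \<infinity>"
      using int unfolding integrable_iff_bounded by simp
    moreover have "(\<integral>\<^sup>+x\<in>{x. 1 \<le> \<bar>x\<bar>}. ennreal (?G x) \<partial>lebesgue) < \<infinity>"
      using nn_integral_powr_tail_finite[of "1 / p"] p by (simp add: nn_integral_completion)
    ultimately show ?thesis by (simp add: ennreal_mult_less_top)
  qed
  finally show ?thesis .
qed

lemma nn_integral_continuous_Icc_finite:
  assumes \<mu>: "continuous_on UNIV \<mu>"
  shows "(\<integral>\<^sup>+x\<in>{a..b::real}. ennreal (\<mu> x) \<partial>lebesgue) < \<infinity>"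
proof -
  have "set_integrable lebesgue {a..b} \<mu>" using L1_loc_continuous[OF \<mu>] by (simp add: L1_loc_def)
  then have "(\<integral>\<^sup>+x. ennreal (norm (indicator {a..b} x *\<^sub>R \<mu> x)) \<partial>lebesgue) < \<infinity>"
    unfolding set_integrable_def integrable_iff_bounded by blast
  moreover have "(\<integral>\<^sup>+x\<in>{a..b}. ennreal (\<mu> x) \<partial>lebesgue) \<le> (\<integral>\<^sup>+x. ennreal (norm (indicator {a..b} x *\<^sub>R \<mu> x)) \<partial>lebesgue)"
    by (intro nn_integral_mono) (auto split: split_indicator intro!: ennreal_leI)
  ultimately show ?thesis by (rule le_less_trans[rotated])
qed

lemma nn_integral_Un_finite:
  assumes "(\<integral>\<^sup>+x\<in>A. f x \<partial>M) < \<infinity>" "(\<integral>\<^sup>+x\<in>B. f x \<partial>M) < \<infinity>" "C \<subseteq> A \<union> B"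
    "A \<in> sets M" "B \<in> sets M" "f \<in> borel_measurable M"
  shows "(\<integral>\<^sup>+x\<in>C. f x \<partial>M) < (\<infinity> :: ennreal)"
proof -
  have "(\<integral>\<^sup>+x\<in>C. f x \<partial>M) \<le> (\<integral>\<^sup>+x. f x * indicator A x + f x * indicator B x \<partial>M)"
    using assms(3) by (intro nn_integral_mono) (auto split: split_indicator)
  also have "\<dots> = (\<integral>\<^sup>+x\<in>A. f x \<partial>M) + (\<integral>\<^sup>+x\<in>B. f x \<partial>M)"
    using assms by (intro nn_integral_add) auto
  finally show ?thesis using assms(1,2) by (simp add: le_less_trans)
qed

locale divergent_weight =
  fixes \<mu> :: "real \<Rightarrow> real" and p :: real
  assumes \<mu>_cont: "continuous_on UNIV \<mu>" and \<mu>_pos: "\<And>x. 0 < \<mu> x" and p: "1 \<le> p"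
    and \<mu>_left: "(\<integral>\<^sup>+t\<in>{..0}. ennreal (\<mu> t) \<partial>lebesgue) = \<infinity>"
    and \<mu>_right: "(\<integral>\<^sup>+t\<in>{0..}. ennreal (\<mu> t) \<partial>lebesgue) = \<infinity>"
begin

lemma \<mu>_measurable: "(\<lambda>x. ennreal (\<mu> x)) \<in> borel_measurable lebesgue"
  using borel_measurable_continuous_onI[OF \<mu>_cont] by (intro measurable_completion) measurable

lemma no_linear_growth_right:
  assumes "integrable lebesgue (\<lambda>x. \<bar>\<mu> x * y x\<bar> powr p)" "0 < \<kappa>" "1 \<le> X"
  shows "\<not> (\<forall>x\<ge>X. \<kappa> * \<bar>x\<bar> \<le> \<bar>y x\<bar>)"
proof
  assume *: "\<forall>x\<ge>X. \<kappa> * \<bar>x\<bar> \<le> \<bar>y x\<bar>"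
  have "(\<integral>\<^sup>+x\<in>{X..}. ennreal (\<mu> x) \<partial>lebesgue) < \<infinity>"
    by (rule weight_integral_finite[OF p assms(1) \<mu>_pos assms(2)]) (use * assms(3) in auto)
  from nn_integral_Un_finite[OF this nn_integral_continuous_Icc_finite[OF \<mu>_cont, of 0 X] _ _ _ \<mu>_measurable, of "{0..}"]
  show False using \<mu>_right by force
qed

lemma no_linear_growth_left:
  assumes "integrable lebesgue (\<lambda>x. \<bar>\<mu> x * y x\<bar> powr p)" "0 < \<kappa>" "1 \<le> X"
  shows "\<not> (\<forall>x\<le>-X. \<kappa> * \<bar>x\<bar> \<le> \<bar>y x\<bar>)"
proof
  assume *: "\<forall>x\<le>-X. \<kappa> * \<bar>x\<bar> \<le> \<bar>y x\<bar>"
  have "(\<integral>\<^sup>+x\<in>{..-X}. ennreal (\<mu> x) \<partial>lebesgue) < \<infinity>"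
    by (rule weight_integral_finite[OF p assms(1) \<mu>_pos assms(2)]) (use * assms(3) in auto)
  from nn_integral_Un_finite[OF this nn_integral_continuous_Icc_finite[OF \<mu>_cont, of "-X" 0] _ _ _ \<mu>_measurable, of "{..0}"]
  show False using \<mu>_left by force
qed

text \<open>Linear growth at either end would make the integral of \<mu> finite there, so only the
  constant alternative survives.\<close>

lemma positive_part_constant:
  assumes h: "primitive h k" and k: "primitive k g"
    and g: "AE x in lebesgue. 0 < h x \<longrightarrow> 0 \<le> g x"
    and x0: "0 < h x0" and int: "integrable lebesgue (\<lambda>x. \<bar>\<mu> x * h x\<bar> powr p)"
  shows "(\<forall>x. h x = h x0) \<and> (AE x in lebesgue. g x = 0)"
  using h k g x0
proof (cases rule: linear_growth_or_constant)
  case (right \<kappa> X)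
  then have "\<kappa> * \<bar>x\<bar> \<le> \<bar>h x\<bar>" if "X \<le> x" for x using that abs_ge_self order_trans by blast
  then show ?thesis using no_linear_growth_right[OF int right(1,2)] by blast
next
  case (left \<kappa> X)
  then have "\<kappa> * \<bar>x\<bar> \<le> \<bar>h x\<bar>" if "x \<le> - X" for x using that abs_ge_self order_trans by blast
  then show ?thesis using no_linear_growth_left[OF int left(1,2)] by blast
qed auto

end

locale weighted_potential = potential q + divergent_weight \<mu> p for q \<mu> :: "real \<Rightarrow> real" and p :: real
begin

lemma q_not_AE_zero: "\<not> (AE x in lebesgue. q x = 0)"
proof
  assume "AE x in lebesgue. q x = 0"
  then have "(\<integral>\<^sup>+t\<in>{0..}. ennreal (q t) \<partial>lebesgue) = (\<integral>\<^sup>+t. 0 \<partial>(lebesgue :: real measure))"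
    by (intro nn_integral_cong_AE, eventually_elim) simp
  then show False using q_right[of 0] by simp
qed

text \<open>Where \<open>- y\<close> is positive its second derivative is
  \<open>q * (- y) + f\<close>, hence nonnegative, so a negative value makes \<open>y\<close> a
  negative constant. Then \<open>q * y = f\<close> with \<open>f\<close> nonnegative forces
  \<open>q\<close> to vanish almost everywhere, against the mass assumption.\<close>

lemma solution_nonneg:
  assumes y: "primitive y z" and z: "primitive z (\<lambda>x. q x * y x - f x)"
    and f: "AE x in lebesgue. 0 \<le> f x" and int: "integrable lebesgue (\<lambda>x. \<bar>\<mu> x * y x\<bar> powr p)"
  shows "0 \<le> y x"
proof (rule ccontr)
  assume neg: "\<not> 0 \<le> y x"
  have "(\<forall>t. - y t = - y x) \<and> (AE t in lebesgue. - (q t * y t - f t) = 0)"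
  proof (rule positive_part_constant[OF primitive_minus[OF y] primitive_minus[OF z]])
    show "AE t in lebesgue. 0 < - y t \<longrightarrow> 0 \<le> - (q t * y t - f t)"
      using q_nonneg f
    proof eventually_elim
      case (elim t)
      then show ?case using mult_nonneg_nonpos[of "q t" "y t"] by auto
    qed
    show "integrable lebesgue (\<lambda>x. \<bar>\<mu> x * - y x\<bar> powr p)" using int by simp
  qed (use neg in auto)
  then have c: "\<And>t. y t = y x" and ae: "AE t in lebesgue. - (q t * y t - f t) = 0" by auto
  have "AE t in lebesgue. q t = 0"
    using ae q_nonneg f
  proof eventually_elim
    case (elim t)
    then have "q t * y x \<ge> 0" using c[of t] by simp
    then show ?case using neg elim by (simp add: zero_le_mult_iff)
  qed
  then show False using q_not_AE_zero by blast
qed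

lemma homogeneous_solution_zero:
  assumes y: "primitive y z" and z: "primitive z (\<lambda>x. q x * y x)"
    and int: "integrable lebesgue (\<lambda>x. \<bar>\<mu> x * y x\<bar> powr p)"
  shows "y x = 0"
proof -
  have "0 \<le> y x" by (rule solution_nonneg[OF y, of "\<lambda>x. 0"]) (use z int in auto)
  moreover have "0 \<le> - y x"
    by (rule solution_nonneg[OF primitive_minus[OF y], of "\<lambda>x. 0"])
      (use primitive_minus[OF z] int in auto)
  ultimately show ?thesis by simp
qed

end

section \<open>Sufficiency: a Schur test\<close>

lemma nn_integral_le_exhaustion:
  assumes f: "f \<in> borel_measurable lborel"
    and le: "\<And>n::nat. (\<integral>\<^sup>+x\<in>{- real n..real n}. f x \<partial>lborel) \<le> C"
  shows "(\<integral>\<^sup>+x. f x \<partial>lborel) \<le> C"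
proof -
  have sup: "f x = (SUP n::nat. f x * indicator {- real n..real n} x)" for x
  proof (rule antisym)
    obtain n where "\<bar>x\<bar> \<le> real n" using real_arch_simple by blast
    then have "f x = f x * indicator {- real n..real n} x" by (simp add: indicator_def abs_le_iff)
    also have "\<dots> \<le> (SUP n::nat. f x * indicator {- real n..real n} x)" by (rule SUP_upper) simp
    finally show "f x \<le> (SUP n::nat. f x * indicator {- real n..real n} x)" .
    show "(SUP n::nat. f x * indicator {- real n..real n} x) \<le> f x"
      by (rule SUP_least) (simp add: indicator_def)
  qed
  have "(\<integral>\<^sup>+x. f x \<partial>lborel) = (\<integral>\<^sup>+x. (SUP n::nat. f x * indicator {- real n..real n} x) \<partial>lborel)"
    by (subst sup) (rule refl)
  also have "\<dots> = (SUP n::nat. \<integral>\<^sup>+x. f x * indicator {- real n..real n} x \<partial>lborel)"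
  proof (rule nn_integral_monotone_convergence_SUP)
    show "incseq (\<lambda>(n::nat) x. f x * indicator {- real n..real n} x)"
      by (intro incseq_SucI le_funI) (simp add: indicator_def)
    show "(\<lambda>x. f x * indicator {- real n..real n} x) \<in> borel_measurable lborel" for n :: nat
      using f by measurable
  qed
  also have "\<dots> \<le> C" by (rule SUP_least) (rule le)
  finally show ?thesis .
qed

section \<open>Schur's test for all finite exponents\<close>

text \<open>The convex function \<open>g powr p\<close> lies above its tangent at \<tau>. Young's
  inequality proves this with the conjugate exponent \<open>p / (p - 1)\<close>, hence the separate
  case \<open>p = 1\<close>.\<close>

lemma young_tangent:
  fixes p g \<tau> :: real
  assumes p: "1 \<le> p" and g: "0 \<le> g" and l: "0 < \<tau>"
  shows "p * \<tau> powr (p - 1) * g \<le> g powr p + (p - 1) * \<tau> powr p"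
proof (cases "p = 1")
  case True
  then show ?thesis using g l by simp
next
  case False
  then have p1: "1 < p" using p by simp
  have "g * \<tau> powr (p - 1) \<le> g powr p / p + (\<tau> powr (p - 1)) powr (p / (p - 1)) / (p / (p - 1))"
    by (rule Youngs_inequality) (use p1 g in \<open>auto simp: field_simps\<close>)
  also have "(\<tau> powr (p - 1)) powr (p / (p - 1)) = \<tau> powr p" using p1 by (simp add: powr_powr)
  finally have "p * (g * \<tau> powr (p - 1)) \<le> p * (g powr p / p + \<tau> powr p / (p / (p - 1)))"
    using p1 by (intro mult_left_mono) auto
  also have "\<dots> = g powr p + (p - 1) * \<tau> powr p" using p1 by (simp add: field_simps)
  finally show ?thesis by (simp add: mult.commute mult.left_commute)
qed

text \<open>The tangent inequality is integrated against \<open>k\<close> and then optimised over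
  \<tau>. Linear tangents make a single argument serve every exponent, \<open>p = 1\<close>
  included.\<close>

lemma jensen_powr_nn_integral:
  fixes k g :: "'a \<Rightarrow> real"
  assumes p: "1 \<le> p" and C: "0 < C"
    and meas [measurable]: "k \<in> borel_measurable M" "g \<in> borel_measurable M"
    and nn: "\<And>t. 0 \<le> k t" "\<And>t. 0 \<le> g t"
    and k: "(\<integral>\<^sup>+t. ennreal (k t) \<partial>M) \<le> ennreal C"
    and a: "0 \<le> a" "ennreal a \<le> (\<integral>\<^sup>+t. ennreal (k t * g t) \<partial>M)"
  shows "ennreal (a powr p) \<le> ennreal (C powr (p - 1)) * (\<integral>\<^sup>+t. ennreal (k t * g t powr p) \<partial>M)"
proof (cases "(\<integral>\<^sup>+t. ennreal (k t * g t powr p) \<partial>M) = \<infinity>")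
  case True
  then show ?thesis using C by (simp add: ennreal_mult_top)
next
  case False
  then obtain i where i: "0 \<le> i" "(\<integral>\<^sup>+t. ennreal (k t * g t powr p) \<partial>M) = ennreal i"
    by (cases "\<integral>\<^sup>+t. ennreal (k t * g t powr p) \<partial>M") auto
  have bound: "p * \<tau> powr (p - 1) * a \<le> i + (p - 1) * \<tau> powr p * C" if l: "0 < \<tau>" for \<tau>
  proof -
    have "ennreal (p * \<tau> powr (p - 1) * a) = ennreal (p * \<tau> powr (p - 1)) * ennreal a"
      using p a by (intro ennreal_mult) auto
    also have "\<dots> \<le> ennreal (p * \<tau> powr (p - 1)) * (\<integral>\<^sup>+t. ennreal (k t * g t) \<partial>M)"
      by (intro mult_left_mono a) simp
    also have "\<dots> = (\<integral>\<^sup>+t. ennreal (p * \<tau> powr (p - 1)) * ennreal (k t * g t) \<partial>M)"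
      by (rule nn_integral_cmult[symmetric]) measurable
    also have "\<dots> \<le> (\<integral>\<^sup>+t. ennreal (k t * g t powr p) + ennreal ((p - 1) * \<tau> powr p) * ennreal (k t) \<partial>M)"
    proof (rule nn_integral_mono)
      fix t
      have "ennreal (p * \<tau> powr (p - 1)) * ennreal (k t * g t) = ennreal (k t * (p * \<tau> powr (p - 1) * g t))"
        using p nn by (subst ennreal_mult[symmetric]) (auto simp: mult_ac)
      also have "\<dots> \<le> ennreal (k t * (g t powr p + (p - 1) * \<tau> powr p))"
        by (intro ennreal_leI mult_left_mono young_tangent p l nn)
      also have "\<dots> = ennreal (k t * g t powr p + (p - 1) * \<tau> powr p * k t)"
        by (simp add: algebra_simps)
      also have "\<dots> = ennreal (k t * g t powr p) + ennreal ((p - 1) * \<tau> powr p) * ennreal (k t)"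
        using p nn by (subst ennreal_plus) (auto simp: ennreal_mult)
      finally show "ennreal (p * \<tau> powr (p - 1)) * ennreal (k t * g t) \<le>
          ennreal (k t * g t powr p) + ennreal ((p - 1) * \<tau> powr p) * ennreal (k t)" .
    qed
    also have "\<dots> = ennreal i + ennreal ((p - 1) * \<tau> powr p) * (\<integral>\<^sup>+t. ennreal (k t) \<partial>M)"
      by (subst nn_integral_add) (auto simp: i nn_integral_cmult)
    also have "\<dots> \<le> ennreal i + ennreal ((p - 1) * \<tau> powr p) * ennreal C"
      by (intro add_left_mono mult_left_mono k) simp
    also have "\<dots> = ennreal (i + (p - 1) * \<tau> powr p * C)"
      using p C i by (simp add: ennreal_mult ennreal_plus)
    finally show ?thesis using p C i by (subst (asm) ennreal_le_iff) auto
  qed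
  \<comment> \<open>The optimal \<tau> satisfies \<open>\<tau> powr p = i / C\<close>, which would
    be 0 for \<open>i = 0\<close>; a strictly larger \<open>j\<close> keeps \<tau> positive and is
    removed by density afterwards.\<close>
  have "a powr p \<le> C powr (p - 1) * j" if j: "i < j" for j
  proof -
    define \<tau> where "\<tau> = (j / C) powr (1 / p)"
    have jC: "0 < j / C" using j i C by simp
    have l: "0 < \<tau>" using j i C by (simp add: \<tau>_def)
    have lp: "\<tau> powr p = j / C" using jC p i j C by (simp add: \<tau>_def powr_powr)
    have "p * \<tau> powr (p - 1) * a \<le> j + (p - 1) * \<tau> powr p * C" using bound[OF l] j by linarith
    also have "\<dots> = p * (\<tau> powr p * C)" using lp C by (simp add: field_simps)
    also have "\<dots> = p * \<tau> powr (p - 1) * (C * \<tau>)" using l by (simp add: powr_diff)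
    finally have "a \<le> C * \<tau>" using p l by simp
    then have "a powr p \<le> (C * \<tau>) powr p" using a p by (intro powr_mono2) auto
    also have "\<dots> = C powr p * (j / C)" using C l by (simp add: powr_mult lp)
    also have "\<dots> = C powr (p - 1) * j" using C by (simp add: powr_diff)
    finally show ?thesis .
  qed
  then have "a powr p / C powr (p - 1) \<le> j" if "i < j" for j
    using that C by (simp add: divide_le_eq mult.commute)
  then have "a powr p / C powr (p - 1) \<le> i" by (rule dense_ge)
  then have "a powr p \<le> C powr (p - 1) * i" using C by (simp add: divide_le_eq mult.commute)
  then show ?thesis using i by (simp add: ennreal_mult[symmetric] ennreal_leI)
qed

text \<open>Jensen's inequality in \<open>t\<close> with the row bound gives the factor
  \<open>C powr (p - 1)\<close>; after exchanging the integrals the column bound supplies the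
  missing factor \<open>C\<close>.\<close>

lemma schur_test:
  fixes k :: "real \<Rightarrow> real \<Rightarrow> real" and g y :: "real \<Rightarrow> real"
  assumes p: "1 \<le> p" and C: "0 < C"
    and k [measurable]: "case_prod k \<in> borel_measurable (borel \<Otimes>\<^sub>M borel)" and g [measurable]: "g \<in> borel_measurable borel"
    and nn: "\<And>x t. 0 \<le> k x t" "\<And>t. 0 \<le> g t" "\<And>x. 0 \<le> y x"
    and k1: "\<And>x. (\<integral>\<^sup>+t. ennreal (k x t) \<partial>lborel) \<le> ennreal C"
    and k2: "\<And>t. (\<integral>\<^sup>+x. ennreal (k x t) \<partial>lborel) \<le> ennreal C"
    and y: "\<And>x. ennreal (y x) \<le> (\<integral>\<^sup>+t. ennreal (k x t * g t) \<partial>lborel)"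
  shows "(\<integral>\<^sup>+x. ennreal (y x powr p) \<partial>lborel) \<le> ennreal (C powr p) * (\<integral>\<^sup>+t. ennreal (g t powr p) \<partial>lborel)"
proof -
  have kx [measurable]: "k x \<in> borel_measurable borel" for x
    using measurable_compose[OF measurable_Pair1'[of x borel borel] k] by simp
  have kt [measurable]: "(\<lambda>x. k x t) \<in> borel_measurable borel" for t
    using measurable_compose[OF measurable_Pair2'[of t borel borel] k] by simp
  have "(\<integral>\<^sup>+x. ennreal (y x powr p) \<partial>lborel) \<le>
      (\<integral>\<^sup>+x. ennreal (C powr (p - 1)) * (\<integral>\<^sup>+t. ennreal (k x t * g t powr p) \<partial>lborel) \<partial>lborel)"
    by (intro nn_integral_mono jensen_powr_nn_integral p C nn k1 y) auto
  also have "\<dots> = ennreal (C powr (p - 1)) * (\<integral>\<^sup>+x. (\<integral>\<^sup>+t. ennreal (k x t * g t powr p) \<partial>lborel) \<partial>lborel)"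
    by (rule nn_integral_cmult) measurable
  also have "(\<integral>\<^sup>+x. (\<integral>\<^sup>+t. ennreal (k x t * g t powr p) \<partial>lborel) \<partial>lborel) =
      (\<integral>\<^sup>+t. (\<integral>\<^sup>+x. ennreal (k x t * g t powr p) \<partial>lborel) \<partial>lborel)"
    by (rule lborel_pair.Fubini'[symmetric]) measurable
  also have "\<dots> \<le> (\<integral>\<^sup>+t. ennreal C * ennreal (g t powr p) \<partial>lborel)"
  proof (rule nn_integral_mono)
    fix t
    have "(\<integral>\<^sup>+x. ennreal (k x t * g t powr p) \<partial>lborel) = (\<integral>\<^sup>+x. ennreal (k x t) * ennreal (g t powr p) \<partial>lborel)"
      using nn by (simp add: ennreal_mult)
    also have "\<dots> = (\<integral>\<^sup>+x. ennreal (k x t) \<partial>lborel) * ennreal (g t powr p)"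
      by (rule nn_integral_multc) measurable
    also have "\<dots> \<le> ennreal C * ennreal (g t powr p)" by (intro mult_right_mono k2) simp
    finally show "(\<integral>\<^sup>+x. ennreal (k x t * g t powr p) \<partial>lborel) \<le> ennreal C * ennreal (g t powr p)" .
  qed
  also have "\<dots> = ennreal C * (\<integral>\<^sup>+t. ennreal (g t powr p) \<partial>lborel)"
    by (rule nn_integral_cmult) measurable
  finally have "(\<integral>\<^sup>+x. ennreal (y x powr p) \<partial>lborel) \<le>
      ennreal (C powr (p - 1)) * (ennreal C * (\<integral>\<^sup>+t. ennreal (g t powr p) \<partial>lborel))"
    by (simp add: mult_left_mono)
  also have "\<dots> = ennreal (C powr (p - 1) * C) * (\<integral>\<^sup>+t. ennreal (g t powr p) \<partial>lborel)"
    using C by (simp add: ennreal_mult mult.assoc)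
  also have "C powr (p - 1) * C = C powr p" using C by (simp add: powr_diff)
  finally show ?thesis .
qed

context potential
begin

lemma rad_measurable [measurable]: "rad \<in> borel_measurable borel"
  by (rule borel_measurable_continuous_onI[OF rad_continuous])

lemma R_measurable [measurable]: "R \<in> borel_measurable borel"
  by (rule borel_measurable_continuous_onI[OF primitive_continuous[OF R_primitive]])

text \<open>Substituting \<open>R t\<close> for \<open>t\<close> turns \<open>dt / rad t\<close>
  into Lebesgue measure. Each side of \<open>x\<close> then contributes at most
  \<open>1 / c\<close>.\<close>

lemma nn_integral_exp_R:
  assumes c: "0 < c"
  shows "(\<integral>\<^sup>+t. ennreal (1 / rad t * exp (- c * \<bar>R t - R x\<bar>)) \<partial>lborel) \<le> ennreal (2 / c)"
proof (rule nn_integral_le_exhaustion)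
  show "(\<lambda>t. ennreal (1 / rad t * exp (- c * \<bar>R t - R x\<bar>))) \<in> borel_measurable lborel" by measurable
  have DR: "((\<lambda>t. exp (s * (R t - R x)) / s) has_real_derivative 1 / rad t * exp (s * (R t - R x))) (at t)"
    if "s \<noteq> 0" for s t
    using that by (auto intro!: derivative_eq_intros R_DERIV simp: less_imp_neq[OF rad(1), symmetric])
  have right: "(\<integral>\<^sup>+t\<in>{x..b}. ennreal (1 / rad t * exp (- c * (R t - R x))) \<partial>lborel) \<le> ennreal (1 / c)" for b
  proof (cases "x \<le> b")
    case True
    have "(\<integral>\<^sup>+t\<in>{x..b}. ennreal (1 / rad t * exp (- c * (R t - R x))) \<partial>lborel) =
        ennreal (exp (- c * (R b - R x)) / - c - exp (- c * (R x - R x)) / - c)"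
      by (rule nn_integral_FTC_Icc[where F="\<lambda>t. exp (- c * (R t - R x)) / - c"])
        (use DR[of "- c"] c True in \<open>auto simp: less_imp_le[OF rad(1)]\<close>)
    also have "\<dots> \<le> ennreal (1 / c)" using c by (intro ennreal_leI) (simp add: field_simps)
    finally show ?thesis .
  qed simp
  have left: "(\<integral>\<^sup>+t\<in>{a..x}. ennreal (1 / rad t * exp (c * (R t - R x))) \<partial>lborel) \<le> ennreal (1 / c)" for a
  proof (cases "a \<le> x")
    case True
    have "(\<integral>\<^sup>+t\<in>{a..x}. ennreal (1 / rad t * exp (c * (R t - R x))) \<partial>lborel) =
        ennreal (exp (c * (R x - R x)) / c - exp (c * (R a - R x)) / c)"
      by (rule nn_integral_FTC_Icc[where F="\<lambda>t. exp (c * (R t - R x)) / c"])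
        (use DR[of c] c True in \<open>auto simp: less_imp_le[OF rad(1)]\<close>)
    also have "\<dots> \<le> ennreal (1 / c)" using c by (intro ennreal_leI) (simp add: field_simps)
    finally show ?thesis .
  qed simp
  fix n :: nat
  have "(\<integral>\<^sup>+t\<in>{- real n..real n}. ennreal (1 / rad t * exp (- c * \<bar>R t - R x\<bar>)) \<partial>lborel) \<le>
     (\<integral>\<^sup>+t. ennreal (1 / rad t * exp (- c * (R t - R x))) * indicator {x..real n} t +
       ennreal (1 / rad t * exp (c * (R t - R x))) * indicator {- real n..x} t \<partial>lborel)"
  proof (rule nn_integral_mono)
    fix t
    show "ennreal (1 / rad t * exp (- c * \<bar>R t - R x\<bar>)) * indicator {- real n..real n} t \<le>
       ennreal (1 / rad t * exp (- c * (R t - R x))) * indicator {x..real n} t +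
       ennreal (1 / rad t * exp (c * (R t - R x))) * indicator {- real n..x} t"
    proof (cases "x \<le> t")
      case True
      then show ?thesis using R_mono[OF True] by (simp add: indicator_def)
    next
      case False
      then have e: "- c * \<bar>R t - R x\<bar> = c * (R t - R x)" using R_mono[of t x] by (simp add: algebra_simps)
      show ?thesis using False unfolding e by (simp add: indicator_def)
    qed
  qed
  also have "\<dots> = (\<integral>\<^sup>+t\<in>{x..real n}. ennreal (1 / rad t * exp (- c * (R t - R x))) \<partial>lborel) +
      (\<integral>\<^sup>+t\<in>{- real n..x}. ennreal (1 / rad t * exp (c * (R t - R x))) \<partial>lborel)"
    by (rule nn_integral_add) measurable
  also have "\<dots> \<le> ennreal (1 / c) + ennreal (1 / c)" by (intro add_mono right left)
  also have "\<dots> = ennreal (2 / c)" using c by (simp flip: ennreal_plus)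
  finally show "(\<integral>\<^sup>+t\<in>{- real n..real n}. ennreal (1 / rad t * exp (- c * \<bar>R t - R x\<bar>)) \<partial>lborel) \<le> ennreal (2 / c)" .
qed

end

section \<open>Variation of parameters and the weighted kernel\<close>

lemma set_integral_Ioc_eq_integral:
  assumes w: "L1_loc w"
  shows "set_integrable lebesgue {a<..b} w" "(LINT t:{a<..b}|lebesgue. w t) = integral {a..b} w"
proof -
  have "set_integrable lebesgue {a..b} w" using w by (simp add: L1_loc_def)
  then show int: "set_integrable lebesgue {a<..b} w" by (rule set_integrable_subset) auto
  have "(LINT t:{a<..b}|lebesgue. w t) = integral {a<..b} w"
    by (rule set_lebesgue_integral_eq_integral[OF int])
  also have "\<dots> = integral {a..b} w"
    by (rule integral_spike_set) (auto intro: negligible_subset[of "{a}"])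
  finally show "(LINT t:{a<..b}|lebesgue. w t) = integral {a..b} w" .
qed

text \<open>For the coefficient functions of variation of parameters, which are integrals over the
  complementary half-lines \<open>{..x}\<close> and \<open>{x<..}\<close>.\<close>

lemma primitive_lower_integral:
  assumes w: "L1_loc w" and int: "\<And>x. set_integrable lebesgue {..x} w"
  shows "primitive (\<lambda>x. LINT t:{..x}|lebesgue. w t) w"
  unfolding primitive_def
proof (intro conjI allI impI w)
  fix a b :: real assume ab: "a \<le> b"
  have "(LINT t:{..a} \<union> {a<..b}|lebesgue. w t) = (LINT t:{..a}|lebesgue. w t) + (LINT t:{a<..b}|lebesgue. w t)"
    by (rule set_integral_Un[OF _ int set_integral_Ioc_eq_integral(1)[OF w]]) auto
  moreover have "{..a} \<union> {a<..b} = {..b}" using ab by auto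
  ultimately show "integral {a..b} w = (LINT t:{..b}|lebesgue. w t) - (LINT t:{..a}|lebesgue. w t)"
    by (simp add: set_integral_Ioc_eq_integral[OF w])
qed

lemma primitive_upper_integral:
  assumes w: "L1_loc w" and int: "\<And>x. set_integrable lebesgue {x<..} w"
  shows "primitive (\<lambda>x. LINT t:{x<..}|lebesgue. w t) (\<lambda>x. - w x)"
proof -
  have "primitive (\<lambda>x. - (LINT t:{x<..}|lebesgue. w t)) w"
    unfolding primitive_def
  proof (intro conjI allI impI w)
    fix a b :: real assume ab: "a \<le> b"
    have "(LINT t:{a<..b} \<union> {b<..}|lebesgue. w t) = (LINT t:{a<..b}|lebesgue. w t) + (LINT t:{b<..}|lebesgue. w t)"
      by (rule set_integral_Un[OF _ set_integral_Ioc_eq_integral(1)[OF w] int]) auto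
    moreover have "{a<..b} \<union> {b<..} = {a<..}" using ab by auto
    ultimately show "integral {a..b} w = - (LINT t:{b<..}|lebesgue. w t) - - (LINT t:{a<..}|lebesgue. w t)"
      by (simp add: set_integral_Ioc_eq_integral[OF w])
  qed
  then show ?thesis using primitive_minus by fastforce
qed

lemma le_one_plus_powr:
  fixes a p :: real
  assumes p: "1 \<le> p" and a: "0 \<le> a"
  shows "a \<le> 1 + a powr p"
proof (cases "a \<le> 1")
  case True
  then show ?thesis by (simp add: add_increasing2)
next
  case False
  then have "a powr 1 \<le> a powr p" using p by (intro powr_mono) auto
  then show ?thesis using False by simp
qed

lemma Lp_loc_imp_L1_loc:
  assumes p: "1 \<le> p" and f: "f \<in> Lp_loc p"
  shows "L1_loc f"
  unfolding L1_loc_def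
proof (intro allI)
  fix a b :: real
  have "set_integrable lebesgue {a..b} (\<lambda>x. 1 + \<bar>f x\<bar> powr p)"
    using f L1_loc_continuous[of "\<lambda>x. 1"] unfolding Lp_loc_def L1_loc_def by (auto intro!: set_integral_add)
  then show "set_integrable lebesgue {a..b} f"
  proof (rule set_integrable_bound)
    have "f \<in> borel_measurable lebesgue" using f by (simp add: Lp_loc_def)
    then show "set_borel_measurable lebesgue {a..b} f"
      unfolding set_borel_measurable_def by (intro borel_measurable_scaleR borel_measurable_indicator) auto
    show "AE x in lebesgue. x \<in> {a..b} \<longrightarrow> norm (f x) \<le> norm (1 + \<bar>f x\<bar> powr p)"
    proof (intro AE_I2 impI)
      fix x
      have "\<bar>f x\<bar> \<le> 1 + \<bar>f x\<bar> powr p" by (rule le_one_plus_powr[OF p]) simp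
      then show "norm (f x) \<le> norm (1 + \<bar>f x\<bar> powr p)" by simp
    qed
  qed
qed

lemma continuous_abs_powr:
  assumes "continuous_on UNIV y" "0 < (p::real)"
  shows "continuous_on UNIV (\<lambda>x::real. \<bar>y x :: real\<bar> powr p)"
  by (intro continuous_on_powr' continuous_intros assms) (use assms in auto)

lemma continuous_in_Lp_loc:
  assumes "continuous_on UNIV y" "0 < p"
  shows "y \<in> Lp_loc p"
  using L1_loc_continuous[OF continuous_abs_powr[OF assms]] borel_measurable_continuous_onI[OF assms(1)]
  by (auto simp: Lp_loc_def L1_loc_def intro!: measurable_completion)

lemma abs_diff_powr_le:
  fixes a b p :: real
  assumes "0 \<le> p"
  shows "\<bar>a - b\<bar> powr p \<le> 2 powr p * (\<bar>a\<bar> powr p + \<bar>b\<bar> powr p)"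
proof -
  have "\<bar>a - b\<bar> powr p \<le> (2 * max \<bar>a\<bar> \<bar>b\<bar>) powr p" by (rule powr_mono2) (use assms in auto)
  also have "\<dots> = 2 powr p * max \<bar>a\<bar> \<bar>b\<bar> powr p" by (rule powr_mult) 
  also have "\<dots> \<le> 2 powr p * (\<bar>a\<bar> powr p + \<bar>b\<bar> powr p)" by (intro mult_left_mono) (auto simp: max_def)
  finally show ?thesis .
qed

context divergent_weight
begin

lemma Lp_weighted_diff_integrable:
  assumes "continuous_on UNIV y1" "continuous_on UNIV y2"
    and "integrable lebesgue (\<lambda>x. \<bar>\<mu> x * y1 x\<bar> powr p)" "integrable lebesgue (\<lambda>x. \<bar>\<mu> x * y2 x\<bar> powr p)"
  shows "integrable lebesgue (\<lambda>x. \<bar>\<mu> x * (y1 x - y2 x)\<bar> powr p)"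
proof (rule Bochner_Integration.integrable_bound)
  show "integrable lebesgue (\<lambda>x. 2 powr p * (\<bar>\<mu> x * y1 x\<bar> powr p + \<bar>\<mu> x * y2 x\<bar> powr p))"
    using assms(3,4) by simp
  have "continuous_on UNIV (\<lambda>x. \<bar>\<mu> x * (y1 x - y2 x)\<bar> powr p)"
    using p by (intro continuous_abs_powr continuous_intros \<mu>_cont assms) auto
  then show "(\<lambda>x. \<bar>\<mu> x * (y1 x - y2 x)\<bar> powr p) \<in> borel_measurable lebesgue"
    by (intro measurable_completion) (simp add: borel_measurable_continuous_onI)
  show "AE x in lebesgue. norm (\<bar>\<mu> x * (y1 x - y2 x)\<bar> powr p) \<le>
      norm (2 powr p * (\<bar>\<mu> x * y1 x\<bar> powr p + \<bar>\<mu> x * y2 x\<bar> powr p))"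
    using abs_diff_powr_le[of p "\<mu> _ * y1 _" "\<mu> _ * y2 _"] p by (auto simp: right_diff_distrib)
qed

end

locale agreeing_weights = weighted_potential q \<mu> p for q \<mu> :: "real \<Rightarrow> real" and p :: real +
  fixes \<theta> :: "real \<Rightarrow> real"
  assumes \<theta>_cont: "continuous_on UNIV \<theta>" and \<theta>_pos: "\<And>x. 0 < \<theta> x" and agr: "agrees \<mu> \<theta> q"
begin

text \<open>Agreement at \<open>\<epsilon> / sqrt 2\<close>, because the integral of
  \<open>1 / d\<close> is \<open>sqrt 2\<close> times an increment of \<open>R\<close>; the
  quotients of \<open>d\<close> and of \<open>rad\<close> coincide.\<close>

lemma agreement:
  assumes \<epsilon>: "0 < \<epsilon>"
  obtains c where "1 \<le> c"
    "\<And>t x. inverse c * exp (- \<epsilon> * \<bar>R t - R x\<bar>) \<le> sqrt (rad t / rad x) * (\<mu> t / \<mu> x)"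
    "\<And>t x. sqrt (rad t / rad x) * (\<mu> t / \<mu> x) \<le> c * exp (\<epsilon> * \<bar>R t - R x\<bar>)"
    "\<And>t x. inverse c * exp (- \<epsilon> * \<bar>R t - R x\<bar>) \<le> sqrt (rad t / rad x) * (\<theta> x / \<theta> t)"
    "\<And>t x. sqrt (rad t / rad x) * (\<theta> x / \<theta> t) \<le> c * exp (\<epsilon> * \<bar>R t - R x\<bar>)"
proof -
  have "0 < \<epsilon> / sqrt 2" using \<epsilon> by simp
  then obtain c where c: "1 \<le> c" and
    *: "\<And>t x. let I = \<bar>LINT \<xi>=ereal x..ereal t|lebesgue. (1 / d_fun q \<xi>)\<bar>;
            A = sqrt (d_fun q t / d_fun q x) * (\<mu> t / \<mu> x);
            B = sqrt (d_fun q t / d_fun q x) * (\<theta> x / \<theta> t)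
        in inverse c * exp (- (\<epsilon> / sqrt 2) * I) \<le> A \<and> A \<le> c * exp (\<epsilon> / sqrt 2 * I) \<and>
           inverse c * exp (- (\<epsilon> / sqrt 2) * I) \<le> B \<and> B \<le> c * exp (\<epsilon> / sqrt 2 * I)"
    using agr unfolding agrees_def by blast
  have r: "d_fun q t / d_fun q x = rad t / rad x" for t x by (simp add: d_fun_rad)
  have e: "\<epsilon> / sqrt 2 * (sqrt 2 * X) = \<epsilon> * X" for X by simp
  show thesis
    by (rule that[OF c]) (use *[unfolded LINT_inverse_d r Let_def] in \<open>simp_all add: e\<close>)
qed

text \<open>Two factorisations of \<open>\<mu> x / \<theta> t * sqrt (rad x * rad t)\<close>: one
  isolates the bounded quantity at \<open>x\<close>, the factor \<open>1 / rad x\<close> and the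
  agreement quotient for \<theta>; the other does the same at \<open>t\<close> with the quotient for
  \<mu>. Both quotients cost \<open>exp (|R t - R x| / 4)\<close> out of a decay with rate
  1/2.\<close>

lemma kernel_bound:
  assumes m: "\<And>x. \<mu> x / \<theta> x * (rad x)\<^sup>2 \<le> m"
  obtains M where "0 < M" "\<And>x t. \<mu> x / \<theta> t * (sqrt (rad x * rad t) * exp (- \<bar>R t - R x\<bar> / 2)) \<le>
      M * (min (1 / rad x) (1 / rad t) * exp (- \<bar>R t - R x\<bar> / 4))"
proof -
  obtain c where c: "1 \<le> c"
    and A: "\<And>t x. sqrt (rad t / rad x) * (\<mu> t / \<mu> x) \<le> c * exp (1 / 4 * \<bar>R t - R x\<bar>)"
    and B: "\<And>t x. sqrt (rad t / rad x) * (\<theta> x / \<theta> t) \<le> c * exp (1 / 4 * \<bar>R t - R x\<bar>)"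
    using agreement[of "1 / 4"] by (metis zero_less_divide_1_iff zero_less_numeral)
  have m0: "0 < \<mu> x / \<theta> x * (rad x)\<^sup>2" for x using \<mu>_pos[of x] \<theta>_pos[of x] rad(1)[of x] by simp
  have mpos: "0 < m" using m0[of 0] m[of 0] by linarith
  show thesis
  proof (rule that[of "m * c"])
    show "0 < m * c" using mpos c by simp
    fix x t
    define E where "E = exp (1 / 4 * \<bar>R t - R x\<bar>)"
    have E: "0 < E" by (simp add: E_def)
    have sq: "sqrt (rad x * rad t) = rad x * sqrt (rad t / rad x)" "sqrt (rad x * rad t) = rad t * sqrt (rad x / rad t)"
      using rad(1)[of x] rad(1)[of t] by (auto simp: real_sqrt_mult real_sqrt_divide field_simps)
    have "\<mu> x / \<theta> t * sqrt (rad x * rad t) = (\<mu> x / \<theta> x * (rad x)\<^sup>2) * (1 / rad x) * (sqrt (rad t / rad x) * (\<theta> x / \<theta> t))"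
      unfolding sq(1) using rad(1)[of x] \<theta>_pos[of x] \<theta>_pos[of t] by (simp add: field_simps power2_eq_square)
    also have "\<dots> \<le> m * (1 / rad x) * (c * E)"
      unfolding E_def
      by (rule mult_mono[OF mult_right_mono[OF m] B])
        (use less_imp_le[OF rad(1)] less_imp_le[OF \<theta>_pos] mpos in auto)
    finally have 1: "\<mu> x / \<theta> t * sqrt (rad x * rad t) \<le> m * c * (1 / rad x) * E" by (simp add: mult_ac)
    have "\<mu> x / \<theta> t * sqrt (rad x * rad t) = (\<mu> t / \<theta> t * (rad t)\<^sup>2) * (1 / rad t) * (sqrt (rad x / rad t) * (\<mu> x / \<mu> t))"
      unfolding sq(2) using rad(1)[of t] \<theta>_pos[of t] \<mu>_pos[of t] by (simp add: field_simps power2_eq_square)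
    also have "\<dots> \<le> m * (1 / rad t) * (c * E)"
      unfolding E_def abs_minus_commute[of "R t" "R x"]
      by (rule mult_mono[OF mult_right_mono[OF m] A])
        (use less_imp_le[OF rad(1)] less_imp_le[OF \<mu>_pos] mpos in auto)
    finally have 2: "\<mu> x / \<theta> t * sqrt (rad x * rad t) \<le> m * c * (1 / rad t) * E" by (simp add: mult_ac)
    have "\<mu> x / \<theta> t * sqrt (rad x * rad t) \<le> m * c * min (1 / rad x) (1 / rad t) * E"
      using 1 2 by (auto simp: min_def)
    then have "\<mu> x / \<theta> t * sqrt (rad x * rad t) * exp (- \<bar>R t - R x\<bar> / 2) \<le>
        m * c * min (1 / rad x) (1 / rad t) * E * exp (- \<bar>R t - R x\<bar> / 2)"
      by (rule mult_right_mono) simp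
    also have "\<dots> = m * c * min (1 / rad x) (1 / rad t) * exp (- \<bar>R t - R x\<bar> / 4)"
      unfolding mult.assoc E_def exp_add[symmetric] by simp
    finally show "\<mu> x / \<theta> t * (sqrt (rad x * rad t) * exp (- \<bar>R t - R x\<bar> / 2)) \<le>
        m * c * (min (1 / rad x) (1 / rad t) * exp (- \<bar>R t - R x\<bar> / 4))" by (simp only: mult.assoc)
  qed
qed

text \<open>Variation of parameters, \<open>y = v * A + u * B\<close>, represents \<open>y\<close>
  by the Green function, and Schur's test applies to its weighted kernel. \<open>f\<close> is taken
  Borel because the iterated integrals live on \<open>lborel\<close>; \<open>C\<close> is fixed
  before \<open>f\<close>.\<close>

lemma solution_exists_bounded:
  assumes m: "\<And>x. \<mu> x / \<theta> x * (rad x)\<^sup>2 \<le> m"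
  obtains C where "0 < C"
    "\<And>f. f \<in> borel_measurable borel \<Longrightarrow> L1_loc f \<Longrightarrow> integrable lebesgue (\<lambda>x. \<bar>\<theta> x * f x\<bar> powr p) \<Longrightarrow>
      \<exists>y z. primitive y z \<and> primitive z (\<lambda>x. q x * y x - f x) \<and>
        integrable lebesgue (\<lambda>x. \<bar>\<mu> x * y x\<bar> powr p) \<and>
        (LINT x|lebesgue. \<bar>\<mu> x * y x\<bar> powr p) \<le> C powr p * (LINT x|lebesgue. \<bar>\<theta> x * f x\<bar> powr p)"
proof -
  obtain M where M: "0 < M" and Kb: "\<And>x t. \<mu> x / \<theta> t * (sqrt (rad x * rad t) * exp (- \<bar>R t - R x\<bar> / 2)) \<le>
      M * (min (1 / rad x) (1 / rad t) * exp (- \<bar>R t - R x\<bar> / 4))"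
    using kernel_bound[OF m] by blast
  obtain u u' v v' where
    u: "primitive u u'" "primitive u' (\<lambda>x. q x * u x)" "\<And>x. 0 < u x" "\<And>x. 0 \<le> u' x" and
    v: "primitive v v'" "primitive v' (\<lambda>x. q x * v x)" "\<And>x. 0 < v x" "\<And>x. v' x \<le> 0" and
    W: "\<And>x. u' x * v x - u x * v' x = 1"
    using fundamental_system by blast
  define G where "G x t = (if t \<le> x then u t * v x else u x * v t)" for x t
  have Gpos: "0 < G x t" for x t using u(3) v(3) by (simp add: G_def)
  have Gb: "G x t \<le> sqrt (rad x * rad t) * exp (- \<bar>R t - R x\<bar> / 2)" for x t
  proof (cases "t \<le> x")
    case True
    then have "- \<bar>R t - R x\<bar> = - (R x - R t)" using R_mono[OF True] by simp
    then show ?thesis using green_bound[OF u v W True] True by (simp add: G_def mult.commute)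
  next
    case False
    then have "x \<le> t" "- \<bar>R t - R x\<bar> = - (R t - R x)" using R_mono[of x t] by auto
    then show ?thesis using green_bound[OF u v W, of x t] False by (simp add: G_def)
  qed
  define k where "k x t = M * (min (1 / rad x) (1 / rad t) * exp (- \<bar>R t - R x\<bar> / 4))" for x t
  have knn: "0 \<le> k x t" for x t using M less_imp_le[OF rad(1)] by (simp add: k_def)
  have Gk: "\<mu> x * G x t \<le> k x t * \<theta> t" for x t
  proof -
    have "\<mu> x / \<theta> t * G x t \<le> \<mu> x / \<theta> t * (sqrt (rad x * rad t) * exp (- \<bar>R t - R x\<bar> / 2))"
      using \<mu>_pos[of x] \<theta>_pos[of t] by (intro mult_left_mono Gb) simp
    also have "\<dots> \<le> k x t" using Kb[of x t] by (simp add: k_def)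
    finally show ?thesis using \<theta>_pos[of t] by (simp add: field_simps)
  qed
  \<comment> \<open>The decay rate 1/4 makes the exponential integral at most
    \<open>2 / (1 / 4) = 8\<close>.\<close>
  define C where "C = 8 * M"
  have C: "0 < C" using M by (simp add: C_def)
  have int_exp: "(\<integral>\<^sup>+t. ennreal (M * (1 / rad t * exp (- \<bar>R t - R x\<bar> / 4))) \<partial>lborel) \<le> ennreal C" for x
  proof -
    have "(\<integral>\<^sup>+t. ennreal (M * (1 / rad t * exp (- \<bar>R t - R x\<bar> / 4))) \<partial>lborel) =
        (\<integral>\<^sup>+t. ennreal M * ennreal (1 / rad t * exp (- (1 / 4) * \<bar>R t - R x\<bar>)) \<partial>lborel)"
      using M less_imp_le[OF rad(1)] by (intro nn_integral_cong) (simp add: ennreal_mult[symmetric])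
    also have "\<dots> = ennreal M * (\<integral>\<^sup>+t. ennreal (1 / rad t * exp (- (1 / 4) * \<bar>R t - R x\<bar>)) \<partial>lborel)"
      by (rule nn_integral_cmult) measurable
    also have "\<dots> \<le> ennreal M * ennreal (2 / (1 / 4))" by (intro mult_left_mono nn_integral_exp_R) auto
    also have "\<dots> = ennreal (M * (2 / (1 / 4)))" using M by (intro ennreal_mult[symmetric]) auto
    also have "M * (2 / (1 / 4)) = C" by (simp add: C_def)
    finally show ?thesis .
  qed
  have k1: "(\<integral>\<^sup>+t. ennreal (k x t) \<partial>lborel) \<le> ennreal C" for x
  proof (rule order_trans[OF nn_integral_mono int_exp[of x]])
    show "ennreal (k x t) \<le> ennreal (M * (1 / rad t * exp (- \<bar>R t - R x\<bar> / 4)))" for t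
      unfolding k_def using M by (intro ennreal_leI mult_left_mono mult_right_mono) auto
  qed
  have k2: "(\<integral>\<^sup>+x. ennreal (k x t) \<partial>lborel) \<le> ennreal C" for t
  proof (rule order_trans[OF nn_integral_mono int_exp[of t]])
    show "ennreal (k x t) \<le> ennreal (M * (1 / rad x * exp (- \<bar>R x - R t\<bar> / 4)))" for x
      unfolding k_def abs_minus_commute[of "R t" "R x"] using M
      by (intro ennreal_leI mult_left_mono mult_right_mono) auto
  qed
  have kmeas [measurable]: "case_prod k \<in> borel_measurable (borel \<Otimes>\<^sub>M borel)"
    unfolding k_def case_prod_beta by measurable
  have kx [measurable]: "k x \<in> borel_measurable borel" for x
    using measurable_compose[OF measurable_Pair1'[of x borel borel] kmeas] by simp
  have umeas [measurable]: "u \<in> borel_measurable borel" "v \<in> borel_measurable borel"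
    by (rule borel_measurable_continuous_onI[OF primitive_continuous], rule u v)+
  have \<theta>meas [measurable]: "\<theta> \<in> borel_measurable borel" by (rule borel_measurable_continuous_onI[OF \<theta>_cont])
  show thesis
  proof (rule that[OF C])
    fix f assume fm [measurable]: "f \<in> borel_measurable borel" and floc: "L1_loc f"
      and fint: "integrable lebesgue (\<lambda>x. \<bar>\<theta> x * f x\<bar> powr p)"
    define g where "g t = \<theta> t * \<bar>f t\<bar>" for t
    have gm [measurable]: "g \<in> borel_measurable borel" unfolding g_def by measurable
    have gnn: "0 \<le> g t" for t using \<theta>_pos[of t] by (simp add: g_def)
    have g_eq: "g t = \<bar>\<theta> t * f t\<bar>" for t using \<theta>_pos[of t] by (simp add: g_def abs_mult)
    define N where "N = (LINT x|lebesgue. \<bar>\<theta> x * f x\<bar> powr p)"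
    have N0: "0 \<le> N" unfolding N_def by (rule integral_nonneg_AE) simp
    have gN: "(\<integral>\<^sup>+t. ennreal (g t powr p) \<partial>lborel) = ennreal N"
      using nn_integral_eq_integral[OF fint] by (simp add: g_eq N_def nn_integral_completion)
    \<comment> \<open>The formula for \<open>y\<close> needs convergence at every single
      \<open>x\<close>. Splitting \<open>g \<le> 1 + g powr p\<close> leaves the row integral of the
      kernel and, as the kernel is at most \<open>M / rad x\<close>, a multiple of
      \<open>N\<close>.\<close>
    have kg_fin: "(\<integral>\<^sup>+t. ennreal (k x t * g t) \<partial>lborel) < \<infinity>" for x
    proof -
      have "(\<integral>\<^sup>+t. ennreal (k x t * g t) \<partial>lborel) \<le>
          (\<integral>\<^sup>+t. ennreal (k x t) + ennreal (M / rad x) * ennreal (g t powr p) \<partial>lborel)"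
      proof (rule nn_integral_mono)
        fix t
        have "g t \<le> 1 + g t powr p" by (rule le_one_plus_powr[OF p gnn])
        then have "k x t * g t \<le> k x t * (1 + g t powr p)" using knn by (rule mult_left_mono)
        also have "k x t * (1 + g t powr p) = k x t + k x t * g t powr p" by (simp add: algebra_simps)
        also have "\<dots> \<le> k x t + M / rad x * g t powr p"
        proof -
          have "k x t \<le> M * (1 / rad x * 1)"
            unfolding k_def using M less_imp_le[OF rad(1)] by (intro mult_left_mono mult_mono) auto
          then show ?thesis by (intro add_left_mono mult_right_mono) auto
        qed
        finally have "ennreal (k x t * g t) \<le> ennreal (k x t + M / rad x * g t powr p)" by (rule ennreal_leI)
        also have "\<dots> = ennreal (k x t) + ennreal (M / rad x) * ennreal (g t powr p)"
        proof -
          have M': "0 \<le> M / rad x" using M less_imp_le[OF rad(1)] by simp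
          have "ennreal (M / rad x * g t powr p) = ennreal (M / rad x) * ennreal (g t powr p)"
            by (rule ennreal_mult[OF M']) simp
          moreover have "0 \<le> M / rad x * g t powr p" by (rule mult_nonneg_nonneg[OF M']) simp
          ultimately show ?thesis using ennreal_plus[OF knn[of x t]] by metis
        qed
        finally show "ennreal (k x t * g t) \<le> ennreal (k x t) + ennreal (M / rad x) * ennreal (g t powr p)" .
      qed
      also have "\<dots> = (\<integral>\<^sup>+t. ennreal (k x t) \<partial>lborel) + ennreal (M / rad x) * ennreal N"
        unfolding gN[symmetric] by (subst nn_integral_add) (auto simp: nn_integral_cmult)
      also have "\<dots> < \<infinity>"
        using le_less_trans[OF k1[of x] ennreal_less_top] by (simp add: ennreal_mult[symmetric] N0 ennreal_mult_less_top)
      finally show ?thesis .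
    qed
    have Gf: "ennreal (\<mu> x) * ennreal (G x t * \<bar>f t\<bar>) \<le> ennreal (k x t * g t)" for x t
    proof -
      have "\<mu> x * G x t * \<bar>f t\<bar> \<le> k x t * \<theta> t * \<bar>f t\<bar>" by (intro mult_right_mono Gk) simp
      then show ?thesis
        using less_imp_le[OF \<mu>_pos[of x]] less_imp_le[OF Gpos[of x t]]
        by (subst ennreal_mult[symmetric]) (auto simp: g_def mult_ac intro!: ennreal_leI)
    qed
    have Gm [measurable]: "(\<lambda>t. G x t) \<in> borel_measurable borel" for x unfolding G_def by measurable
    have Gf_fin: "(\<integral>\<^sup>+t. ennreal (G x t * \<bar>f t\<bar>) \<partial>lborel) < \<infinity>" for x
    proof -
      have "ennreal (\<mu> x) * (\<integral>\<^sup>+t. ennreal (G x t * \<bar>f t\<bar>) \<partial>lborel) \<le> (\<integral>\<^sup>+t. ennreal (k x t * g t) \<partial>lborel)"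
        by (subst nn_integral_cmult[symmetric]) (auto intro!: nn_integral_mono Gf)
      also have "\<dots> < \<infinity>" by (rule kg_fin)
      finally show ?thesis using \<mu>_pos[of x] by (auto simp: ennreal_mult_less_top)
    qed
    \<comment> \<open>On a half-line the Green function is a constant times one solution:
      \<open>v x * u t\<close> to the left of \<open>x\<close> and \<open>u x * v t\<close> to the
      right.\<close>
    have int_part: "set_integrable lebesgue S (\<lambda>t. w t * f t)"
      if S: "S \<in> sets borel" and w: "w \<in> borel_measurable borel" and w0: "\<And>t. 0 < w t" and c: "0 < c"
        and wG: "\<And>t. t \<in> S \<Longrightarrow> c * w t = G x t" for S w c x
    proof -
      note [measurable] = S w
      let ?n = "\<lambda>t. ennreal (norm (indicat_real S t *\<^sub>R (w t * f t)))"
      show ?thesis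
        unfolding set_integrable_def
      proof (rule integrableI_bounded)
        show "(\<lambda>t. indicat_real S t *\<^sub>R (w t * f t)) \<in> borel_measurable lebesgue"
          by (intro measurable_completion) measurable
        have "ennreal c * (\<integral>\<^sup>+t. ?n t \<partial>lborel) \<le>
            (\<integral>\<^sup>+t. ennreal (G x t * \<bar>f t\<bar>) \<partial>lborel)"
        proof (subst nn_integral_cmult[symmetric])
          show "(\<integral>\<^sup>+t. ennreal c * ?n t \<partial>lborel) \<le>
            (\<integral>\<^sup>+t. ennreal (G x t * \<bar>f t\<bar>) \<partial>lborel)"
          proof (rule nn_integral_mono)
            fix t
            show "ennreal c * ?n t \<le> ennreal (G x t * \<bar>f t\<bar>)"
            proof (cases "t \<in> S")
              case True
              then show ?thesis using c w0[of t] wG[OF True, symmetric] by (simp add: ennreal_mult[symmetric] abs_mult)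
            qed simp
          qed
        qed measurable
        also have "\<dots> < \<infinity>" by (rule Gf_fin)
        finally show "(\<integral>\<^sup>+t. ?n t \<partial>lebesgue) < \<infinity>"
          using c by (auto simp: ennreal_mult_less_top nn_integral_completion)
      qed
    qed
    have intA: "set_integrable lebesgue {..x} (\<lambda>t. u t * f t)" for x
      by (rule int_part[of _ _ "v x" x]) (use u(3) v(3) in \<open>auto simp: G_def\<close>)
    have intB: "set_integrable lebesgue {x<..} (\<lambda>t. v t * f t)" for x
      by (rule int_part[of _ _ "u x" x]) (use u(3) v(3) in \<open>auto simp: G_def\<close>)
    have uf: "L1_loc (\<lambda>t. u t * f t)" and vf: "L1_loc (\<lambda>t. v t * f t)"
      using L1_loc_mult_continuous[OF floc primitive_continuous[OF u(1)]]
        L1_loc_mult_continuous[OF floc primitive_continuous[OF v(1)]] by (simp_all add: mult.commute)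
    define A where "A x = (LINT t:{..x}|lebesgue. u t * f t)" for x
    define B where "B x = (LINT t:{x<..}|lebesgue. v t * f t)" for x
    have A: "primitive A (\<lambda>t. u t * f t)" unfolding A_def by (rule primitive_lower_integral[OF uf intA])
    have B: "primitive B (\<lambda>t. - (v t * f t))" unfolding B_def by (rule primitive_upper_integral[OF vf intB])
    define y where "y x = v x * A x + u x * B x" for x
    define z where "z x = v' x * A x + u' x * B x" for x
    have y: "primitive y z"
    proof -
      have e: "(\<lambda>x. (v' x * A x + u x * f x * v x) + (u' x * B x + - (v x * f x) * u x)) = z"
        by (auto simp: z_def)
      show ?thesis
        using primitive_add[OF primitive_mult[OF v(1) A] primitive_mult[OF u(1) B]]
        unfolding e by (simp add: y_def[abs_def])
    qed
    have z: "primitive z (\<lambda>x. q x * y x - f x)"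
    proof -
      \<comment> \<open>The terms in \<open>f\<close> combine to \<open>- f x\<close> times the
        Wronskian, which is 1.\<close>
      have e: "(q x * v x * A x + u x * f x * v' x) + (q x * u x * B x + - (v x * f x) * u' x) = q x * y x - f x" for x
      proof -
        have "q x * y x - f x = q x * y x - f x * (u' x * v x - u x * v' x)" by (simp add: W)
        then show ?thesis by (simp add: y_def algebra_simps)
      qed
      show ?thesis
        using primitive_add[OF primitive_mult[OF v(2) A] primitive_mult[OF u(2) B]]
        unfolding e by (simp add: z_def[abs_def])
    qed
    have ycont: "continuous_on UNIV y" by (rule primitive_continuous[OF y])
    have ybound: "ennreal \<bar>\<mu> x * y x\<bar> \<le> (\<integral>\<^sup>+t. ennreal (k x t * g t) \<partial>lborel)" for x
    proof -
      have part: "ennreal \<bar>c * (LINT t:S|lebesgue. w t * f t)\<bar> \<le> (\<integral>\<^sup>+t\<in>S. ennreal (c * w t * \<bar>f t\<bar>) \<partial>lborel)"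
        if S: "S \<in> sets borel" and w: "w \<in> borel_measurable borel" and w0: "\<And>t. 0 < w t" and c: "0 < c"
          and int: "set_integrable lebesgue S (\<lambda>t. w t * f t)" for S w c
      proof -
        note [measurable] = S w
        let ?n = "\<lambda>t. ennreal (norm (indicat_real S t *\<^sub>R (w t * f t)))"
        have "ennreal \<bar>c * (LINT t:S|lebesgue. w t * f t)\<bar> = ennreal c * ennreal (norm (LINT t:S|lebesgue. w t * f t))"
          using c by (simp add: abs_mult ennreal_mult)
        also have "\<dots> \<le> ennreal c * (\<integral>\<^sup>+t. ?n t \<partial>lebesgue)"
          unfolding set_lebesgue_integral_def
          by (intro mult_left_mono integral_norm_bound_ennreal int[unfolded set_integrable_def]) simp
        also have "\<dots> = ennreal c * (\<integral>\<^sup>+t. ?n t \<partial>lborel)"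
          by (simp add: nn_integral_completion)
        also have "\<dots> = (\<integral>\<^sup>+t. ennreal c * ?n t \<partial>lborel)"
          by (rule nn_integral_cmult[symmetric]) measurable
        also have "\<dots> = (\<integral>\<^sup>+t\<in>S. ennreal (c * w t * \<bar>f t\<bar>) \<partial>lborel)"
        proof (rule nn_integral_cong)
          fix t
          show "ennreal c * ?n t = ennreal (c * w t * \<bar>f t\<bar>) * indicator S t"
            using c w0[of t] by (cases "t \<in> S") (auto simp: ennreal_mult[symmetric] abs_mult mult.assoc)
        qed
        finally show ?thesis .
      qed
      have "\<bar>\<mu> x * y x\<bar> \<le> \<bar>\<mu> x * v x * A x\<bar> + \<bar>\<mu> x * u x * B x\<bar>"
      proof -
        have "\<mu> x * y x = \<mu> x * v x * A x + \<mu> x * u x * B x" by (simp add: y_def algebra_simps)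
        then show ?thesis using abs_triangle_ineq by metis
      qed
      then have "ennreal \<bar>\<mu> x * y x\<bar> \<le> ennreal (\<bar>\<mu> x * v x * A x\<bar> + \<bar>\<mu> x * u x * B x\<bar>)" by (rule ennreal_leI)
      also have "\<dots> = ennreal \<bar>\<mu> x * v x * A x\<bar> + ennreal \<bar>\<mu> x * u x * B x\<bar>" by simp
      also have "\<dots> \<le> (\<integral>\<^sup>+t\<in>{..x}. ennreal (\<mu> x * v x * u t * \<bar>f t\<bar>) \<partial>lborel) +
          (\<integral>\<^sup>+t\<in>{x<..}. ennreal (\<mu> x * u x * v t * \<bar>f t\<bar>) \<partial>lborel)"
        unfolding A_def B_def using \<mu>_pos[of x] u(3) v(3)
        by (intro add_mono part intA intB umeas) auto
      also have "\<dots> = (\<integral>\<^sup>+t. ennreal (\<mu> x * v x * u t * \<bar>f t\<bar>) * indicator {..x} t +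
          ennreal (\<mu> x * u x * v t * \<bar>f t\<bar>) * indicator {x<..} t \<partial>lborel)"
        by (rule nn_integral_add[symmetric]) measurable
      also have "\<dots> \<le> (\<integral>\<^sup>+t. ennreal (k x t * g t) \<partial>lborel)"
      proof (rule nn_integral_mono)
        fix t
        have "ennreal (\<mu> x * v x * u t * \<bar>f t\<bar>) * indicator {..x} t + ennreal (\<mu> x * u x * v t * \<bar>f t\<bar>) * indicator {x<..} t
            = ennreal (\<mu> x) * ennreal (G x t * \<bar>f t\<bar>)"
          using less_imp_le[OF \<mu>_pos[of x]] less_imp_le[OF Gpos[of x t]]
          by (subst ennreal_mult[symmetric]) (auto simp: G_def mult_ac)
        then show "ennreal (\<mu> x * v x * u t * \<bar>f t\<bar>) * indicator {..x} t + ennreal (\<mu> x * u x * v t * \<bar>f t\<bar>) * indicator {x<..} t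
            \<le> ennreal (k x t * g t)" using Gf[of x t] by simp
      qed
      finally show ?thesis .
    qed
    have S: "(\<integral>\<^sup>+x. ennreal (\<bar>\<mu> x * y x\<bar> powr p) \<partial>lborel) \<le> ennreal (C powr p) * (\<integral>\<^sup>+t. ennreal (g t powr p) \<partial>lborel)"
      by (rule schur_test[OF p C kmeas gm knn gnn abs_ge_zero k1 k2 ybound])
    then have S': "(\<integral>\<^sup>+x. ennreal (\<bar>\<mu> x * y x\<bar> powr p) \<partial>lebesgue) \<le> ennreal (C powr p * N)"
      using N0 by (simp add: gN ennreal_mult nn_integral_completion)
    have "continuous_on UNIV (\<lambda>x. \<bar>\<mu> x * y x\<bar> powr p)"
      using p by (intro continuous_abs_powr continuous_intros \<mu>_cont ycont) auto
    then have my: "(\<lambda>x. \<bar>\<mu> x * y x\<bar> powr p) \<in> borel_measurable lebesgue"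
      by (intro measurable_completion) (simp add: borel_measurable_continuous_onI)
    have yint: "integrable lebesgue (\<lambda>x. \<bar>\<mu> x * y x\<bar> powr p)"
      by (rule integrableI_bounded[OF my]) (use le_less_trans[OF S' ennreal_less_top] in simp)
    have "ennreal (LINT x|lebesgue. \<bar>\<mu> x * y x\<bar> powr p) \<le> ennreal (C powr p * N)"
      using S' nn_integral_eq_integral[OF yint] by simp
    then have "(LINT x|lebesgue. \<bar>\<mu> x * y x\<bar> powr p) \<le> C powr p * N"
      using N0 by (subst (asm) ennreal_le_iff) auto
    then show "\<exists>y z. primitive y z \<and> primitive z (\<lambda>x. q x * y x - f x) \<and>
        integrable lebesgue (\<lambda>x. \<bar>\<mu> x * y x\<bar> powr p) \<and>
        (LINT x|lebesgue. \<bar>\<mu> x * y x\<bar> powr p) \<le> C powr p * (LINT x|lebesgue. \<bar>\<theta> x * f x\<bar> powr p)"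
      using y z yint unfolding N_def by blast
  qed
qed

end

section \<open>From the bounded supremum to admissibility\<close>

context agreeing_weights
begin

lemma weighted_solution_unique:
  assumes y1: "is_solution q f y1" "y1 \<in> Lp_weighted p \<mu>" and y2: "is_solution q f y2" "y2 \<in> Lp_weighted p \<mu>"
    and f: "L1_loc f"
  shows "y1 = y2"
proof -
  obtain z1 where z1: "primitive y1 z1" "primitive z1 (\<lambda>x. q x * y1 x - f x)"
    using y1(1) is_solution_iff_primitive[OF q_loc f] by blast
  obtain z2 where z2: "primitive y2 z2" "primitive z2 (\<lambda>x. q x * y2 x - f x)"
    using y2(1) is_solution_iff_primitive[OF q_loc f] by blast
  have d: "primitive (\<lambda>x. y1 x - y2 x) (\<lambda>x. z1 x - z2 x)"
    using primitive_add[OF z1(1) primitive_minus[OF z2(1)]] by simp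
  have "(\<lambda>x. (q x * y1 x - f x) + - (q x * y2 x - f x)) = (\<lambda>x. q x * (y1 x - y2 x))"
    by (simp add: algebra_simps)
  then have d': "primitive (\<lambda>x. z1 x - z2 x) (\<lambda>x. q x * (y1 x - y2 x))"
    using primitive_add[OF z1(2) primitive_minus[OF z2(2)]] by simp
  have "integrable lebesgue (\<lambda>x. \<bar>\<mu> x * (y1 x - y2 x)\<bar> powr p)"
    using y1(2) y2(2)
    by (intro Lp_weighted_diff_integrable primitive_continuous[OF z1(1)] primitive_continuous[OF z2(1)])
      (auto simp: Lp_weighted_def)
  then have "y1 x - y2 x = 0" for x by (rule homogeneous_solution_zero[OF d d'])
  then show ?thesis by (intro ext) simp
qed

lemma bounded_imp_admissible:
  assumes m: "\<And>x. \<mu> x / \<theta> x * (rad x)\<^sup>2 \<le> m"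
  shows "admissible p \<mu> \<theta> q"
proof -
  obtain C where C: "0 < C" and sol:
    "\<And>f. f \<in> borel_measurable borel \<Longrightarrow> L1_loc f \<Longrightarrow> integrable lebesgue (\<lambda>x. \<bar>\<theta> x * f x\<bar> powr p) \<Longrightarrow>
      \<exists>y z. primitive y z \<and> primitive z (\<lambda>x. q x * y x - f x) \<and>
        integrable lebesgue (\<lambda>x. \<bar>\<mu> x * y x\<bar> powr p) \<and>
        (LINT x|lebesgue. \<bar>\<mu> x * y x\<bar> powr p) \<le> C powr p * (LINT x|lebesgue. \<bar>\<theta> x * f x\<bar> powr p)"
    using solution_exists_bounded[OF m] by blast
  have ex: "\<exists>y. is_solution q f y \<and> y \<in> Lp_weighted p \<mu> \<and> norm_weighted p \<mu> y \<le> C * norm_weighted p \<theta> f"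
    if f: "f \<in> Lp_weighted p \<theta>" for f
  proof -
    have floc: "L1_loc f" using f by (intro Lp_loc_imp_L1_loc[OF p]) (simp add: Lp_weighted_def)
    have fm: "f \<in> borel_measurable lebesgue" and fint: "integrable lebesgue (\<lambda>x. \<bar>\<theta> x * f x\<bar> powr p)"
      using f by (auto simp: Lp_weighted_def Lp_loc_def)
    \<comment> \<open>A Borel representative of \<open>f\<close>: neither the norms nor the
      indefinite integral \<open>z\<close> notice the change on a null set.\<close>
    obtain f0 where f0: "f0 \<in> borel_measurable lborel" and ae0: "AE x in lborel. f x = f0 x"
      using completion_ex_borel_measurable_real[OF fm] by blast
    have ae: "AE x in lebesgue. f x = f0 x" by (rule AE_completion[OF ae0])
    have f0m: "f0 \<in> borel_measurable borel" using f0 by simp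
    have \<theta>m: "\<theta> \<in> borel_measurable borel" by (rule borel_measurable_continuous_onI[OF \<theta>_cont])
    have m0: "(\<lambda>x. \<bar>\<theta> x * f0 x\<bar> powr p) \<in> borel_measurable lebesgue"
      by (rule measurable_completion) (use f0m \<theta>m in simp)
    have ae': "AE x in lebesgue. \<bar>\<theta> x * f x\<bar> powr p = \<bar>\<theta> x * f0 x\<bar> powr p" using ae by eventually_elim simp
    have int0: "integrable lebesgue (\<lambda>x. \<bar>\<theta> x * f0 x\<bar> powr p)"
      using fint integrable_cong_AE[OF borel_measurable_integrable[OF fint] m0 ae'] by blast
    have eq: "(LINT x|lebesgue. \<bar>\<theta> x * f x\<bar> powr p) = (LINT x|lebesgue. \<bar>\<theta> x * f0 x\<bar> powr p)"
      by (rule integral_cong_AE[OF borel_measurable_integrable[OF fint] m0 ae'])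
    obtain y z where y: "primitive y z" and z0: "primitive z (\<lambda>x. q x * y x - f0 x)"
      and yint: "integrable lebesgue (\<lambda>x. \<bar>\<mu> x * y x\<bar> powr p)"
      and le: "(LINT x|lebesgue. \<bar>\<mu> x * y x\<bar> powr p) \<le> C powr p * (LINT x|lebesgue. \<bar>\<theta> x * f0 x\<bar> powr p)"
      using sol[OF f0m L1_loc_cong_AE[OF floc ae] int0] by blast
    have z: "primitive z (\<lambda>x. q x * y x - f x)"
      by (rule primitive_cong_AE[OF z0]) (use ae in eventually_elim, simp)
    have "is_solution q f y" using is_solution_iff_primitive[OF q_loc floc] y z by blast
    moreover have "y \<in> Lp_weighted p \<mu>"
      using continuous_in_Lp_loc[OF primitive_continuous[OF y]] p yint by (simp add: Lp_weighted_def)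
    moreover have "norm_weighted p \<mu> y \<le> C * norm_weighted p \<theta> f"
    proof -
      define I where "I = (LINT x|lebesgue. \<bar>\<theta> x * f x\<bar> powr p)"
      have I: "0 \<le> I" unfolding I_def by (rule integral_nonneg_AE) simp
      have "norm_weighted p \<mu> y \<le> (C powr p * I) powr (1 / p)"
        unfolding norm_weighted_def using le p
        by (intro powr_mono2) (auto simp: I_def eq intro!: integral_nonneg_AE)
      also have "\<dots> = C * I powr (1 / p)" using C I p by (simp add: powr_mult powr_powr)
      finally show ?thesis by (simp add: norm_weighted_def I_def)
    qed
    ultimately show ?thesis by blast
  qed
  have uniq: "y1 = y2" if "f \<in> Lp_weighted p \<theta>" "is_solution q f y1 \<and> y1 \<in> Lp_weighted p \<mu>"
    "is_solution q f y2 \<and> y2 \<in> Lp_weighted p \<mu>" for f y1 y2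
    using that by (intro weighted_solution_unique[of f] Lp_loc_imp_L1_loc[OF p]) (auto simp: Lp_weighted_def)
  show ?thesis unfolding admissible_def
  proof (intro conjI ballI)
    fix f assume f: "f \<in> Lp_weighted p \<theta>"
    obtain y where y: "is_solution q f y \<and> y \<in> Lp_weighted p \<mu>" using ex[OF f] by blast
    show "\<exists>!y. is_solution q f y \<and> y \<in> Lp_weighted p \<mu>"
    proof (rule ex1I[of _ y])
      show "is_solution q f y \<and> y \<in> Lp_weighted p \<mu>" by (rule y)
      show "y' = y" if "is_solution q f y' \<and> y' \<in> Lp_weighted p \<mu>" for y' by (rule uniq[OF f that y])
    qed
  next
    show "\<exists>c>0. \<forall>f \<in> Lp_weighted p \<theta>. \<forall>y. is_solution q f y \<and> y \<in> Lp_weighted p \<mu>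
        \<longrightarrow> norm_weighted p \<mu> y \<le> c * norm_weighted p \<theta> f"
    proof (intro exI conjI ballI allI impI)
      fix f y assume f: "f \<in> Lp_weighted p \<theta>" and y: "is_solution q f y \<and> y \<in> Lp_weighted p \<mu>"
      obtain y' where y': "is_solution q f y' \<and> y' \<in> Lp_weighted p \<mu>" "norm_weighted p \<mu> y' \<le> C * norm_weighted p \<theta> f"
        using ex[OF f] by blast
      have "y = y'" by (rule uniq[OF f y y'(1)])
      then show "norm_weighted p \<mu> y \<le> C * norm_weighted p \<theta> f" using y'(2) by simp
    qed (rule C)
  qed
qed

section \<open>Necessity: testing with an indicator function\<close>

text \<open>The Lipschitz bound keeps \<open>rad\<close> above \<open>rad x / 2\<close> on the
  window, so \<open>R\<close> has slope at most \<open>2 / rad x\<close> over a length of at most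
  \<open>rad x / 2\<close>.\<close>

lemma rad_near:
  assumes "\<bar>t - x\<bar> \<le> rad x / 2"
  shows "rad x / 2 \<le> rad t" "rad t \<le> 2 * rad x" "\<bar>R t - R x\<bar> \<le> 1"
proof -
  have lo: "rad x / 2 \<le> rad s" if "\<bar>s - x\<bar> \<le> rad x / 2" for s
    using rad_Lipschitz[of x s] that by simp
  show "rad x / 2 \<le> rad t" by (rule lo[OF assms])
  show "rad t \<le> 2 * rad x" using rad_Lipschitz[of t x] assms rad(1)[of x] by (simp add: abs_minus_commute)
  have inc: "R b - R a \<le> 1" if "a \<le> b" "b - a \<le> rad x / 2" "\<And>s. a \<le> s \<Longrightarrow> s \<le> b \<Longrightarrow> \<bar>s - x\<bar> \<le> rad x / 2" for a b
  proof -
    have "R b - R a \<le> 2 / rad x * b - 2 / rad x * a"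
    proof (rule DERIV_diff_mono[OF that(1) R_DERIV])
      fix s assume "a \<le> s" "s \<le> b"
      show "((*) (2 / rad x) has_real_derivative 2 / rad x) (at s)" by (auto intro!: derivative_eq_intros)
      have "rad x / 2 \<le> rad s" using lo that(3) \<open>a \<le> s\<close> \<open>s \<le> b\<close> by blast
      then show "1 / rad s \<le> 2 / rad x" using rad(1)[of x] rad(1)[of s] by (simp add: field_simps)
    qed
    also have "2 / rad x * b - 2 / rad x * a = 2 / rad x * (b - a)" by (simp add: right_diff_distrib)
    also have "\<dots> \<le> 2 / rad x * (rad x / 2)" using rad(1)[of x] that(2) by (intro mult_left_mono) auto
    also have "\<dots> = 1" using rad(1)[of x] by simp
    finally show ?thesis .
  qed
  show "\<bar>R t - R x\<bar> \<le> 1"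
  proof (cases "x \<le> t")
    case True
    then show ?thesis using inc[of x t] R_mono[OF True] assms by simp
  next
    case False
    then show ?thesis using inc[of t x] R_mono[of t x] assms by simp
  qed
qed

text \<open>At the maximum point \<xi> over the window, \<open>q * y \<le> y \<xi> * q\<close>
  bounds the second difference at \<open>x\<close> by \<open>2 * y \<xi> - s\<^sup>2\<close>; as
  \<open>y\<close> is nonnegative and \<open>y x \<le> y \<xi>\<close>, this yields
  \<open>s\<^sup>2 \<le> 4 * y \<xi>\<close>. From \<open>y'' \<ge> - 1\<close> the symmetric sum at
  distance \<open>h\<close> is then at least \<open>s\<^sup>2 / 2 - h\<^sup>2\<close>. Symmetric
  sums avoid the slope at \<xi>, which need not vanish at an end of the window.\<close>

lemma solution_large_near_maximum:
  assumes y: "primitive y z" and z: "primitive z (\<lambda>t. q t * y t - indicator {x - s..x + s} t)"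
    and s: "0 < s" "mass x s \<le> 2" and nn: "\<And>t. 0 \<le> y t"
  obtains \<xi> where "\<xi> \<in> {x - s..x + s}"
    "\<And>h. 0 \<le> h \<Longrightarrow> h \<le> s / 2 \<Longrightarrow> s\<^sup>2 / 4 \<le> y (\<xi> + h) + y (\<xi> - h)"
proof -
  have Dy: "(y has_real_derivative z t) (at t)" for t
    by (rule primitive_DERIV[OF y primitive_isCont[OF z]])
  have Dmass: "(mass x has_real_derivative (Q (x + t) - Q (x - t))) (at t)" for t
    by (rule primitive_DERIV[OF mass_primitive])
      (use Q_window_continuous(1)[of UNIV x] in \<open>simp add: continuous_on_eq_continuous_at\<close>)
  have Dsym: "((\<lambda>t. y (c + t) + y (c - t)) has_real_derivative z (c + t) - z (c - t)) (at t)" for c t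
    by (auto intro!: derivative_eq_intros DERIV_chain2[OF Dy])
  have "\<exists>\<xi>\<in>{x - s..x + s}. \<forall>t\<in>{x - s..x + s}. y t \<le> y \<xi>"
    by (rule continuous_attains_sup) (use s primitive_continuous[OF y] in auto)
  then obtain \<xi> where \<xi>: "\<xi> \<in> {x - s..x + s}" and max: "\<And>t. t \<in> {x - s..x + s} \<Longrightarrow> y t \<le> y \<xi>" by blast
  have "(y (x + s) + y (x - s)) - (y (x + 0) + y (x - 0)) \<le> (y \<xi> * mass x s - s\<^sup>2) - (y \<xi> * mass x 0 - 0\<^sup>2)"
  proof (rule DERIV_diff_mono[OF _ Dsym])
    show "0 \<le> s" using s by simp
    fix t assume t: "0 \<le> t" "t \<le> s"
    show "((\<lambda>t. y \<xi> * mass x t - t\<^sup>2) has_real_derivative y \<xi> * (Q (x + t) - Q (x - t)) - 2 * t) (at t)"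
      by (auto intro!: derivative_eq_intros Dmass)
    have pr: "primitive (\<lambda>t. y \<xi> * Q t + - t) (\<lambda>t. y \<xi> * q t + - 1)"
      by (intro primitive_add primitive_cmult Q_primitive DERIV_primitive) (auto intro!: derivative_eq_intros)
    have "integral {x - t..x + t} (\<lambda>t. q t * y t - indicator {x - s..x + s} t) \<le> integral {x - t..x + t} (\<lambda>t. y \<xi> * q t + - 1)"
    proof (rule integral_mono_AE_lebesgue)
      show "AE u in lebesgue. u \<in> {x - t..x + t} \<longrightarrow> q u * y u - indicator {x - s..x + s} u \<le> y \<xi> * q u + - 1"
        using q_nonneg
      proof eventually_elim
        case (elim u)
        show ?case
        proof
          assume "u \<in> {x - t..x + t}"
          then have u: "u \<in> {x - s..x + s}" using t by auto
          have "q u * y u \<le> q u * y \<xi>" by (rule mult_left_mono[OF max[OF u] elim])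
          then show "q u * y u - indicator {x - s..x + s} u \<le> y \<xi> * q u + - 1" using u by (simp add: mult.commute)
        qed
      qed
    qed (use primitive_integrable[OF z] primitive_integrable[OF pr] in auto)
    then show "z (x + t) - z (x - t) \<le> y \<xi> * (Q (x + t) - Q (x - t)) - 2 * t"
      using primitive_integral[OF z, of "x - t" "x + t"] primitive_integral[OF pr, of "x - t" "x + t"] t
      by (simp only: right_diff_distrib)
  qed
  moreover have "y \<xi> * mass x s \<le> y \<xi> * 2" by (rule mult_left_mono[OF s(2) nn])
  moreover have "y x \<le> y \<xi>" using max[of x] s by simp
  ultimately have big: "s\<^sup>2 / 4 \<le> y \<xi>" using nn[of "x + s"] nn[of "x - s"] by simp
  have "s\<^sup>2 / 4 \<le> y (\<xi> + h) + y (\<xi> - h)" if h: "0 \<le> h" "h \<le> s / 2" for h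
  proof -
    have "- h\<^sup>2 - (- 0\<^sup>2) \<le> (y (\<xi> + h) + y (\<xi> - h)) - (y (\<xi> + 0) + y (\<xi> - 0))"
    proof (rule DERIV_diff_mono[OF h(1) _ Dsym])
      fix t :: real assume t: "0 \<le> t" "t \<le> h"
      show "((\<lambda>t. - t\<^sup>2) has_real_derivative - 2 * t) (at t)" by (auto intro!: derivative_eq_intros)
      have "AE u in lebesgue. u \<in> {\<xi> - t..\<xi> + t} \<longrightarrow> - 1 \<le> q u * y u - indicator {x - s..x + s} u"
        using q_nonneg
      proof eventually_elim
        case (elim u)
        have "0 \<le> q u * y u" by (rule mult_nonneg_nonneg[OF elim nn])
        then show ?case by (simp add: indicator_def)
      qed
      from primitive_mono[OF z _ this] show "- 2 * t \<le> z (\<xi> + t) - z (\<xi> - t)" using t by simp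
    qed
    moreover have "h\<^sup>2 \<le> (s / 2)\<^sup>2" using h by (intro power_mono) auto
    ultimately show ?thesis using big by (simp add: power_divide)
  qed
  with \<xi> show thesis by (rule that)
qed

text \<open>For each \<open>h\<close> at least one of the two points \<open>\<xi> + h\<close>,
  \<open>\<xi> - h\<close> has value at least \<open>b\<close>. Hence the two integrands together
  are at least \<open>(\<mu>0 * b) powr p\<close>, and \<open>h\<close> ranges over length
  \<open>a\<close>.\<close>

lemma solution_norm_lower_bound:
  assumes \<xi>: "\<And>h. 0 \<le> h \<Longrightarrow> h \<le> a \<Longrightarrow> 2 * b \<le> y (\<xi> + h) + y (\<xi> - h)" and a: "0 \<le> a" and b: "0 \<le> b"
    and y: "continuous_on UNIV y" and int: "integrable lebesgue (\<lambda>t. \<bar>\<mu> t * y t\<bar> powr p)"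
    and \<mu>0: "0 \<le> \<mu>0" "\<And>t. \<bar>t - \<xi>\<bar> \<le> a \<Longrightarrow> \<mu>0 \<le> \<mu> t"
  shows "(\<mu>0 * b) powr p * a \<le> (LINT t|lebesgue. \<bar>\<mu> t * y t\<bar> powr p)"
proof -
  define Y where "Y t = \<bar>\<mu> t * y t\<bar> powr p" for t
  have Yc: "continuous_on UNIV Y"
    unfolding Y_def using p by (intro continuous_abs_powr continuous_intros \<mu>_cont y) auto
  have Ynn: "0 \<le> Y t" for t by (simp add: Y_def)
  have YU: "(Y has_integral (LINT t|lebesgue. Y t)) UNIV"
    using has_integral_integral_lebesgue[OF int] by (simp add: Y_def[abs_def])
  define P where "P = integral0 Y"
  have P: "primitive P Y" unfolding P_def by (rule primitive_integral0[OF L1_loc_continuous[OF Yc]])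
  have DP: "(P has_real_derivative Y t) (at t)" for t
    by (rule primitive_DERIV[OF P]) (use Yc in \<open>simp add: continuous_on_eq_continuous_at\<close>)
  have one: "(\<mu>0 * b) powr p \<le> Y t" if "b \<le> y t" "\<bar>t - \<xi>\<bar> \<le> a" for t
    unfolding Y_def
  proof (rule powr_mono2)
    have "\<mu>0 * b \<le> \<mu> t * y t" using that \<mu>0 b \<mu>_pos[of t] by (intro mult_mono) auto
    then show "\<mu>0 * b \<le> \<bar>\<mu> t * y t\<bar>" by linarith
  qed (use p \<mu>0 b in auto)
  have "(\<mu>0 * b) powr p * a - (\<mu>0 * b) powr p * 0 \<le> (P (\<xi> + a) - P (\<xi> - a)) - (P (\<xi> + 0) - P (\<xi> - 0))"
  proof (rule DERIV_diff_mono[OF a])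
    fix h assume h: "0 \<le> h" "h \<le> a"
    show "((*) ((\<mu>0 * b) powr p) has_real_derivative (\<mu>0 * b) powr p) (at h)" by (auto intro!: derivative_eq_intros)
    show "((\<lambda>h. P (\<xi> + h) - P (\<xi> - h)) has_real_derivative Y (\<xi> + h) + Y (\<xi> - h)) (at h)"
      by (auto intro!: derivative_eq_intros DERIV_chain2[OF DP])
    have "b \<le> y (\<xi> + h) \<or> b \<le> y (\<xi> - h)" using \<xi>[OF h] by linarith
    then show "(\<mu>0 * b) powr p \<le> Y (\<xi> + h) + Y (\<xi> - h)"
      using one[of "\<xi> + h"] one[of "\<xi> - h"] h Ynn[of "\<xi> + h"] Ynn[of "\<xi> - h"] by auto
  qed
  then have "(\<mu>0 * b) powr p * a \<le> integral {\<xi> - a..\<xi> + a} Y"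
    using a by (simp add: primitive_integral[OF P])
  also have "\<dots> \<le> integral UNIV Y"
    by (rule integral_subset_le) (use primitive_integrable[OF P] Ynn YU in \<open>auto intro: has_integral_integrable\<close>)
  also have "\<dots> = (LINT t|lebesgue. Y t)" by (rule integral_unique[OF YU])
  finally show ?thesis by (simp add: Y_def)
qed

lemma indicator_in_Lp_weighted:
  fixes a b :: real
  shows "indicator {a..b} \<in> Lp_weighted p \<theta>"
    "\<lbrakk>a \<le> b; \<And>t. t \<in> {a..b} \<Longrightarrow> \<theta> t \<le> \<theta>0\<rbrakk> \<Longrightarrow>
      (LINT t|lebesgue. \<bar>\<theta> t * indicator {a..b} t\<bar> powr p) \<le> \<theta>0 powr p * (b - a)"
proof -
  have eq: "\<bar>\<theta> t * indicator {a..b} t\<bar> powr p = indicator {a..b} t *\<^sub>R (\<bar>\<theta> t\<bar> powr p)" for t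
    by (simp add: indicator_def)
  have \<theta>p: "continuous_on UNIV (\<lambda>t. \<bar>\<theta> t\<bar> powr p)" using p by (intro continuous_abs_powr \<theta>_cont) simp
  have si: "set_integrable lebesgue {a..b} (\<lambda>t. \<bar>\<theta> t\<bar> powr p)"
    using L1_loc_continuous[OF \<theta>p] by (simp add: L1_loc_def)
  have ind: "L1_loc (\<lambda>t. \<bar>indicat_real {a..b} t\<bar> powr p)"
  proof -
    have "set_integrable lebesgue {c..d} (\<lambda>t. \<bar>indicat_real {a..b} t\<bar> powr p)" for c d
    proof (rule set_integrable_bound)
      show "set_integrable lebesgue {c..d} (\<lambda>t. 1 :: real)"
        using L1_loc_continuous[of "\<lambda>t. 1"] by (simp add: L1_loc_def)
      show "set_borel_measurable lebesgue {c..d} (\<lambda>t. \<bar>indicat_real {a..b} t\<bar> powr p)"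
        unfolding set_borel_measurable_def by (intro measurable_completion) measurable
      show "AE t in lebesgue. t \<in> {c..d} \<longrightarrow> norm (\<bar>indicat_real {a..b} t\<bar> powr p) \<le> norm (1 :: real)"
        by (simp add: indicator_def)
    qed
    then show ?thesis by (simp add: L1_loc_def)
  qed
  have "indicat_real {a..b} \<in> borel_measurable lebesgue" by (rule borel_measurable_indicator) simp
  then show "indicator {a..b} \<in> Lp_weighted p \<theta>"
    using ind si by (simp add: Lp_weighted_def Lp_loc_def L1_loc_def eq set_integrable_def)
  assume ab: "a \<le> b" and \<theta>0: "\<And>t. t \<in> {a..b} \<Longrightarrow> \<theta> t \<le> \<theta>0"
  have "(LINT t|lebesgue. \<bar>\<theta> t * indicator {a..b} t\<bar> powr p) = integral {a..b} (\<lambda>t. \<bar>\<theta> t\<bar> powr p)"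
    unfolding eq using set_lebesgue_integral_eq_integral(2)[OF si] by (simp add: set_lebesgue_integral_def)
  also have "\<dots> \<le> integral {a..b} (\<lambda>t. \<theta>0 powr p)"
  proof (rule integral_le)
    show "(\<lambda>t. \<bar>\<theta> t\<bar> powr p) integrable_on {a..b}" by (rule L1_loc_integrable[OF L1_loc_continuous[OF \<theta>p]])
    show "\<bar>\<theta> t\<bar> powr p \<le> \<theta>0 powr p" if "t \<in> {a..b}" for t
      using \<theta>0[OF that] \<theta>_pos[of t] p by (intro powr_mono2) auto
    show "(\<lambda>t. \<theta>0 powr p) integrable_on {a..b}" by (rule integrable_on_const) simp
  qed
  also have "\<dots> = \<theta>0 powr p * (b - a)" using ab by simp
  finally show "(LINT t|lebesgue. \<bar>\<theta> t * indicator {a..b} t\<bar> powr p) \<le> \<theta>0 powr p * (b - a)" .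
qed

text \<open>Extracts p-th roots with a constant independent of \<open>p\<close>, using
  \<open>4 \<le> 4 powr p\<close>. The 4 is the ratio of the length \<open>2 * s\<close> of the
  support of the test function to the length \<open>s / 2\<close> in the lower bound.\<close>

lemma powr_le_4_mult:
  fixes a b :: real
  assumes "a powr p \<le> 4 * b powr p" "0 < b"
  shows "a \<le> 4 * b"
proof (rule ccontr)
  assume "\<not> a \<le> 4 * b"
  then have "(4 * b) powr p < a powr p" using assms(2) p by (intro powr_less_mono2) auto
  moreover have "(4 * b) powr p = 4 powr p * b powr p" using assms(2) by (simp add: powr_mult)
  moreover have "4 powr 1 \<le> (4 :: real) powr p" using p by (intro powr_mono) auto
  then have "4 * b powr p \<le> 4 powr p * b powr p" by (intro mult_right_mono) auto
  ultimately show False using assms(1) by linarith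
qed

lemma admissible_imp_bounded:
  assumes adm: "admissible p \<mu> \<theta> q"
  obtains m where "\<And>x. \<mu> x / \<theta> x * (rad x)\<^sup>2 \<le> m"
proof -
  obtain c where c: "0 < c" and bound: "\<And>f y. f \<in> Lp_weighted p \<theta> \<Longrightarrow> is_solution q f y \<Longrightarrow> y \<in> Lp_weighted p \<mu> \<Longrightarrow>
      norm_weighted p \<mu> y \<le> c * norm_weighted p \<theta> f"
    using adm unfolding admissible_def by blast
  obtain c0 where c0: "1 \<le> c0"
    and A: "\<And>t x. inverse c0 * exp (- 1 * \<bar>R t - R x\<bar>) \<le> sqrt (rad t / rad x) * (\<mu> t / \<mu> x)"
    and B: "\<And>t x. inverse c0 * exp (- 1 * \<bar>R t - R x\<bar>) \<le> sqrt (rad t / rad x) * (\<theta> x / \<theta> t)"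
    using agreement[OF zero_less_one] by metis
  \<comment> \<open>\<open>exp (- 1)\<close> comes from \<epsilon> = 1 and an increment of
    \<open>R\<close> of at most 1; the division by 2 absorbs
    \<open>sqrt (rad t / rad x) \<le> 2\<close>.\<close>
  define \<delta> where "\<delta> = inverse c0 * exp (- 1) / 2"
  have \<delta>: "0 < \<delta>" using c0 by (simp add: \<delta>_def)
  have near: "\<delta> * \<mu> x \<le> \<mu> t \<and> \<theta> t \<le> \<theta> x / \<delta>" if t: "\<bar>t - x\<bar> \<le> rad x / 2" for t x
  proof -
    have "rad t / rad x \<le> 2\<^sup>2" using rad_near(2)[OF t] rad(1)[of x] by (simp add: divide_le_eq)
    then have sq: "sqrt (rad t / rad x) \<le> 2" using real_sqrt_le_mono by fastforce
    have "exp (- 1) \<le> exp (- 1 * \<bar>R t - R x\<bar>)" using rad_near(3)[OF t] by simp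
    then have "inverse c0 * exp (- 1) \<le> inverse c0 * exp (- 1 * \<bar>R t - R x\<bar>)" using c0 by (intro mult_left_mono) auto
    then have lo: "2 * \<delta> \<le> inverse c0 * exp (- 1 * \<bar>R t - R x\<bar>)" by (simp add: \<delta>_def)
    have "2 * \<delta> \<le> 2 * (\<mu> t / \<mu> x)"
      using lo A[of t x] mult_right_mono[OF sq, of "\<mu> t / \<mu> x"] \<mu>_pos[of t] \<mu>_pos[of x] by simp
    moreover have "2 * \<delta> \<le> 2 * (\<theta> x / \<theta> t)"
      using lo B[of t x] mult_right_mono[OF sq, of "\<theta> x / \<theta> t"] \<theta>_pos[of t] \<theta>_pos[of x] by simp
    ultimately show ?thesis using \<mu>_pos[of x] \<theta>_pos[of t] \<delta> by (simp add: field_simps)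
  qed
  show thesis
  proof (rule that)
    fix x
    \<comment> \<open>Points within \<open>s / 2\<close> of \<xi>, itself within \<open>s\<close> of
      \<open>x\<close>, stay at distance at most \<open>3 * s / 2 < rad x / 2\<close> from
      \<open>x\<close>, so \<open>near\<close> applies to them.\<close>
    define s where "s = rad x / 4"
    have s: "0 < s" "rad x = 4 * s" using rad(1)[of x] by (simp_all add: s_def)
    have ms: "mass x s \<le> 2" using mass_mono[of s "rad x" x] rad(2)[of x] s by simp
    define f where "f = indicat_real {x - s..x + s}"
    have f: "f \<in> Lp_weighted p \<theta>" unfolding f_def by (rule indicator_in_Lp_weighted)
    have floc: "L1_loc f" using f by (intro Lp_loc_imp_L1_loc[OF p]) (simp add: Lp_weighted_def)
    obtain y where y: "is_solution q f y" "y \<in> Lp_weighted p \<mu>" using adm f unfolding admissible_def by blast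
    obtain z where z: "primitive y z" "primitive z (\<lambda>t. q t * y t - f t)"
      using y(1) is_solution_iff_primitive[OF q_loc floc] by blast
    have yint: "integrable lebesgue (\<lambda>t. \<bar>\<mu> t * y t\<bar> powr p)" using y(2) by (simp add: Lp_weighted_def)
    have ynn: "0 \<le> y t" for t by (rule solution_nonneg[OF z _ yint]) (simp add: f_def)
    obtain \<xi> where \<xi>: "\<xi> \<in> {x - s..x + s}"
      and large: "\<And>h. 0 \<le> h \<Longrightarrow> h \<le> s / 2 \<Longrightarrow> s\<^sup>2 / 4 \<le> y (\<xi> + h) + y (\<xi> - h)"
      using solution_large_near_maximum[OF z(1) z(2)[unfolded f_def] s(1) ms ynn] by blast
    have f_le: "(LINT t|lebesgue. \<bar>\<theta> t * f t\<bar> powr p) \<le> (\<theta> x / \<delta>) powr p * ((x + s) - (x - s))"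
      unfolding f_def
    proof (rule indicator_in_Lp_weighted(2))
      show "\<theta> t \<le> \<theta> x / \<delta>" if "t \<in> {x - s..x + s}" for t
      proof -
        have "\<bar>t - x\<bar> \<le> rad x / 2" using that s unfolding abs_le_iff atLeastAtMost_iff by linarith
        then show ?thesis using near by blast
      qed
    qed (use s in auto)
    have "(\<delta> * \<mu> x * (s\<^sup>2 / 8)) powr p * (s / 2) \<le> (LINT t|lebesgue. \<bar>\<mu> t * y t\<bar> powr p)"
    proof (rule solution_norm_lower_bound[OF _ _ _ primitive_continuous[OF z(1)] yint])
      show "2 * (s\<^sup>2 / 8) \<le> y (\<xi> + h) + y (\<xi> - h)" if "0 \<le> h" "h \<le> s / 2" for h using large[OF that] by simp
      show "\<delta> * \<mu> x \<le> \<mu> t" if "\<bar>t - \<xi>\<bar> \<le> s / 2" for t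
      proof -
        have "\<bar>t - x\<bar> \<le> rad x / 2" using that \<xi> s unfolding abs_le_iff atLeastAtMost_iff by linarith
        then show ?thesis using near by blast
      qed
    qed (use s \<delta> \<mu>_pos[of x] in auto)
    also have "\<dots> \<le> c powr p * (LINT t|lebesgue. \<bar>\<theta> t * f t\<bar> powr p)"
    proof -
      define I where "I = (LINT t|lebesgue. \<bar>\<mu> t * y t\<bar> powr p)"
      define N where "N = (LINT t|lebesgue. \<bar>\<theta> t * f t\<bar> powr p)"
      have nn: "0 \<le> I" "0 \<le> N" unfolding I_def N_def by (auto intro!: integral_nonneg_AE)
      have "I powr (1 / p) \<le> c * N powr (1 / p)" using bound[OF f y] by (simp add: norm_weighted_def I_def N_def)
      then have "(I powr (1 / p)) powr p \<le> (c * N powr (1 / p)) powr p" using p by (intro powr_mono2) auto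
      then show ?thesis using nn p c by (simp add: powr_powr powr_mult I_def N_def)
    qed
    also have "\<dots> \<le> c powr p * ((\<theta> x / \<delta>) powr p * ((x + s) - (x - s)))"
      by (rule mult_left_mono[OF f_le]) simp
    also have "\<dots> = 4 * (c * (\<theta> x / \<delta>)) powr p * (s / 2)"
      by (simp add: powr_mult[of c "\<theta> x / \<delta>"] del: times_divide_eq_right)
    finally have "(\<delta> * \<mu> x * (s\<^sup>2 / 8)) powr p \<le> 4 * (c * (\<theta> x / \<delta>)) powr p" using s by simp
    then have "\<delta> * \<mu> x * (s\<^sup>2 / 8) \<le> 4 * (c * (\<theta> x / \<delta>))"
      by (rule powr_le_4_mult) (use c \<delta> \<theta>_pos[of x] in auto)
    \<comment> \<open>The constant is \<open>8 * 4\<close> from the preceding inequality times 16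
      from \<open>(rad x)\<^sup>2 = 16 * s\<^sup>2\<close>.\<close>
    then show "\<mu> x / \<theta> x * (rad x)\<^sup>2 \<le> 512 * c / \<delta>\<^sup>2"
      using \<delta> \<theta>_pos[of x] by (simp add: s(2) field_simps power2_eq_square)
  qed
qed

end

theorem theorem4p7:
  fixes q \<mu> \<theta> :: "real \<Rightarrow> real" and p :: real
  assumes q_nonneg: "AE x in lebesgue. 0 \<le> q x"
    and q_loc: "L1_loc q"
    and q_left: "\<And>x. (\<integral>\<^sup>+t\<in>{..x}. ennreal (q t) \<partial>lebesgue) > 0"
    and q_right: "\<And>x. (\<integral>\<^sup>+t\<in>{x..}. ennreal (q t) \<partial>lebesgue) > 0"
    and \<mu>_weight: "continuous_on UNIV \<mu>" "\<And>x. \<mu> x > 0"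
    and \<theta>_weight: "continuous_on UNIV \<theta>" "\<And>x. \<theta> x > 0"
    and p: "1 \<le> p"
    and \<mu>_left: "(\<integral>\<^sup>+t\<in>{..0}. ennreal (\<mu> t) \<partial>lebesgue) = \<infinity>"
    and \<mu>_right: "(\<integral>\<^sup>+t\<in>{0..}. ennreal (\<mu> t) \<partial>lebesgue) = \<infinity>"
    and q_H: "q \<in> class_H"
    and agr: "agrees \<mu> \<theta> q"
  shows "admissible p \<mu> \<theta> q \<longleftrightarrow> m_fun q \<mu> \<theta> < \<infinity>"
proof -
  interpret agreeing_weights q \<mu> p \<theta>
    by unfold_locales (use assms in auto)
  have eq: "\<mu> x / \<theta> x * (d_fun q x)\<^sup>2 = \<mu> x / \<theta> x * (rad x)\<^sup>2 / 2" for x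
    by (simp add: d_fun_rad power_divide)
  show ?thesis
  proof
    assume "admissible p \<mu> \<theta> q"
    then obtain m where m: "\<And>x. \<mu> x / \<theta> x * (rad x)\<^sup>2 \<le> m" using admissible_imp_bounded by blast
    have "m_fun q \<mu> \<theta> \<le> ereal (m / 2)"
      unfolding m_fun_def eq by (rule SUP_least) (use m in simp)
    then show "m_fun q \<mu> \<theta> < \<infinity>" using le_less_trans by fastforce
  next
    assume fin: "m_fun q \<mu> \<theta> < \<infinity>"
    have le: "ereal (\<mu> x / \<theta> x * (rad x)\<^sup>2 / 2) \<le> m_fun q \<mu> \<theta>" for x
      unfolding m_fun_def eq by (rule SUP_upper) simp
    \<comment> \<open>The value is real: it is below infinity by assumption, and the term at 0 keeps
      it above minus infinity.\<close>
    obtain m where "m_fun q \<mu> \<theta> = ereal m" using fin le[of 0] by (cases "m_fun q \<mu> \<theta>") auto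
    then have "\<mu> x / \<theta> x * (rad x)\<^sup>2 \<le> 2 * m" for x using le[of x] by simp
    then show "admissible p \<mu> \<theta> q" by (rule bounded_imp_admissible)
  qed
qed

end
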